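(* For every Laurent phenomenon (LP) pattern over a unique factorization domain, the upper bound is mutation invariant: $\mathrm{UB}(t)=\mathrm{UB}(\mu_k t)$ for every seed $t$ of the pattern and every mutable index $k$. Consequently $\mathrm{UB}(t)=\mathcal U_{\mathrm{LP}}(t)$.
   Context: LP seeds (Lam–Pylyavskyy). Let $S$ be a unique factorization domain and $\mathcal F$ a field of rational functions in $r$ variables over $\mathrm{Frac}(S)$. A seed $t$ consists of algebraically independent mutable variables $x_1,\dots,x_r$ generating $\mathcal F$ over $\mathrm{Frac}(S)$, and exchange polynomials $E_i\in S[x_1,\dots,x_r]$, each irreducible, independent of $x_i$, and not divisible by any mutable variable. The associated exchange Laurent polynomial is $\widehat E_i=E_i\prod_{j\ne i}x_j^{-a_{ij}}$, where $a_{ij}\ge 0$ are the unique integers such that, for every $j\ne i$, the substitution $\widehat E_i|_{x_j\leftarrow E_j/X}$ lies in $S[X^{\pm1},x_k^{\pm1}:k\ne j]$ and is not divisible by $E_j$ in that ring. Mutation $\mu_i$ replaces $x_i$ by $x_i'=\widehat E_i/x_i$, keeps the other variables and $E_i$, and changes $E_j$ ($j\ne i$) as follows: if $E_j$ does not involve $x_i$ it is unchanged; otherwise substitute $x_i\leftarrow(\widehat E_i|_{x_j=0})/x_i'$ in $E_j$, remove all common factors with $\widehat E_i|_{x_j=0}$ in $S[x_k:k\ne i,j]$, and multiply by the Laurent monomial in the new variables other than $x_j$ that makes the result a polynomial divisible by no variable (everything up to units). An LP pattern is the collection of all seeds obtained from one seed by finite sequences of mutations; write $s\sim t$ if $s$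 is obtained from $t$ in this way. Put $L(t)=S[x_1^{\pm1},\dots,x_r^{\pm1}]$, $$\mathrm{UB}(t)=L(t)\cap\bigcap_{i=1}^r L(\mu_i t),\qquad \mathcal U_{\mathrm{LP}}(t)=\bigcap_{s\sim t}L(s),$$ all intersections being taken in $\mathcal F$. *)

theory Defs
  imports "HOL-Computational_Algebra.Computational_Algebra" "HOL-Library.Poly_Mapping"
begin

section \<open>Polynomials and Laurent polynomials\<close>

text \<open>
  The rank \<open>r\<close> is the cardinality of the finite, linearly ordered index type \<^typ>\<open>'i\<close>.
  A polynomial (Laurent polynomial) is a finitely supported function from exponent vectors in
  \<open>nat\<close> (in \<open>int\<close>) to coefficients, with the convolution product of \<open>Poly_Mapping\<close>; hence
  \<open>dvd\<close> and \<open>irreducible\<close> are those of the rings \<open>S[x_i]\<close> and \<open>S[x_i, 1/x_i]\<close>.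
\<close>

type_synonym ('i, 's) mpoly = "('i \<Rightarrow>\<^sub>0 nat) \<Rightarrow>\<^sub>0 's"
type_synonym ('i, 's) lpoly = "('i \<Rightarrow>\<^sub>0 int) \<Rightarrow>\<^sub>0 's"

definition mconst :: "'s::zero \<Rightarrow> ('e::zero \<Rightarrow>\<^sub>0 's)" where
  "mconst c = Poly_Mapping.single 0 c"

definition mvar :: "'i \<Rightarrow> (('i \<Rightarrow>\<^sub>0 'e::zero_neq_one) \<Rightarrow>\<^sub>0 's::zero_neq_one)" where
  "mvar i = Poly_Mapping.single (Poly_Mapping.single i 1) 1"

definition involves :: "'i \<Rightarrow> ('i, 's::zero) mpoly \<Rightarrow> bool" where
  "involves i p \<longleftrightarrow> (\<exists>m\<in>Poly_Mapping.keys p. Poly_Mapping.lookup m i \<noteq> 0)"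

definition mpoly_eval ::
  "('s::zero \<Rightarrow> 'r::comm_semiring_1) \<Rightarrow> ('i::finite \<Rightarrow> 'r) \<Rightarrow> ('i, 's) mpoly \<Rightarrow> 'r" where
  "mpoly_eval \<phi> y p = (\<Sum>m\<in>Poly_Mapping.keys p.
     \<phi> (Poly_Mapping.lookup p m) * (\<Prod>i\<in>UNIV. y i ^ Poly_Mapping.lookup m i))"

text \<open>Meaningful only at points all of whose coordinates are nonzero.\<close>

definition laurent_eval ::
  "('s::zero \<Rightarrow> 'f::field) \<Rightarrow> ('i::finite \<Rightarrow> 'f) \<Rightarrow> ('i, 's) lpoly \<Rightarrow> 'f" where
  "laurent_eval \<phi> y p = (\<Sum>m\<in>Poly_Mapping.keys p.
     \<phi> (Poly_Mapping.lookup p m) * (\<Prod>i\<in>UNIV. y i powi Poly_Mapping.lookup m i))"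

text \<open>The subring \<open>S[y_i, 1/y_i]\<close> of a field into which \<open>S\<close> is embedded by \<open>\<phi>\<close>.\<close>

definition laurent_ring :: "('s::zero \<Rightarrow> 'f::field) \<Rightarrow> ('i::finite \<Rightarrow> 'f) \<Rightarrow> 'f set" where
  "laurent_ring \<phi> y = range (laurent_eval \<phi> y)"

definition to_laurent :: "('i::finite, 's::comm_ring_1) mpoly \<Rightarrow> ('i, 's) lpoly" where
  "to_laurent = mpoly_eval mconst mvar"

text \<open>
  The part of \<open>p\<close> free of the variable \<open>j\<close>.  This is \<open>p\<close> at \<open>x_j = 0\<close> when \<open>p\<close> has no negative
  powers of \<open>x_j\<close>, the only case in which that substitution makes sense.
\<close>

definition set_zero :: "'i \<Rightarrow> ('i, 's::comm_monoid_add) lpoly \<Rightarrow> ('i, 's) lpoly" where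
  "set_zero j p = (\<Sum>m | m \<in> Poly_Mapping.keys p \<and> Poly_Mapping.lookup m j = 0.
     Poly_Mapping.single m (Poly_Mapping.lookup p m))"


section \<open>Seeds\<close>

definition ring_embedding :: "('s::comm_ring_1 \<Rightarrow> 'f::field) \<Rightarrow> bool" where
  "ring_embedding emb \<longleftrightarrow> inj emb \<and> emb 1 = 1 \<and>
     (\<forall>a b. emb (a + b) = emb a + emb b) \<and> (\<forall>a b. emb (a * b) = emb a * emb b)"

text \<open>\<open>Frac(S)\<close> as a subfield of the ambient field.\<close>

definition fraction_subfield :: "('s::comm_ring_1 \<Rightarrow> 'f::field) \<Rightarrow> 'f set" where
  "fraction_subfield emb = {emb a / emb b | a b. b \<noteq> 0}"

definition algebraically_independent_over :: "'f::field set \<Rightarrow> ('i::finite \<Rightarrow> 'f) \<Rightarrow> bool" where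
  "algebraically_independent_over K x \<longleftrightarrow>
     (\<forall>p :: ('i, 'f) mpoly. range (Poly_Mapping.lookup p) \<subseteq> K \<longrightarrow>
        mpoly_eval (\<lambda>c. c) x p = 0 \<longrightarrow> p = 0)"

definition generates_over :: "'f::field set \<Rightarrow> ('i::finite \<Rightarrow> 'f) \<Rightarrow> bool" where
  "generates_over K x \<longleftrightarrow>
     (\<forall>f. \<exists>p q :: ('i, 'f) mpoly.
        range (Poly_Mapping.lookup p) \<subseteq> K \<and> range (Poly_Mapping.lookup q) \<subseteq> K \<and>
        mpoly_eval (\<lambda>c. c) x q \<noteq> 0 \<and>
        f = mpoly_eval (\<lambda>c. c) x p / mpoly_eval (\<lambda>c. c) x q)"

text \<open>
  The exchange polynomials are kept as formal polynomials, whose variable \<open>i\<close> stands for the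
  cluster variable \<open>cvar t i\<close>.
\<close>

record (overloaded) ('i, 's, 'f) lp_seed =
  cvar :: "'i \<Rightarrow> 'f"
  expoly :: "'i \<Rightarrow> ('i \<Rightarrow>\<^sub>0 nat) \<Rightarrow>\<^sub>0 's"

definition is_lp_seed ::
  "('s::idom \<Rightarrow> 'f::field) \<Rightarrow> ('i::finite, 's, 'f) lp_seed \<Rightarrow> bool" where
  "is_lp_seed emb t \<longleftrightarrow>
     algebraically_independent_over (fraction_subfield emb) (cvar t) \<and>
     generates_over (fraction_subfield emb) (cvar t) \<and>
     (\<forall>i. irreducible (expoly t i) \<and> \<not> involves i (expoly t i) \<and>
          (\<forall>j. \<not> mvar j dvd expoly t i))"


section \<open>Exchange Laurent polynomials\<close>

definition rconst :: "'s::idom \<Rightarrow> ('i::{finite,linorder}, 's) mpoly fract" where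
  "rconst c = Fract (mconst c) 1"

definition rvar :: "'i::{finite,linorder} \<Rightarrow> ('i, 's::idom) mpoly fract" where
  "rvar i = Fract (mvar i) 1"

definition divide_by_monomial ::
  "('i::finite \<Rightarrow> ('i, 's::comm_ring_1) mpoly) \<Rightarrow> 'i \<Rightarrow> ('i \<Rightarrow> nat) \<Rightarrow> ('i, 's) lpoly" where
  "divide_by_monomial E i a =
     to_laurent (E i) * (\<Prod>j\<in>-{i}. Poly_Mapping.single (Poly_Mapping.single j (- int (a j))) 1)"

text \<open>
  After \<open>x_j\<close> has been replaced by \<open>E_j / X\<close>, the variable \<open>x_j\<close> no longer occurs (\<open>E_j\<close> does
  not involve it), so its formal variable is reused for \<open>X\<close>.  The value of \<open>a\<close> at \<open>i\<close> is
  irrelevant and fixed to be \<open>0\<close>.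
\<close>

definition is_exchange_exponents ::
  "('i::{finite,linorder} \<Rightarrow> ('i, 's::idom) mpoly) \<Rightarrow> 'i \<Rightarrow> ('i \<Rightarrow> nat) \<Rightarrow> bool" where
  "is_exchange_exponents E i a \<longleftrightarrow> a i = 0 \<and>
     (\<forall>j. j \<noteq> i \<longrightarrow>
        (let Ej = mpoly_eval rconst rvar (E j);
             p = laurent_eval rconst (rvar(j := Ej / rvar j)) (divide_by_monomial E i a)
         in p \<in> laurent_ring rconst rvar \<and>
            \<not> (\<exists>q\<in>laurent_ring rconst rvar. p = Ej * q)))"

definition exchange_laurent ::
  "('i::{finite,linorder} \<Rightarrow> ('i, 's::idom) mpoly) \<Rightarrow> 'i \<Rightarrow> ('i, 's) lpoly" where
  "exchange_laurent E i = divide_by_monomial E i (THE a. is_exchange_exponents E i a)"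


section \<open>Mutation\<close>

text \<open>
  \<open>H\<close> arises from \<open>G\<close> by dividing out factors of \<open>A\<close> lying in \<open>S[x_k : k \<notin> I]\<close> until \<open>H\<close> and \<open>A\<close>
  have no such common factor left.  Divisibility is that of the Laurent polynomial ring, as \<open>G\<close>
  and \<open>A\<close> may have monomial denominators; so monomials do not count as factors.
\<close>

definition common_factors_removed ::
  "'i::finite set \<Rightarrow> ('i, 's::comm_ring_1) lpoly \<Rightarrow> ('i, 's) lpoly \<Rightarrow> ('i, 's) lpoly \<Rightarrow> bool" where
  "common_factors_removed I A G H \<longleftrightarrow>
     (let R = to_laurent ` {p. \<forall>k\<in>I. \<not> involves k p}
      in (\<exists>cs. G = prod_list cs * H \<and> (\<forall>c\<in>set cs. c \<in> R \<and> c dvd A)) \<and>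
         (\<forall>c\<in>R. c dvd A \<and> c dvd H \<longrightarrow> c dvd 1))"

text \<open>
  \<open>F\<close> is a mutation at \<open>i\<close> of an exchange polynomial \<open>E j\<close> that involves \<open>x_i\<close>; it is determined
  up to units of \<open>S\<close>.  In \<open>F\<close> the variable \<open>i\<close> stands for the new cluster variable.
\<close>

definition mutated_expoly ::
  "('i::{finite,linorder} \<Rightarrow> ('i, 's::idom) mpoly) \<Rightarrow> 'i \<Rightarrow> 'i \<Rightarrow> ('i, 's) mpoly \<Rightarrow> bool" where
  "mutated_expoly E i j F \<longleftrightarrow>
     (let A = set_zero j (exchange_laurent E i);
          G = mpoly_eval mconst
                (mvar(i := A * Poly_Mapping.single (Poly_Mapping.single i (- 1)) 1)) (E j)
      in (\<exists>H u e. common_factors_removed {i, j} A G H \<and> u dvd 1 \<and> Poly_Mapping.lookup e j = 0 \<and>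
            to_laurent F = Poly_Mapping.single e u * H)) \<and>
     (\<forall>k. \<not> mvar k dvd F)"

text \<open>
  Mutation is a relation, because the exchange polynomials of the new seed are only determined
  up to units.
\<close>

definition lp_mutation ::
  "('s::idom \<Rightarrow> 'f::field) \<Rightarrow> 'i::{finite,linorder} \<Rightarrow> ('i, 's, 'f) lp_seed \<Rightarrow> ('i, 's, 'f) lp_seed
     \<Rightarrow> bool" where
  "lp_mutation emb i t t' \<longleftrightarrow>
     cvar t' = (cvar t)(i := laurent_eval emb (cvar t) (exchange_laurent (expoly t) i) / cvar t i) \<and>
     expoly t' i = expoly t i \<and>
     (\<forall>j. j \<noteq> i \<longrightarrow>
        (if involves i (expoly t j) then mutated_expoly (expoly t) i j (expoly t' j)
         else expoly t' j = expoly t j))"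

definition lp_pattern ::
  "('s::idom \<Rightarrow> 'f::field) \<Rightarrow> ('i::{finite,linorder}, 's, 'f) lp_seed \<Rightarrow> ('i, 's, 'f) lp_seed set"
  where
  "lp_pattern emb t = {s. (\<lambda>u u'. \<exists>i. lp_mutation emb i u u')\<^sup>*\<^sup>* t s}"


section \<open>Upper bounds\<close>

definition seed_ring :: "('s::idom \<Rightarrow> 'f::field) \<Rightarrow> ('i::finite, 's, 'f) lp_seed \<Rightarrow> 'f set" where
  "seed_ring emb t = laurent_ring emb (cvar t)"

definition upper_bound ::
  "('s::idom \<Rightarrow> 'f::field) \<Rightarrow> ('i::{finite,linorder}, 's, 'f) lp_seed \<Rightarrow> 'f set" where
  "upper_bound emb t =
     seed_ring emb t \<inter> (\<Inter>i. \<Inter>t'\<in>{t'. lp_mutation emb i t t'}. seed_ring emb t')"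

definition upper_lp_algebra ::
  "('s::idom \<Rightarrow> 'f::field) \<Rightarrow> ('i::{finite,linorder}, 's, 'f) lp_seed \<Rightarrow> 'f set" where
  "upper_lp_algebra emb t = (\<Inter>s\<in>lp_pattern emb t. seed_ring emb s)"

end

theory Submission
  imports Defs
begin

text \<open>
  Let \<open>t\<close> be a seed with cluster \<open>x\<close> and exchange polynomials \<open>E_j\<close>.  Since the exchange Laurent
  polynomial at \<open>j\<close> is \<open>E_j\<close> times a monomial in the other variables, the Laurent ring of
  \<open>\<mu>_j t\<close> is the Laurent ring \<open>N_j\<close> of the point \<open>y\<close> obtained from \<open>x\<close> by replacing \<open>x_j\<close> with
  \<open>E_j / x_j\<close>.  In \<open>N_j\<close> the element \<open>E_j\<close> is prime; let \<open>O_j(t)\<close> be the localisation of \<open>N_j\<close> at it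
  (\<open>seed_loc\<close> below).  For \<open>f\<close> in \<open>L(t)\<close> some product \<open>f E_j^n\<close> lies in \<open>N_j\<close>, so \<open>f\<close> lies in
  \<open>L(\<mu>_j t)\<close> if and only if it lies in \<open>O_j(t)\<close>.  Hence
  \<open>UB(t) = L(t) \<inter> \<Inter>_j O_j(t)\<close>, which is lemma \<open>mem_upper_bound_iff\<close>.

  The theorem rests on \<open>seed_loc_mutation\<close>: the ring \<open>O_j\<close> does not change under a mutation at
  \<open>k \<noteq> j\<close>.  The defining property of the exchange exponents says that the exchange Laurent
  polynomial at \<open>k\<close> is a unit \<open>w\<close> of \<open>O_j(t)\<close>.
  If \<open>E_j\<close> does not involve \<open>x_k\<close>, then \<open>E_j\<close> and \<open>E_j / x_j\<close> are unchanged and \<open>x_k\<close> becomes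
  \<open>w / x_k\<close>, so the old and the new ring become equal after \<open>w\<close> is inverted (\<open>loc_eq_free\<close>).
  If \<open>E_j\<close> involves \<open>x_k\<close>, then the \<open>j\<close>-th exchange exponent at \<open>k\<close> is \<open>0\<close>, whence
  \<open>w = \<theta> + x_j h\<close> with \<open>\<theta>\<close> free of \<open>x_j\<close>.  The new polynomial \<open>E_j'\<close> is
  \<open>E_j\<close> with \<open>\<theta> / x_k'\<close> in place of \<open>x_k\<close>, up to factors that are units of \<open>O_j(t)\<close>.  At
  the new cluster, \<open>\<theta> / x_k'\<close> differs from \<open>x_k\<close> by a multiple of \<open>x_j\<close>, so \<open>E_j' / x_j\<close> is a
  unit times \<open>E_j / x_j + g\<close>, where the residue of \<open>g\<close> does not involve the transcendental element
  \<open>E_j / x_j\<close>.  It is therefore a unit of \<open>O_j(t)\<close>, and once more the old and the new ring have a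
  common localisation (\<open>mutation_pair_loc_eq\<close>).

  The exchange exponent at \<open>k\<close> belonging to \<open>j\<close> is the value of \<open>E_k\<close> in the valuation ring
  \<open>O_j(t)\<close>, so it does not change either, and mutating twice at \<open>k\<close> gives back the cluster
  (\<open>mutation_involutive\<close>).  Thus \<open>L(t) \<inter> L(\<mu>_k t) \<inter> \<Inter>_{j \<noteq> k} O_j(t)\<close> is a
  description of the upper bound that is the same for \<open>t\<close> and for \<open>\<mu>_k t\<close>.  The upper bound is then
  constant on the pattern; being contained in the Laurent ring of its own seed, it is contained in all
  of them.

  The argument needs irreducible polynomials over a factorial ring to be prime
  (\<open>irreducible_prime_to_laurent\<close>), and it needs every mutation to exist and to lead to exchange
  polynomials that are again prime (\<open>mutated_expoly_exists\<close>, \<open>mutated_expoly_prime\<close>).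
\<close>

section \<open>Unique factorisation relative to a subring\<close>

text \<open>
  Subrings are sets, because the induction on the number of variables below takes place inside one
  polynomial ring, and because the Laurent rings of all seeds are subrings of one field.
\<close>

definition subring_of :: "'r::comm_ring_1 set \<Rightarrow> bool" where
  "subring_of D \<longleftrightarrow> 1 \<in> D \<and> (\<forall>a\<in>D. \<forall>b\<in>D. a - b \<in> D \<and> a * b \<in> D)"

text \<open>
  Divisibility, primality and unique factorisation in a subring \<open>D\<close>; units are the elements
  that divide \<open>1\<close> in \<open>D\<close>, and associates need not be normalised.
\<close>

definition dvd_in :: "'r::comm_ring_1 set \<Rightarrow> 'r \<Rightarrow> 'r \<Rightarrow> bool" where
  "dvd_in D a b \<longleftrightarrow> (\<exists>c\<in>D. b = a * c)"

definition prime_in :: "'r::comm_ring_1 set \<Rightarrow> 'r \<Rightarrow> bool" where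
  "prime_in D p \<longleftrightarrow> p \<in> D \<and> p \<noteq> 0 \<and> \<not> dvd_in D p 1 \<and>
     (\<forall>a\<in>D. \<forall>b\<in>D. dvd_in D p (a * b) \<longrightarrow> dvd_in D p a \<or> dvd_in D p b)"

definition factorial_in :: "'r::comm_ring_1 set \<Rightarrow> bool" where
  "factorial_in D \<longleftrightarrow> subring_of D \<and>
     (\<forall>a\<in>D. a \<noteq> 0 \<longrightarrow> (\<exists>u ps. u \<in> D \<and> dvd_in D u 1 \<and> (\<forall>p\<in>set ps. prime_in D p) \<and>
        a = u * prod_list ps))"

lemma subring_one: "subring_of D \<Longrightarrow> 1 \<in> D"
  and subring_mult: "subring_of D \<Longrightarrow> a \<in> D \<Longrightarrow> b \<in> D \<Longrightarrow> a * b \<in> D"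
  and subring_diff: "subring_of D \<Longrightarrow> a \<in> D \<Longrightarrow> b \<in> D \<Longrightarrow> a - b \<in> D"
  by (auto simp: subring_of_def)

lemma subring_zero: "subring_of D \<Longrightarrow> 0 \<in> D"
  using subring_diff[of D 1 1] subring_one[of D] by simp

lemma subring_uminus: "subring_of D \<Longrightarrow> a \<in> D \<Longrightarrow> - a \<in> D"
  using subring_diff[of D 0 a] subring_zero[of D] by simp

lemma subring_add: "subring_of D \<Longrightarrow> a \<in> D \<Longrightarrow> b \<in> D \<Longrightarrow> a + b \<in> D"
  using subring_diff[of D a "- b"] subring_uminus[of D b] by simp

lemma subring_sum:
  assumes "subring_of D" "\<And>i. i \<in> I \<Longrightarrow> f i \<in> D"
  shows "(\<Sum>i\<in>I. f i) \<in> D"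
  using assms by (induction I rule: infinite_finite_induct) (auto simp: subring_zero subring_add)

lemma subring_prod:
  assumes "subring_of D" "\<And>i. i \<in> I \<Longrightarrow> f i \<in> D"
  shows "(\<Prod>i\<in>I. f i) \<in> D"
  using assms by (induction I rule: infinite_finite_induct) (auto simp: subring_one subring_mult)

lemma subring_power: "subring_of D \<Longrightarrow> a \<in> D \<Longrightarrow> a ^ n \<in> D"
  by (induction n) (auto simp: subring_one subring_mult)

lemma subring_prod_list: "subring_of D \<Longrightarrow> set ps \<subseteq> D \<Longrightarrow> prod_list ps \<in> D"
  by (induction ps) (auto simp: subring_one subring_mult)

lemmas subring_intros = subring_one subring_zero subring_add subring_diff subring_mult
  subring_uminus subring_power subring_sum subring_prod

text \<open>
  The elements that powers of \<open>d\<close> carry into \<open>N\<close>, that is, \<open>N[1/d]\<close> without the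
  division.
\<close>

lemma subring_saturation:
  assumes N: "subring_of N" and d: "d \<in> N"
  shows "subring_of {f. \<exists>n. f * d ^ n \<in> N}" "N \<subseteq> {f. \<exists>n. f * d ^ n \<in> N}"
proof -
  have p: "d ^ n \<in> N" for n by (rule subring_power[OF N d])
  show "N \<subseteq> {f. \<exists>n. f * d ^ n \<in> N}"
  proof
    fix f assume "f \<in> N"
    then show "f \<in> {f. \<exists>n. f * d ^ n \<in> N}" unfolding mem_Collect_eq by (intro exI[of _ 0]) simp
  qed
  then have one: "1 \<in> {f. \<exists>n. f * d ^ n \<in> N}" using subring_one[OF N] by blast
  have "f - g \<in> {f. \<exists>n. f * d ^ n \<in> N} \<and> f * g \<in> {f. \<exists>n. f * d ^ n \<in> N}"
    if n: "f * d ^ n \<in> N" "g * d ^ m \<in> N" for f g n m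
  proof -
    have "(f - g) * d ^ (n + m) = (f * d ^ n) * d ^ m - (g * d ^ m) * d ^ n"
      by (simp add: algebra_simps power_add)
    also have "\<dots> \<in> N" by (rule subring_diff[OF N subring_mult[OF N n(1) p] subring_mult[OF N n(2) p]])
    finally have 1: "(f - g) * d ^ (n + m) \<in> N" .
    have "(f * g) * d ^ (n + m) = (f * d ^ n) * (g * d ^ m)"
      by (simp add: algebra_simps power_add)
    also have "\<dots> \<in> N" by (rule subring_mult[OF N n])
    finally show ?thesis using 1 by blast
  qed
  then show "subring_of {f. \<exists>n. f * d ^ n \<in> N}" using one unfolding subring_of_def by blast
qed

lemma prime_inD:
  assumes "prime_in D p"
  shows "p \<in> D" "p \<noteq> 0" "\<not> dvd_in D p 1"
    "\<And>a b. a \<in> D \<Longrightarrow> b \<in> D \<Longrightarrow> dvd_in D p (a * b) \<Longrightarrow> dvd_in D p a \<or> dvd_in D p b"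
  using assms by (auto simp: prime_in_def)

lemma dvd_in_trans: "subring_of D \<Longrightarrow> dvd_in D a b \<Longrightarrow> dvd_in D b c \<Longrightarrow> dvd_in D a c"
  unfolding dvd_in_def by (metis mult.assoc subring_mult)

lemma dvd_in_mult_left: "subring_of D \<Longrightarrow> dvd_in D a b \<Longrightarrow> c \<in> D \<Longrightarrow> dvd_in D a (b * c)"
  unfolding dvd_in_def by (metis mult.assoc subring_mult)

lemma dvd_in_mult_right: "subring_of D \<Longrightarrow> dvd_in D a b \<Longrightarrow> c \<in> D \<Longrightarrow> dvd_in D a (c * b)"
  using dvd_in_mult_left[of D a b c] by (simp add: mult.commute)

lemma dvd_in_refl: "subring_of D \<Longrightarrow> dvd_in D a a"
  unfolding dvd_in_def by (metis mult.right_neutral subring_one)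

lemma dvd_in_add: "subring_of D \<Longrightarrow> dvd_in D a b \<Longrightarrow> dvd_in D a c \<Longrightarrow> dvd_in D a (b + c)"
  unfolding dvd_in_def by (metis distrib_left subring_add)

lemma dvd_in_diff: "subring_of D \<Longrightarrow> dvd_in D a b \<Longrightarrow> dvd_in D a c \<Longrightarrow> dvd_in D a (b - c)"
  unfolding dvd_in_def by (metis right_diff_distrib subring_diff)

lemma dvd_in_zero: "subring_of D \<Longrightarrow> dvd_in D a 0"
  unfolding dvd_in_def using subring_zero by force

lemma dvd_in_sum:
  assumes "subring_of D" "\<And>i. i \<in> I \<Longrightarrow> dvd_in D a (f i)"
  shows "dvd_in D a (\<Sum>i\<in>I. f i)"
  using assms by (induction I rule: infinite_finite_induct) (auto simp: dvd_in_zero dvd_in_add)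

lemma prime_in_dvd_prod_list:
  assumes "subring_of D" "prime_in D p" "set ps \<subseteq> D" "dvd_in D p (prod_list ps)"
  shows "\<exists>q\<in>set ps. dvd_in D p q"
  using assms(3,4)
proof (induction ps)
  case Nil
  then show ?case using prime_inD(3)[OF assms(2)] by simp
next
  case (Cons a ps)
  then show ?case
    using prime_inD(4)[OF assms(2), of a "prod_list ps"] subring_prod_list[OF assms(1), of ps] by auto
qed

text \<open>
  The polynomials with coefficients in \<open>D\<close>.
\<close>

definition polys_over :: "'r::comm_ring_1 set \<Rightarrow> 'r poly set" where
  "polys_over D = {f. \<forall>n. coeff f n \<in> D}"

lemma subring_polys_over:
  assumes D: "subring_of D"
  shows "subring_of (polys_over D)"
  using D unfolding subring_of_def[of "polys_over D"]
  by (auto simp: polys_over_def coeff_mult subring_one subring_zero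
      intro!: subring_sum subring_mult subring_diff)

lemma const_in_polys_over [simp]:
  "subring_of D \<Longrightarrow> [:a:] \<in> polys_over D \<longleftrightarrow> a \<in> D"
  by (auto simp: polys_over_def coeff_pCons subring_zero split: nat.split
      dest: spec[of _ 0])

lemma all_nat_split: "(\<forall>n. P n) \<longleftrightarrow> P 0 \<and> (\<forall>n. P (Suc n))"
  by (metis not0_implies_Suc)

lemma pCons_in_polys_over:
  "pCons a f \<in> polys_over D \<longleftrightarrow> a \<in> D \<and> f \<in> polys_over D"
  unfolding polys_over_def mem_Collect_eq
  by (subst all_nat_split) (auto simp: coeff_pCons)

lemma monom_in_polys_over: "subring_of D \<Longrightarrow> a \<in> D \<Longrightarrow> monom a n \<in> polys_over D"
  by (auto simp: polys_over_def subring_zero)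

text \<open>Gauss's lemma: the polynomials over a factorial subring \<open>D\<close> form a factorial ring.\<close>

context
  fixes D :: "'r::idom set"
  assumes fact: "factorial_in D"
begin

lemma gauss_subring: "subring_of D" "subring_of (polys_over D)"
  using fact subring_polys_over by (auto simp: factorial_in_def)

lemma const_dvd_in_iff:
  assumes "p \<in> D" "f \<in> polys_over D"
  shows "dvd_in (polys_over D) [:p:] f \<longleftrightarrow> (\<forall>n. dvd_in D p (coeff f n))"
proof
  assume "dvd_in (polys_over D) [:p:] f"
  then show "\<forall>n. dvd_in D p (coeff f n)"
    by (auto simp: dvd_in_def polys_over_def)
next
  assume "\<forall>n. dvd_in D p (coeff f n)"
  with assms(2) show "dvd_in (polys_over D) [:p:] f"
  proof (induction f)
    case 0
    then show ?case using gauss_subring by (simp add: dvd_in_zero)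
  next
    case (pCons a f)
    have f: "f \<in> polys_over D" using pCons.prems by (simp add: pCons_in_polys_over)
    have "dvd_in D p (coeff f n)" for n
      using spec[OF pCons.prems(2), of "Suc n"] by simp
    then obtain g where g: "g \<in> polys_over D" "f = [:p:] * g"
      using pCons.IH f by (auto simp: dvd_in_def)
    obtain c where c: "c \<in> D" "a = p * c"
      using spec[OF pCons.prems(2), of 0] by (auto simp: dvd_in_def)
    have "pCons c g \<in> polys_over D" using c g by (simp add: pCons_in_polys_over)
    moreover have "pCons a f = [:p:] * pCons c g" using c g by simp
    ultimately show ?case unfolding dvd_in_def by blast
  qed
qed

lemma const_prime_in:
  assumes p: "prime_in D p"
  shows "prime_in (polys_over D) [:p:]"
proof -
  note D = gauss_subring
  note pD = prime_inD[OF p]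
  have "dvd_in (polys_over D) [:p:] f \<or> dvd_in (polys_over D) [:p:] g"
    if f: "f \<in> polys_over D" and g: "g \<in> polys_over D"
      and fg: "dvd_in (polys_over D) [:p:] (f * g)" for f g
  proof (rule ccontr)
    assume n: "\<not> ?thesis"
    have "\<exists>i. \<not> dvd_in D p (coeff f i)" "\<exists>i. \<not> dvd_in D p (coeff g i)"
      using n const_dvd_in_iff[OF pD(1)] f g by auto
    define i where "i = (LEAST i. \<not> dvd_in D p (coeff f i))"
    define j where "j = (LEAST j. \<not> dvd_in D p (coeff g j))"
    have i: "\<not> dvd_in D p (coeff f i)" "\<And>k. k < i \<Longrightarrow> dvd_in D p (coeff f k)"
      unfolding i_def using LeastI_ex[OF \<open>\<exists>i. \<not> dvd_in D p (coeff f i)\<close>]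
        not_less_Least[of _ "\<lambda>i. \<not> dvd_in D p (coeff f i)"] by blast+
    have j: "\<not> dvd_in D p (coeff g j)" "\<And>k. k < j \<Longrightarrow> dvd_in D p (coeff g k)"
      unfolding j_def using LeastI_ex[OF \<open>\<exists>i. \<not> dvd_in D p (coeff g i)\<close>]
        not_less_Least[of _ "\<lambda>i. \<not> dvd_in D p (coeff g i)"] by blast+
    have cf: "coeff f k \<in> D" "coeff g k \<in> D" for k using f g by (auto simp: polys_over_def)
    have "coeff (f * g) (i + j) = coeff f i * coeff g j
        + (\<Sum>k\<in>{..i+j}-{i}. coeff f k * coeff g (i + j - k))"
      by (simp add: coeff_mult sum.remove[where x = i])
    moreover have "dvd_in D p (\<Sum>k\<in>{..i+j}-{i}. coeff f k * coeff g (i + j - k))"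
    proof (rule dvd_in_sum[OF D(1)])
      fix k assume k: "k \<in> {..i+j}-{i}"
      then consider "k < i" | "i + j - k < j" by force
      then show "dvd_in D p (coeff f k * coeff g (i + j - k))"
        using i(2) j(2) cf D(1) by cases (auto intro: dvd_in_mult_left dvd_in_mult_right)
    qed
    moreover have "dvd_in D p (coeff (f * g) (i + j))"
      using fg const_dvd_in_iff[OF pD(1)] f g D by (simp add: subring_mult)
    ultimately have "dvd_in D p (coeff f i * coeff g j)"
      using dvd_in_diff[OF D(1)] by fastforce
    then show False using pD(4) cf i(1) j(1) by blast
  qed
  moreover have "\<not> dvd_in (polys_over D) [:p:] 1"
  proof
    assume "dvd_in (polys_over D) [:p:] 1"
    then have "dvd_in D p (coeff 1 0)"
      using const_dvd_in_iff[OF pD(1) subring_one[OF D(2)]] by blast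
    then show False using pD(3) by simp
  qed
  ultimately show ?thesis
    using pD D by (auto simp: prime_in_def)
qed

text \<open>
  Primitive means here that no prime of \<open>D\<close> divides all coefficients.
\<close>

definition primitive_over :: "'r poly \<Rightarrow> bool" where
  "primitive_over f \<longleftrightarrow> f \<in> polys_over D \<and> f \<noteq> 0 \<and>
     (\<forall>p. prime_in D p \<longrightarrow> \<not> dvd_in (polys_over D) [:p:] f)"

text \<open>
  Primes are split off one by one; each of them divides the leading coefficient, whose
  factorisation gets shorter.
\<close>

lemma content_decomposition:
  assumes "f \<in> polys_over D" "f \<noteq> 0"
  shows "\<exists>c g. c \<in> D \<and> c \<noteq> 0 \<and> primitive_over g \<and> f = [:c:] * g"
proof -
  note D = gauss_subring
  have "\<exists>c g. c \<in> D \<and> c \<noteq> 0 \<and> primitive_over g \<and> f = [:c:] * g"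
    if "f \<in> polys_over D" "f \<noteq> 0" "u \<in> D" "dvd_in D u 1" "\<forall>p\<in>set ps. prime_in D p"
      "lead_coeff f = u * prod_list ps" for f u ps
    using that
  proof (induction "length ps" arbitrary: f u ps)
    case (0 ps f u)
    then have lc: "dvd_in D (lead_coeff f) 1" by simp
    have "\<not> dvd_in (polys_over D) [:p:] f" if p: "prime_in D p" for p
    proof
      assume "dvd_in (polys_over D) [:p:] f"
      then have "dvd_in D p (lead_coeff f)"
        using const_dvd_in_iff prime_inD(1)[OF p] 0 by blast
      then show False using lc dvd_in_trans[OF D(1)] prime_inD(3)[OF p] by blast
    qed
    then show ?case using 0 D(1)
      by (intro exI[of _ 1] exI[of _ f]) (auto simp: primitive_over_def subring_one)
  next
    case (Suc n ps f u)
    show ?case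
    proof (cases "primitive_over f")
      case True
      then show ?thesis using D(1) by (intro exI[of _ 1] exI[of _ f]) (auto simp: subring_one)
    next
      case False
      then obtain p where p: "prime_in D p" "dvd_in (polys_over D) [:p:] f"
        using Suc.prems by (auto simp: primitive_over_def)
      note pD = prime_inD[OF p(1)]
      obtain g where g: "g \<in> polys_over D" "f = [:p:] * g" using p by (auto simp: dvd_in_def)
      have g0: "g \<noteq> 0" using g Suc.prems by auto
      have lcg: "lead_coeff g \<in> D" using g by (auto simp: polys_over_def)
      have lc: "lead_coeff f = p * lead_coeff g" using g pD by simp
      have psD: "set ps \<subseteq> D" using Suc.prems(5) prime_inD(1) by blast
      have "dvd_in D p (u * prod_list ps)"
        using lc lcg Suc.prems(6) unfolding dvd_in_def by metis
      then have "dvd_in D p u \<or> dvd_in D p (prod_list ps)"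
        using pD(4) Suc.prems(3) subring_prod_list[OF D(1) psD] by blast
      moreover have "\<not> dvd_in D p u"
        using pD(3) Suc.prems(4) dvd_in_trans[OF D(1)] by blast
      ultimately obtain q where q: "q \<in> set ps" "dvd_in D p q"
        using prime_in_dvd_prod_list[OF D(1) p(1) psD] by blast
      then obtain v where v: "v \<in> D" "q = p * v" by (auto simp: dvd_in_def)
      have qp: "prime_in D q" using q Suc.prems(5) by blast
      have "dvd_in D q (p * v)" using v dvd_in_refl[OF D(1)] by simp
      moreover have "\<not> dvd_in D q v"
      proof
        assume "dvd_in D q v"
        then obtain w where w: "w \<in> D" "v = q * w" by (auto simp: dvd_in_def)
        then have "q * 1 = q * (p * w)" using v by (metis mult.commute mult.left_commute mult_1)
        then have "1 = p * w" using prime_inD(2)[OF qp] by (simp only: mult_cancel_left)simp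
        then show False using pD(3) w by (auto simp: dvd_in_def)
      qed
      ultimately obtain w where w: "w \<in> D" "p = q * w"
        using prime_inD(4)[OF qp pD(1) v(1)] by (auto simp: dvd_in_def)
      have "p * 1 = p * (v * w)" using v w by (metis mult.assoc mult.right_neutral)
      then have vw: "v * w = 1" using pD(2) by (simp only: mult_cancel_left) simp
      obtain ps1 ps2 where ps: "ps = ps1 @ q # ps2" using split_list[OF q(1)] by blast
      have "p * lead_coeff g = u * prod_list ps" using lc Suc.prems(6) by simp
      also have "prod_list ps = prod_list ps1 * (q * prod_list ps2)" by (simp add: ps)
      also have "q = p * v" by (fact v(2))
      also have "u * (prod_list ps1 * (p * v * prod_list ps2)) = p * ((u * v) * prod_list (ps1 @ ps2))"
        by (simp add: mult_ac)
      finally have "p * lead_coeff g = p * ((u * v) * prod_list (ps1 @ ps2))" .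
      then have lg: "lead_coeff g = (u * v) * prod_list (ps1 @ ps2)" using pD(2) by simp
      have "dvd_in D (u * v) 1"
      proof -
        obtain u' where "u' \<in> D" "1 = u * u'" using Suc.prems(4) by (auto simp: dvd_in_def)
        then have "1 = (u * v) * (u' * w)" using vw by (metis mult.assoc mult.left_commute mult_1_right)
        then show ?thesis using \<open>u' \<in> D\<close> w(1) D(1) unfolding dvd_in_def by (metis subring_mult)
      qed
      then obtain c h where "c \<in> D" "c \<noteq> 0" "primitive_over h" "g = [:c:] * h"
        using Suc.hyps(1)[of "ps1 @ ps2" g "u * v"] Suc.hyps(2) Suc.prems(3,5) ps g g0 lg v(1) D(1)
        by (auto simp: subring_mult)
      then show ?thesis using g pD D(1)
        by (intro exI[of _ "p * c"] exI[of _ h]) (auto simp: subring_mult mult.commute)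
    qed
  qed
  moreover have "lead_coeff f \<in> D" "lead_coeff f \<noteq> 0"
    using assms by (auto simp: polys_over_def)
  ultimately show ?thesis
    using assms fact unfolding factorial_in_def by metis
qed

lemma primitive_dvd_cancel_const:
  assumes "primitive_over g" "d \<in> D" "d \<noteq> 0" "f \<in> polys_over D"
    "dvd_in (polys_over D) g ([:d:] * f)"
  shows "dvd_in (polys_over D) g f"
proof -
  note D = gauss_subring
  obtain u ps where u: "u \<in> D" "dvd_in D u 1" and ps: "\<forall>p\<in>set ps. prime_in D p"
    and d: "d = u * prod_list ps" using fact assms(2,3) unfolding factorial_in_def by metis
  obtain w where w: "w \<in> D" "u * w = 1" using u by (auto simp: dvd_in_def)
  have "dvd_in (polys_over D) g ([:prod_list ps:] * f)"
  proof -
    have "prod_list ps = d * w"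
      using w(2) d by (metis mult.commute mult.assoc mult_1)
    then have "[:prod_list ps:] * f = ([:d:] * f) * [:w:]"
      by (simp add: mult.commute)
    moreover have "[:w:] \<in> polys_over D" using w D(1) by simp
    ultimately show ?thesis using assms(5) dvd_in_mult_left[OF D(2)] by metis
  qed
  then show ?thesis using ps
  proof (induction ps)
    case Nil
    then show ?case by (simp flip: one_pCons)
  next
    case (Cons p ps)
    then have p: "prime_in D p" by simp
    have "set ps \<subseteq> D" using Cons.prems(2) prime_inD(1) by auto
    then have PD: "[:prod_list ps:] * f \<in> polys_over D"
      using assms(4) D by (simp only: subring_mult const_in_polys_over subring_prod_list)
    obtain h where h: "h \<in> polys_over D" "[:prod_list (p # ps):] * f = g * h"
      using Cons.prems by (auto simp: dvd_in_def)
    have "dvd_in (polys_over D) [:p:] (g * h)"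
      unfolding dvd_in_def
      by (rule bexI[of _ "[:prod_list ps:] * f"]) (use h PD in \<open>auto simp: mult.commute\<close>)
    then obtain h' where h': "h' \<in> polys_over D" "h = [:p:] * h'"
      using prime_inD(4)[OF const_prime_in[OF p], of g h] assms(1) h p
      unfolding primitive_over_def dvd_in_def[of _ _ h] by blast
    have "[:p:] * ([:prod_list ps:] * f) = [:p:] * (g * h')"
      using h(2) h'(2) by (simp add: algebra_simps)
    then have "[:prod_list ps:] * f = g * h'"
      using prime_inD(2)[OF p] by (metis mult_cancel_left pCons_eq_0_iff)
    then have "dvd_in (polys_over D) g ([:prod_list ps:] * f)"
      using h' unfolding dvd_in_def by blast
    then show ?case using Cons by simp
  qed
qed

lemma pseudo_division_over:
  assumes "r \<in> polys_over D" "r \<noteq> 0" "g \<in> polys_over D"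
  shows "\<exists>c q s. c \<in> D \<and> c \<noteq> 0 \<and> q \<in> polys_over D \<and> s \<in> polys_over D \<and>
     [:c:] * g = q * r + s \<and> (s = 0 \<or> degree s < degree r)"
  using assms(3)
proof (induction "degree g" arbitrary: g rule: less_induct)
  case less
  note D = gauss_subring
  show ?case
  proof (cases "g = 0 \<or> degree g < degree r")
    case True
    then show ?thesis using D less
      by (intro exI[of _ 1] exI[of _ 0] exI[of _ g]) (auto simp: subring_intros simp flip: one_pCons)
  next
    case False
    define a where "a = lead_coeff r"
    define m where "m = monom (lead_coeff g) (degree g - degree r)"
    define h where "h = [:a:] * g - m * r"
    have a: "a \<in> D" "a \<noteq> 0" using assms by (auto simp: a_def polys_over_def)
    have m: "m \<in> polys_over D" using less(2) D(1)
      by (auto simp: m_def polys_over_def subring_zero)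
    have h: "h \<in> polys_over D" unfolding h_def using m less(2) assms D a
      by (intro subring_diff subring_mult) auto
    have dm: "degree (m * r) = degree g"
      using False assms by (auto simp: m_def a_def degree_mult_eq degree_monom_eq monom_eq_0_iff)
    have "lead_coeff (m * r) = a * lead_coeff g"
      using False by (simp only: lead_coeff_mult) (auto simp: m_def a_def degree_monom_eq)
    note dm = dm this[unfolded dm]
    have "degree h \<le> degree g" unfolding h_def
      using dm a by (intro degree_diff_le) auto
    moreover have "coeff h (degree g) = 0"
      unfolding h_def using dm by simp
    ultimately have "h = 0 \<or> degree h < degree g"
      by (metis leading_coeff_0_iff le_neq_implies_less)
    then consider "h = 0" | "degree h < degree g" by blast
    then obtain c q s where *: "c \<in> D" "c \<noteq> 0" "q \<in> polys_over D" "s \<in> polys_over D"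
      "[:c:] * h = q * r + s" "s = 0 \<or> degree s < degree r"
    proof cases
      case 1
      then show ?thesis using that[of 1 0 0] D by (auto simp: subring_intros)
    next
      case 2
      then show ?thesis using less(1)[OF 2 h] that by blast
    qed
    have "[:c * a:] * g = [:c:] * (h + m * r)" by (simp add: h_def mult.commute)
    also have "\<dots> = (q + [:c:] * m) * r + s" using *(5) by (simp add: algebra_simps)
    finally have "[:c * a:] * g = (q + [:c:] * m) * r + s" .
    moreover have "c * a \<in> D" "c * a \<noteq> 0" "q + [:c:] * m \<in> polys_over D"
    proof -
      show "c * a \<in> D" "c * a \<noteq> 0" using a * D by (auto simp: subring_mult)
      show "q + [:c:] * m \<in> polys_over D"
        using m * D by (intro subring_add subring_mult) auto
    qed
    ultimately show ?thesis using * by blast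
  qed
qed

text \<open>
  Suppose that \<open>f\<close> divides \<open>a b\<close>, and let \<open>r\<close> have least degree in the ideal \<open>J\<close>
  generated by \<open>f\<close> and \<open>a\<close>.  By pseudo-division the primitive part \<open>r0\<close> of \<open>r\<close> divides every
  element of \<open>J\<close>, in particular \<open>f\<close> and \<open>a\<close>.  Since \<open>f\<close> is not a product of two polynomials of
  positive degree, either \<open>r0\<close> is associated to \<open>f\<close>, and \<open>f\<close> divides \<open>a\<close>, or \<open>J\<close> contains a
  nonzero constant \<open>c\<close>, and \<open>f\<close> divides \<open>c b\<close>.
\<close>

lemma indecomposable_primitive_prime:
  assumes f: "primitive_over f" "degree f > 0"
    and irr: "\<And>g h. g \<in> polys_over D \<Longrightarrow> h \<in> polys_over D \<Longrightarrow> f = g * h \<Longrightarrow>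
       degree g = 0 \<or> degree h = 0"
  shows "prime_in (polys_over D) f"
proof -
  note D = gauss_subring
  let ?P = "polys_over D"
  have fP: "f \<in> ?P" "f \<noteq> 0" using f by (auto simp: primitive_over_def)
  have "dvd_in ?P f a \<or> dvd_in ?P f b"
    if a: "a \<in> ?P" and b: "b \<in> ?P" and ab: "dvd_in ?P f (a * b)" for a b
  proof -
    define J where "J = {u * f + v * a | u v. u \<in> ?P \<and> v \<in> ?P}"
    have JP: "J \<subseteq> ?P" using a fP D by (auto simp: J_def intro!: subring_intros)
    have fJ: "f \<in> J" and aJ: "a \<in> J"
      unfolding J_def using D(2) subring_one[OF D(2)] subring_zero[OF D(2)]
      by (force intro: exI[of _ 1] exI[of _ 0])+
    define r where "r = arg_min degree (\<lambda>g. g \<in> J \<and> g \<noteq> 0)"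
    have r: "r \<in> J" "r \<noteq> 0" "\<And>g. g \<in> J \<Longrightarrow> g \<noteq> 0 \<Longrightarrow> degree r \<le> degree g"
      using arg_min_nat_lemma[of "\<lambda>g. g \<in> J \<and> g \<noteq> 0" f degree] fJ fP by (auto simp: r_def)
    obtain u v where uv: "u \<in> ?P" "v \<in> ?P" "r = u * f + v * a" using r(1) by (auto simp: J_def)
    have rP: "r \<in> ?P" using r JP by blast
    obtain c0 r0 where r0: "c0 \<in> D" "c0 \<noteq> 0" "primitive_over r0" "r = [:c0:] * r0"
      using content_decomposition[OF rP r(2)] by blast
    have r0P: "r0 \<in> ?P" using r0 by (auto simp: primitive_over_def)
    have dvdJ: "dvd_in ?P r0 g" if g: "g \<in> J" for g
    proof -
      obtain c q s where *: "c \<in> D" "c \<noteq> 0" "q \<in> ?P" "s \<in> ?P" "[:c:] * g = q * r + s"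
        "s = 0 \<or> degree s < degree r"
        using pseudo_division_over[OF rP r(2)] g JP by blast
      obtain u' v' where g': "u' \<in> ?P" "v' \<in> ?P" "g = u' * f + v' * a" using g by (auto simp: J_def)
      have "s = [:c:] * g - q * r" using *(5) by simp
      also have "\<dots> = ([:c:] * u' - q * u) * f + ([:c:] * v' - q * v) * a"
        unfolding g'(3) uv(3) by (simp only: algebra_simps)
      finally have "s \<in> J" unfolding J_def
        using * uv g' D by (blast intro!: subring_diff subring_mult const_in_polys_over[THEN iffD2])
      then have "s = 0" using r(3) *(6) by force
      then have "[:c:] * g = r0 * ([:c0:] * q)" using *(5) r0(4) by (simp add: mult.commute)
      moreover have "[:c0:] * q \<in> ?P" using r0 * D by (intro subring_mult) auto
      ultimately have "dvd_in ?P r0 ([:c:] * g)" unfolding dvd_in_def by blast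
      then show ?thesis using primitive_dvd_cancel_const[OF r0(3) *(1,2)] g JP by blast
    qed
    obtain t where t: "t \<in> ?P" "f = r0 * t" using dvdJ[OF fJ] by (auto simp: dvd_in_def)
    consider "degree t = 0" | "degree r0 = 0" using irr[OF r0P t] by auto
    then show ?thesis
    proof cases
      case 1
      then obtain d where d: "t = [:d:]" by (metis degree_0_id)
      have dD: "d \<in> D" "d \<noteq> 0" using t d fP D by auto
      then obtain w ps where w: "w \<in> D" "dvd_in D w 1" "\<forall>p\<in>set ps. prime_in D p" "d = w * prod_list ps"
        using fact unfolding factorial_in_def by metis
      have "ps = []"
      proof (rule ccontr)
        assume "ps \<noteq> []"
        then obtain p ps' where ps: "ps = p # ps'" by (cases ps) auto
        then have p: "prime_in D p" and "set ps' \<subseteq> D" using w prime_inD(1) by auto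
        then have e: "w * prod_list ps' \<in> D" using w D by (auto intro!: subring_intros subring_prod_list)
        have "f = [:p:] * ([:w * prod_list ps':] * r0)"
          using t d w ps by (simp add: algebra_simps)
        moreover have "[:w * prod_list ps':] * r0 \<in> ?P" using e r0P D
          by (metis const_in_polys_over subring_mult)
        ultimately have "dvd_in ?P [:p:] f" unfolding dvd_in_def by blast
        then show False using f p by (auto simp: primitive_over_def)
      qed
      then have "dvd_in D d 1" using w by simp
      then obtain d' where d': "d' \<in> D" "d * d' = 1" by (auto simp: dvd_in_def)
      have "r0 = f * [:d':]" using t d d' by (simp add: mult.commute)
      then have "dvd_in ?P f r0" using d'(1) const_in_polys_over[OF D(1)] unfolding dvd_in_def by blast
      then show ?thesis using dvdJ[OF aJ] dvd_in_trans[OF D(2)] by blast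
    next
      case 2
      then obtain d where d: "r0 = [:d:]" by (metis degree_0_id)
      have dD: "c0 * d \<in> D" "c0 * d \<noteq> 0" using r0 r0P d r(2) D by (auto simp: subring_mult)
      have "[:c0 * d:] * b = u * f * b + v * (a * b)"
        using uv(3) r0(4) d by (simp add: algebra_simps)
      moreover have "dvd_in ?P f (u * f * b + v * (a * b))"
        using dvd_in_add[OF D(2)] dvd_in_mult_right[OF D(2) ab uv(2)]
          dvd_in_mult_left[OF D(2) dvd_in_mult_right[OF D(2) dvd_in_refl[OF D(2)] uv(1)] b] by blast
      ultimately have "dvd_in ?P f ([:c0 * d:] * b)" by simp
      then show ?thesis using primitive_dvd_cancel_const[OF f(1) dD b] by blast
    qed
  qed
  moreover have "\<not> dvd_in ?P f 1"
  proof
    assume "dvd_in ?P f 1"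
    then obtain g where "1 = f * g" by (auto simp: dvd_in_def)
    then have "degree f + degree g = 0" using fP
      by (metis degree_1 degree_mult_eq mult_zero_right zero_neq_one)
    then show False using f by simp
  qed
  ultimately show ?thesis using fP by (auto simp: prime_in_def)
qed

lemma primitive_factorization:
  assumes "primitive_over f"
  shows "\<exists>u ps. u \<in> polys_over D \<and> dvd_in (polys_over D) u 1 \<and>
     (\<forall>p\<in>set ps. prime_in (polys_over D) p) \<and> f = u * prod_list ps"
  using assms
proof (induction "degree f" arbitrary: f rule: less_induct)
  case less
  note D = gauss_subring
  let ?P = "polys_over D"
  have fP: "f \<in> ?P" "f \<noteq> 0" using less.prems by (auto simp: primitive_over_def)
  consider "degree f = 0"
    | g h where "g \<in> ?P" "h \<in> ?P" "f = g * h" "degree g > 0" "degree h > 0"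
    | "prime_in ?P f"
    using indecomposable_primitive_prime[OF less.prems] by blast
  then show ?case
  proof cases
    case 1
    then obtain d where d: "f = [:d:]" by (metis degree_0_id)
    have dD: "d \<in> D" "d \<noteq> 0" using d fP D by auto
    then obtain w ps where w: "w \<in> D" "dvd_in D w 1" "\<forall>p\<in>set ps. prime_in D p" "d = w * prod_list ps"
      using fact unfolding factorial_in_def by metis
    then obtain w' where w': "w' \<in> D" "w * w' = 1" by (auto simp: dvd_in_def)
    have "dvd_in ?P [:w:] 1"
      unfolding dvd_in_def by (rule bexI[of _ "[:w':]"]) (use w' D in \<open>auto simp: one_pCons mult.commute\<close>)
    moreover have "prod_list (map (\<lambda>p. [:p:]) ps) = [:prod_list ps:]"
      by (induction ps) (auto simp: one_pCons)
    ultimately show ?thesis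
      using w D d const_prime_in
      by (intro exI[of _ "[:w:]"] exI[of _ "map (\<lambda>p. [:p:]) ps"]) auto
  next
    case 2
    have "g \<noteq> 0" "h \<noteq> 0" using 2 fP by auto
    then have deg: "degree g < degree f" "degree h < degree f"
      using 2 by (auto simp: degree_mult_eq)
    have "primitive_over g" "primitive_over h"
      using less.prems 2 \<open>g \<noteq> 0\<close> \<open>h \<noteq> 0\<close> dvd_in_mult_left[OF D(2)] dvd_in_mult_right[OF D(2)]
      by (auto simp: primitive_over_def)
    then obtain u ps v qs where
      u: "u \<in> ?P" "dvd_in ?P u 1" "\<forall>p\<in>set ps. prime_in ?P p" "g = u * prod_list ps" and
      v: "v \<in> ?P" "dvd_in ?P v 1" "\<forall>p\<in>set qs. prime_in ?P p" "h = v * prod_list qs"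
      using less.hyps deg by metis
    obtain u' v' where "u' \<in> ?P" "v' \<in> ?P" "1 = u * u'" "1 = v * v'"
      using u v by (auto simp: dvd_in_def)
    then have "dvd_in ?P (u * v) 1"
      unfolding dvd_in_def using D(2)
      by (intro bexI[of _ "u' * v'"])
        (metis mult.assoc mult.commute mult_1_right, simp add: subring_mult)
    then show ?thesis using u v 2 D(2)
      by (intro exI[of _ "u * v"] exI[of _ "ps @ qs"]) (auto simp: subring_mult algebra_simps)
  next
    case 3
    then show ?thesis using D(2)
      by (intro exI[of _ 1] exI[of _ "[f]"]) (auto simp: subring_one dvd_in_refl)
  qed
qed

theorem factorial_in_polys_over: "factorial_in (polys_over D)"
proof -
  note D = gauss_subring
  let ?P = "polys_over D"
  have "\<exists>u ps. u \<in> ?P \<and> dvd_in ?P u 1 \<and> (\<forall>p\<in>set ps. prime_in ?P p) \<and> f = u * prod_list ps"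
    if f: "f \<in> ?P" "f \<noteq> 0" for f
  proof -
    obtain c g where c: "c \<in> D" "c \<noteq> 0" "primitive_over g" "f = [:c:] * g"
      using content_decomposition[OF f] by blast
    obtain u ps where u: "u \<in> ?P" "dvd_in ?P u 1" "\<forall>p\<in>set ps. prime_in ?P p" "g = u * prod_list ps"
      using primitive_factorization[OF c(3)] by blast
    obtain w qs where w: "w \<in> D" "dvd_in D w 1" "\<forall>p\<in>set qs. prime_in D p" "c = w * prod_list qs"
      using fact c unfolding factorial_in_def by metis
    obtain w' where w': "w' \<in> D" "w * w' = 1" using w by (auto simp: dvd_in_def)
    obtain u' where u': "u' \<in> ?P" "1 = u * u'" using u by (auto simp: dvd_in_def)
    have "([:w:] * u) * ([:w':] * u') = [:w * w':] * (u * u')" by (simp add: algebra_simps)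
    then have "dvd_in ?P ([:w:] * u) 1"
      using w' u' D unfolding dvd_in_def
      by (intro bexI[of _ "[:w':] * u'"] subring_mult) (auto simp: one_pCons)
    moreover have "prod_list (map (\<lambda>p. [:p:]) qs) = [:prod_list qs:]"
      by (induction qs) (auto simp: one_pCons)
    moreover have "[:w:] * u \<in> ?P" using w u D by (intro subring_mult) auto
    ultimately show ?thesis
      using w u c D const_prime_in
      by (intro exI[of _ "[:w:] * u"] exI[of _ "map (\<lambda>p. [:p:]) qs @ ps"]) (auto simp: algebra_simps)
  qed
  then show ?thesis using D by (simp add: factorial_in_def)
qed

end

text \<open>Factoriality is transported along an injective ring homomorphism between subrings.\<close>

lemma factorial_in_image:
  assumes fact: "factorial_in D"
    and inj: "inj_on h D"
    and hom: "h 1 = 1" "\<And>a b. a \<in> D \<Longrightarrow> b \<in> D \<Longrightarrow> h (a - b) = h a - h b"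
      "\<And>a b. a \<in> D \<Longrightarrow> b \<in> D \<Longrightarrow> h (a * b) = h a * h b"
  shows "factorial_in (h ` D)"
proof -
  have D: "subring_of D" using fact by (simp add: factorial_in_def)
  have sub: "subring_of (h ` D)"
    unfolding subring_of_def
  proof (intro conjI ballI)
    show "1 \<in> h ` D" using hom(1) subring_one[OF D] by (metis image_eqI)
    fix a b assume "a \<in> h ` D" "b \<in> h ` D"
    then obtain a' b' where "a' \<in> D" "b' \<in> D" "a = h a'" "b = h b'" by blast
    then show "a - b \<in> h ` D" "a * b \<in> h ` D"
      using hom(2,3)[of a' b'] subring_diff[OF D] subring_mult[OF D] by (metis image_eqI)+
  qed
  have dvd: "dvd_in (h ` D) (h a) (h b) \<longleftrightarrow> dvd_in D a b"
    if ab: "a \<in> D" "b \<in> D" for a b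
  proof
    assume "dvd_in (h ` D) (h a) (h b)"
    then obtain c where "c \<in> D" "h b = h (a * c)" using hom(3)[OF ab(1)] by (auto simp: dvd_in_def)
    then show "dvd_in D a b" using inj ab D
      unfolding dvd_in_def by (metis inj_on_eq_iff subring_mult)
  next
    assume "dvd_in D a b"
    then show "dvd_in (h ` D) (h a) (h b)" using hom(3) ab by (auto simp: dvd_in_def)
  qed
  have h0: "h 0 = 0" using hom(2)[of 1 1] subring_one[OF D] by simp
  have prime: "prime_in (h ` D) (h p)" if p: "prime_in D p" for p
  proof -
    note pD = prime_inD[OF p]
    have "h p \<noteq> 0" using inj pD(1,2) h0 subring_zero[OF D] by (metis inj_on_eq_iff)
    moreover have "\<not> dvd_in (h ` D) (h p) 1"
      using dvd[OF pD(1) subring_one[OF D]] pD(3) hom(1) by simp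
    moreover have "dvd_in (h ` D) (h p) (h a) \<or> dvd_in (h ` D) (h p) (h b)"
      if "a \<in> D" "b \<in> D" "dvd_in (h ` D) (h p) (h a * h b)" for a b
      using that hom(3)[of a b] pD dvd D by (metis subring_mult)
    ultimately show ?thesis using pD(1) by (auto simp: prime_in_def)
  qed
  have plist: "prod_list (map h ps) = h (prod_list ps)" if "set ps \<subseteq> D" for ps
    using that hom(1,3) subring_prod_list[OF D] by (induction ps) auto
  have "\<exists>u ps. u \<in> h ` D \<and> dvd_in (h ` D) u 1 \<and> (\<forall>p\<in>set ps. prime_in (h ` D) p) \<and>
      h a = u * prod_list ps" if a: "a \<in> D" "h a \<noteq> 0" for a
  proof -
    obtain u ps where u: "u \<in> D" "dvd_in D u 1" "\<forall>p\<in>set ps. prime_in D p" "a = u * prod_list ps"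
      using fact a h0 unfolding factorial_in_def by metis
    have psD: "set ps \<subseteq> D" using u(3) prime_inD(1) by blast
    have "h a = h u * prod_list (map h ps)"
      using u(4) plist[OF psD] hom(3)[OF u(1) subring_prod_list[OF D psD]] by simp
    moreover have "dvd_in (h ` D) (h u) 1" using u dvd subring_one[OF D] hom(1) by metis
    ultimately show ?thesis using u prime
      by (intro exI[of _ "h u"] exI[of _ "map h ps"]) auto
  qed
  then show ?thesis using sub unfolding factorial_in_def by blast
qed

section \<open>Ring homomorphisms and evaluation\<close>

abbreviation (input) lookup :: "('a \<Rightarrow>\<^sub>0 'b::zero) \<Rightarrow> 'a \<Rightarrow> 'b" where
  "lookup \<equiv> Poly_Mapping.lookup"

abbreviation (input) single :: "'a \<Rightarrow> 'b \<Rightarrow> ('a \<Rightarrow>\<^sub>0 'b::zero)" where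
  "single \<equiv> Poly_Mapping.single"

abbreviation (input) keys :: "('a \<Rightarrow>\<^sub>0 'b::zero) \<Rightarrow> 'a set" where
  "keys \<equiv> Poly_Mapping.keys"

text \<open>
  Homomorphisms of commutative rings with \<open>1\<close>.
\<close>

locale unital_hom =
  fixes h :: "'a::comm_ring_1 \<Rightarrow> 'b::comm_ring_1"
  assumes hom_one: "h 1 = 1"
    and hom_add: "h (a + b) = h a + h b"
    and hom_mult: "h (a * b) = h a * h b"
begin

lemma hom_zero: "h 0 = 0"
  using hom_add[of 0 0] by simp

lemma hom_uminus: "h (- a) = - h a"
  using hom_add[of "- a" a] hom_zero by (simp add: eq_neg_iff_add_eq_0)

lemma hom_diff: "h (a - b) = h a - h b"
  using hom_add[of a "- b"] hom_uminus[of b] by simp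

lemma hom_sum: "h (\<Sum>i\<in>I. f i) = (\<Sum>i\<in>I. h (f i))"
  by (induction I rule: infinite_finite_induct) (auto simp: hom_zero hom_add)

lemma hom_prod: "h (\<Prod>i\<in>I. f i) = (\<Prod>i\<in>I. h (f i))"
  by (induction I rule: infinite_finite_induct) (auto simp: hom_one hom_mult)

lemma hom_power: "h (a ^ n) = h a ^ n"
  by (induction n) (auto simp: hom_one hom_mult)

lemma hom_prod_list: "h (prod_list xs) = prod_list (map h xs)"
  by (induction xs) (auto simp: hom_one hom_mult)

lemma subring_of_range: "subring_of (range h)"
  unfolding subring_of_def
proof (intro conjI ballI)
  show "1 \<in> range h" by (rule range_eqI[where x = 1]) (simp add: hom_one)
qed (auto simp flip: hom_diff hom_mult)

end

lemma pm_induct [case_names zero add]: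
  assumes "P 0" "\<And>m c f. P f \<Longrightarrow> P (single m c + f)"
  shows "P (f :: 'a \<Rightarrow>\<^sub>0 'b::comm_monoid_add)"
proof (induction f rule: update_induct)
  case const
  then show ?case by (rule assms(1))
next
  case (update f a b)
  have "Poly_Mapping.update a b f = single a b + f"
    using update(1) by (intro poly_mapping_eqI) (auto simp: lookup_update lookup_add lookup_single when_def in_keys_iff)
  then show ?case using assms(2)[OF update(3)] by simp
qed

text \<open>
  The common form of \<^const>\<open>mpoly_eval\<close> and \<^const>\<open>laurent_eval\<close>: \<open>M\<close> gives the values of the
  monomials.
\<close>

definition pm_eval :: "('s::zero \<Rightarrow> 'r::comm_semiring_1) \<Rightarrow> ('m \<Rightarrow> 'r) \<Rightarrow> ('m \<Rightarrow>\<^sub>0 's) \<Rightarrow> 'r" where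
  "pm_eval \<phi> M p = (\<Sum>m\<in>keys p. \<phi> (lookup p m) * M m)"

lemma pm_eval_single: "\<phi> 0 = 0 \<Longrightarrow> pm_eval \<phi> M (single m c) = \<phi> c * M m"
  by (auto simp: pm_eval_def)

lemma unital_hom_pm_eval:
  fixes \<phi> :: "'s::comm_ring_1 \<Rightarrow> 'r::comm_ring_1" and M :: "'m::comm_monoid_add \<Rightarrow> 'r"
  assumes "unital_hom \<phi>" and M: "M 0 = 1" "\<And>a b. M (a + b) = M a * M b"
  shows "unital_hom (pm_eval \<phi> M)"
proof -
  interpret unital_hom \<phi> by fact
  have add: "pm_eval \<phi> M (p + q) = pm_eval \<phi> M p + pm_eval \<phi> M q" for p q
    unfolding pm_eval_def
    by (rule setsum_keys_plus_distrib) (auto simp: hom_zero hom_add algebra_simps)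
  have zero: "pm_eval \<phi> M 0 = 0" by (simp add: pm_eval_def)
  note single = pm_eval_single[of \<phi>, OF hom_zero]
  have mult1: "pm_eval \<phi> M (single m c * q) = \<phi> c * M m * pm_eval \<phi> M q" for m c q
    by (induction q rule: pm_induct)
      (auto simp: zero add single mult_single distrib_left M hom_mult algebra_simps)
  have "pm_eval \<phi> M (p * q) = pm_eval \<phi> M p * pm_eval \<phi> M q" for p q
    by (induction p rule: pm_induct) (auto simp: zero add single mult1 distrib_right)
  moreover have "pm_eval \<phi> M 1 = 1" unfolding single_one[symmetric]
    by (simp only: single hom_one M) simp
  ultimately show ?thesis by unfold_locales (auto simp: add)
qed

lemma mpoly_eval_altdef:
  "mpoly_eval \<phi> y = pm_eval \<phi> (\<lambda>m. \<Prod>i\<in>UNIV. y i ^ lookup m i)"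
  by (rule ext) (simp add: mpoly_eval_def pm_eval_def)

lemma laurent_eval_altdef:
  "laurent_eval \<phi> y = pm_eval \<phi> (\<lambda>m. \<Prod>i\<in>UNIV. y i powi lookup m i)"
  by (rule ext) (simp add: laurent_eval_def pm_eval_def)

lemma unital_hom_mpoly_eval:
  "unital_hom \<phi> \<Longrightarrow> unital_hom (mpoly_eval \<phi> y)"
  unfolding mpoly_eval_altdef
  by (rule unital_hom_pm_eval) (auto simp: lookup_add power_add prod.distrib)

lemma unital_hom_laurent_eval:
  "unital_hom \<phi> \<Longrightarrow> (\<And>i. y i \<noteq> 0) \<Longrightarrow> unital_hom (laurent_eval \<phi> y)"
  unfolding laurent_eval_altdef
  by (rule unital_hom_pm_eval) (auto simp: lookup_add power_int_add prod.distrib)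

lemma mpoly_eval_single:
  "unital_hom \<phi> \<Longrightarrow> mpoly_eval \<phi> y (single m c) =
     \<phi> c * (\<Prod>i\<in>UNIV. y i ^ lookup m i)"
  unfolding mpoly_eval_altdef by (subst pm_eval_single) (auto simp: unital_hom.hom_zero)

lemma laurent_eval_single:
  "unital_hom \<phi> \<Longrightarrow> laurent_eval \<phi> y (single m c) =
     \<phi> c * (\<Prod>i\<in>UNIV. y i powi lookup m i)"
  unfolding laurent_eval_altdef by (subst pm_eval_single) (auto simp: unital_hom.hom_zero)

lemma unital_hom_mconst: "unital_hom (mconst :: 's::comm_ring_1 \<Rightarrow> ('e::comm_monoid_add \<Rightarrow>\<^sub>0 's))"
  by unfold_locales (auto simp: mconst_def single_add mult_single)

lemma prod_single_var_power:
  "(\<Prod>i\<in>UNIV. (y i :: 'r::comm_monoid_mult) ^ lookup (single (j::'i::finite) n) i) = y j ^ n"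
  by (subst prod.remove[where x = j]) (auto simp: lookup_single when_def)

lemma prod_single_var_powi:
  "(\<Prod>i\<in>UNIV. (y i :: 'r::field) powi lookup (single (j::'i::finite) n) i) = y j powi n"
  by (subst prod.remove[where x = j]) (auto simp: lookup_single when_def)

lemma mpoly_eval_mvar: "unital_hom \<phi> \<Longrightarrow> mpoly_eval \<phi> y (mvar j) = y j"
  by (simp add: mvar_def mpoly_eval_single prod_single_var_power unital_hom.hom_one)

lemma laurent_eval_mconst: "unital_hom \<phi> \<Longrightarrow> laurent_eval \<phi> y (mconst c) = \<phi> c"
  by (simp add: mconst_def laurent_eval_single)

lemma laurent_eval_mvar: "unital_hom \<phi> \<Longrightarrow> laurent_eval \<phi> y (mvar j) = y j"
  unfolding mvar_def laurent_eval_single prod_single_var_powi by (simp add: unital_hom.hom_one)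

lemma mvar_power: "(mvar k :: (('i \<Rightarrow>\<^sub>0 nat) \<Rightarrow>\<^sub>0 's::comm_ring_1)) ^ n = single (single k n) 1"
  by (induction n) (auto simp: mvar_def mult_single single_add[symmetric])

lemma hom_mpoly_eval:
  assumes "unital_hom h" "unital_hom \<phi>"
  shows "h (mpoly_eval \<phi> y p) = mpoly_eval (\<lambda>c. h (\<phi> c)) (\<lambda>i. h (y i)) p"
proof -
  interpret h: unital_hom h by fact
  interpret e: unital_hom "mpoly_eval \<phi> y" by (rule unital_hom_mpoly_eval) fact
  have c: "unital_hom (\<lambda>c. h (\<phi> c))"
    using assms by (auto simp: unital_hom_def)
  interpret c: unital_hom "mpoly_eval (\<lambda>c. h (\<phi> c)) (\<lambda>i. h (y i))"
    by (rule unital_hom_mpoly_eval) fact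
  show ?thesis
    by (induction p rule: pm_induct)
      (auto simp: h.hom_zero e.hom_zero c.hom_zero h.hom_add e.hom_add c.hom_add
        mpoly_eval_single[OF assms(2)] mpoly_eval_single[OF c] h.hom_mult h.hom_prod h.hom_power)
qed

section \<open>Laurent polynomials\<close>

lemma single_one_nonzero [simp]: "single m (1::'b::zero_neq_one) \<noteq> 0"
  by (metis lookup_single_eq lookup_zero zero_neq_one)

text \<open>
  Exponent vectors of polynomials, read as exponent vectors of Laurent polynomials.
\<close>

definition lift_exp :: "('i \<Rightarrow>\<^sub>0 nat) \<Rightarrow> ('i \<Rightarrow>\<^sub>0 int)" where
  "lift_exp m = Poly_Mapping.map int m"

lemma lookup_lift_exp [simp]: "lookup (lift_exp m) i = int (lookup m i)"
  by (simp add: lift_exp_def map.rep_eq when_def)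

lemma lift_exp_inject [simp]: "lift_exp m = lift_exp n \<longleftrightarrow> m = n"
  by (auto simp: poly_mapping_eq_iff fun_eq_iff)

lemma lift_exp_zero [simp]: "lift_exp 0 = 0"
  by (rule poly_mapping_eqI) simp

lemma lift_exp_surj:
  assumes "\<And>i. lookup n i \<ge> 0"
  obtains m where "n = lift_exp m"
  by (rule that[of "Poly_Mapping.map nat n"])
    (use assms in \<open>auto intro!: poly_mapping_eqI simp: map.rep_eq when_def\<close>)

lemma unital_hom_to_laurent:
  "unital_hom (to_laurent :: ('i::finite, 's::comm_ring_1) mpoly \<Rightarrow> ('i, 's) lpoly)"
  unfolding to_laurent_def by (rule unital_hom_mpoly_eval[OF unital_hom_mconst])

global_interpretation tl: unital_hom "to_laurent :: ('i::finite, 's::comm_ring_1) mpoly \<Rightarrow> ('i, 's) lpoly"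
  by (rule unital_hom_to_laurent)

lemma prod_single_exp:
  "(\<Prod>i\<in>I. single (f i) (1::'s::comm_semiring_1)) = single (\<Sum>i\<in>I. f i :: 'e::comm_monoid_add) 1"
  by (induction I rule: infinite_finite_induct) (auto simp: mult_single)

lemma single_power: "single (single i (e::'e::comm_ring_1)) (1::'s::comm_semiring_1) ^ n
    = single (single i (of_nat n * e)) 1"
  by (induction n) (auto simp: mult_single single_add[symmetric] algebra_simps)

lemma exp_expansion: "(\<Sum>i\<in>UNIV. single i (lookup m i)) = (m :: 'i::finite \<Rightarrow>\<^sub>0 'e::comm_monoid_add)"
  by (rule poly_mapping_eqI) (simp add: lookup_sum lookup_single when_def)

lemma to_laurent_single [simp]: "to_laurent (single m c) = single (lift_exp m) c"
proof -
  have "(\<Sum>i\<in>UNIV. single i (int (lookup m i))) = lift_exp m"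
    using exp_expansion[of "lift_exp m"] by simp
  then show ?thesis
    unfolding to_laurent_def mpoly_eval_single[OF unital_hom_mconst] mvar_def single_power
    by (simp add: prod_single_exp mconst_def mult_single)
qed

lemma to_laurent_mvar [simp]: "to_laurent (mvar i) = mvar i"
  by (simp add: mvar_def) (rule arg_cong[where f = "\<lambda>m. single m 1"], rule poly_mapping_eqI,
    simp add: lookup_single when_def)

lemma lookup_to_laurent [simp]: "lookup (to_laurent p) (lift_exp m) = lookup p m"
  by (induction p rule: pm_induct) (auto simp: tl.hom_zero tl.hom_add lookup_add lookup_single when_def)

lemma keys_to_laurent: "keys (to_laurent p) = lift_exp ` keys p"
proof -
  have "keys (to_laurent p) \<subseteq> range lift_exp"
  proof (induction p rule: pm_induct)
    case (add m c f)
    then show ?case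
      using keys_add[of "single (lift_exp m) c" "to_laurent f"]
      by (auto simp: tl.hom_add split: if_splits)
  qed (simp add: tl.hom_zero)
  then show ?thesis by (auto simp: in_keys_iff)
qed

lemma to_laurent_inject [simp]: "to_laurent p = to_laurent q \<longleftrightarrow> p = q"
  by (metis lookup_to_laurent poly_mapping_eqI)

lemma to_laurent_eq_0_iff [simp]: "to_laurent p = 0 \<longleftrightarrow> p = 0"
  using to_laurent_inject[of p 0] by (simp add: tl.hom_zero)

lemma laurent_eval_to_laurent:
  assumes "unital_hom \<phi>" "\<And>i. y i \<noteq> 0"
  shows "laurent_eval \<phi> y (to_laurent p) = mpoly_eval \<phi> y p"
proof -
  interpret l: unital_hom "laurent_eval \<phi> y" by (rule unital_hom_laurent_eval) fact+
  interpret m: unital_hom "mpoly_eval \<phi> y" by (rule unital_hom_mpoly_eval) fact+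
  show ?thesis
    by (induction p rule: pm_induct)
      (auto simp: tl.hom_zero tl.hom_add l.hom_zero l.hom_add m.hom_zero m.hom_add
        laurent_eval_single[OF assms(1)] mpoly_eval_single[OF assms(1)])
qed

lemma to_laurent_surj:
  assumes "\<And>n i. n \<in> keys P \<Longrightarrow> lookup n i \<ge> 0"
  obtains p where "P = to_laurent p"
proof -
  have "\<forall>n\<in>keys P. \<exists>m. n = lift_exp m" using assms by (meson lift_exp_surj)
  then obtain g where g: "\<And>n. n \<in> keys P \<Longrightarrow> n = lift_exp (g n)" by metis
  have "P = (\<Sum>n\<in>keys P. single n (lookup P n))"
    by (rule poly_mapping_eqI) (auto simp: lookup_sum lookup_single when_def in_keys_iff)
  also have "\<dots> = to_laurent (\<Sum>n\<in>keys P. single (g n) (lookup P n))"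
    using g by (simp add: tl.hom_sum cong: sum.cong)
  finally show ?thesis by (rule that)
qed

section \<open>Homogeneous components in one variable\<close>

text \<open>
  The variable \<open>k\<close> does not occur.  For polynomials this is the negation of \<^const>\<open>involves\<close>; it
  is needed for Laurent polynomials as well.
\<close>

definition free_of :: "'i \<Rightarrow> (('i \<Rightarrow>\<^sub>0 'e::zero) \<Rightarrow>\<^sub>0 's::zero) \<Rightarrow> bool" where
  "free_of k p \<longleftrightarrow> (\<forall>m\<in>keys p. lookup m k = 0)"

lemma involves_iff: "involves k p \<longleftrightarrow> \<not> free_of k p"
  by (simp add: involves_def free_of_def)

lemma free_of_to_laurent [simp]: "free_of k (to_laurent p) \<longleftrightarrow> free_of k p"
  by (auto simp: free_of_def keys_to_laurent)

text \<open>
  The part of \<open>p\<close> that is homogeneous of degree \<open>n\<close> in the variable \<open>k\<close>.  It is linear over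
  the (Laurent) polynomials free of \<open>k\<close>, which makes it possible to compare coefficients.
\<close>

definition hcomp :: "'i \<Rightarrow> 'e \<Rightarrow> (('i \<Rightarrow>\<^sub>0 'e::zero) \<Rightarrow>\<^sub>0 's::comm_monoid_add) \<Rightarrow> (('i \<Rightarrow>\<^sub>0 'e) \<Rightarrow>\<^sub>0 's)" where
  "hcomp k n p = (\<Sum>m | m \<in> keys p \<and> lookup m k = n.
     single m (lookup p m))"

lemma set_zero_eq_hcomp: "set_zero j p = hcomp j 0 p"
  by (simp add: set_zero_def hcomp_def)

lemma lookup_hcomp: "lookup (hcomp k n p) m = (lookup p m when lookup m k = n)"
proof -
  have "lookup (hcomp k n p) m =
      (\<Sum>m' | m' \<in> keys p \<and> lookup m' k = n. (lookup p m' when m' = m))"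
    by (simp add: hcomp_def lookup_sum lookup_single)
  also have "\<dots> = (lookup p m when lookup m k = n)"
    by (auto simp: when_def in_keys_iff)
  finally show ?thesis .
qed

lemma hcomp_add: "hcomp k n (p + q) = hcomp k n p + hcomp k n q"
  by (rule poly_mapping_eqI) (auto simp: lookup_hcomp lookup_add when_def)

lemma hcomp_zero [simp]: "hcomp k n 0 = 0"
  by (rule poly_mapping_eqI) (auto simp: lookup_hcomp when_def)

lemma hcomp_sum: "hcomp k n (\<Sum>i\<in>I. f i) = (\<Sum>i\<in>I. hcomp k n (f i))"
  by (induction I rule: infinite_finite_induct) (auto simp: hcomp_add)

lemma hcomp_single: "hcomp k n (single m c) = (if lookup m k = n then single m c else 0)"
  by (rule poly_mapping_eqI) (auto simp: lookup_hcomp lookup_single when_def)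

lemma free_of_iff_hcomp: "free_of k p \<longleftrightarrow> hcomp k 0 p = p"
proof
  assume "free_of k p"
  then show "hcomp k 0 p = p"
    by (intro poly_mapping_eqI) (auto simp: lookup_hcomp when_def free_of_def in_keys_iff)
next
  assume "hcomp k 0 p = p"
  then have "lookup (hcomp k 0 p) m = lookup p m" for m by simp
  then show "free_of k p"
    by (force simp: lookup_hcomp when_def free_of_def in_keys_iff split: if_splits)
qed

lemma free_of_hcomp_other: "free_of j p \<Longrightarrow> free_of j (hcomp k n p)"
  by (auto simp: free_of_def in_keys_iff lookup_hcomp when_def split: if_splits)

lemma free_of_hcomp_zero: "free_of k (hcomp k 0 p)"
  by (auto simp: free_of_def in_keys_iff lookup_hcomp when_def split: if_splits)

lemma hcomp_hcomp_mult:
  fixes c p :: "('i \<Rightarrow>\<^sub>0 'e::cancel_comm_monoid_add) \<Rightarrow>\<^sub>0 's::comm_semiring_1"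
  shows "hcomp k n (hcomp k 0 c * p) = hcomp k 0 c * hcomp k n p"
proof (induction c rule: pm_induct)
  case (add m a c)
  have "hcomp k n (hcomp k 0 (single m a) * p) =
      hcomp k 0 (single m a) * hcomp k n p"
  proof (induction p rule: pm_induct)
    case (add m' a' p)
    then show ?case
      by (auto simp: hcomp_add hcomp_single mult_single distrib_left lookup_add split: if_splits)
  qed simp
  with add show ?case by (simp add: hcomp_add distrib_right)
qed simp

lemma hcomp_mult_free:
  fixes c p :: "('i \<Rightarrow>\<^sub>0 'e::cancel_comm_monoid_add) \<Rightarrow>\<^sub>0 's::comm_semiring_1"
  shows "free_of k c \<Longrightarrow> hcomp k n (c * p) = c * hcomp k n p"
  using hcomp_hcomp_mult[of k n c p] by (simp add: free_of_iff_hcomp)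

lemma free_of_zero [simp]: "free_of k 0"
  and free_of_one [simp]: "free_of k (1 :: ('i \<Rightarrow>\<^sub>0 'e::zero) \<Rightarrow>\<^sub>0 's::zero_neq_one)"
  and free_of_single: "free_of k (single m c) \<longleftrightarrow> c = 0 \<or> lookup m k = 0"
  by (auto simp: free_of_def)

lemma free_of_add:
  fixes p q :: "('i \<Rightarrow>\<^sub>0 'e::zero) \<Rightarrow>\<^sub>0 's::comm_monoid_add"
  shows "free_of k p \<Longrightarrow> free_of k q \<Longrightarrow> free_of k (p + q)"
  by (simp add: free_of_iff_hcomp hcomp_add)

lemma free_of_sum:
  "(\<And>i. i \<in> I \<Longrightarrow> free_of k (f i)) \<Longrightarrow> free_of k (\<Sum>i\<in>I. f i)"
  by (simp add: free_of_iff_hcomp hcomp_sum)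

lemma free_of_uminus: "free_of k (p :: ('i \<Rightarrow>\<^sub>0 'e::zero) \<Rightarrow>\<^sub>0 's::ab_group_add) \<Longrightarrow> free_of k (- p)"
  by (auto simp: free_of_def in_keys_iff)

lemma free_of_mult:
  fixes p q :: "('i \<Rightarrow>\<^sub>0 'e::cancel_comm_monoid_add) \<Rightarrow>\<^sub>0 's::comm_semiring_1"
  shows "free_of k p \<Longrightarrow> free_of k q \<Longrightarrow> free_of k (p * q)"
  by (simp add: free_of_iff_hcomp[of k "p * q"] hcomp_mult_free) (simp add: free_of_iff_hcomp)

lemma free_of_prod_list:
  fixes ps :: "(('i \<Rightarrow>\<^sub>0 'e::cancel_comm_monoid_add) \<Rightarrow>\<^sub>0 's::comm_semiring_1) list"
  shows "(\<And>p. p \<in> set ps \<Longrightarrow> free_of k p) \<Longrightarrow> free_of k (prod_list ps)"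
  by (induction ps) (auto simp: free_of_mult)

lemma free_of_power:
  fixes p :: "('i \<Rightarrow>\<^sub>0 'e::cancel_comm_monoid_add) \<Rightarrow>\<^sub>0 's::comm_semiring_1"
  shows "free_of k p \<Longrightarrow> free_of k (p ^ n)"
  by (induction n) (auto simp: free_of_mult)

lemma free_of_cancel:
  fixes c p :: "('i::linorder \<Rightarrow>\<^sub>0 'e::{ordered_comm_monoid_add, ordered_ab_semigroup_add_imp_le, cancel_comm_monoid_add, linorder}) \<Rightarrow>\<^sub>0 's::idom"
  assumes "free_of k c" "c \<noteq> 0" "free_of k (c * p)"
  shows "free_of k p"
  using assms hcomp_mult_free[OF assms(1), of 0 p] by (simp add: free_of_iff_hcomp)

lemma mvar_power_free: "j \<noteq> k \<Longrightarrow> free_of k (mvar j :: (('i \<Rightarrow>\<^sub>0 'e::zero_neq_one) \<Rightarrow>\<^sub>0 's::zero_neq_one))"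
  by (simp add: mvar_def free_of_single lookup_single when_def)

section \<open>Unique factorisation of polynomials in several variables\<close>

text \<open>
  The polynomials in the variables of \<open>I\<close>.  Unique factorisation is proved by induction on \<open>I\<close>;
  \<open>polys_in_insert\<close> identifies the step with the passage from \<open>D\<close> to \<open>D[X]\<close>.
\<close>

definition polys_in :: "'i set \<Rightarrow> ('i, 's::comm_ring_1) mpoly set" where
  "polys_in I = {p. \<forall>k\<in>-I. free_of k p}"

lemma subring_polys_in: "subring_of (polys_in I :: ('i, 's::comm_ring_1) mpoly set)"
  unfolding subring_of_def polys_in_def
  by (auto simp: free_of_mult diff_conv_add_uminus free_of_add free_of_uminus simp del: add_uminus_conv_diff)

lemma hcomp_poly_mvar:
  fixes f :: "('i, 's::comm_ring_1) mpoly poly"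
  assumes "\<And>n. free_of k (coeff f n)"
  shows "hcomp k n (poly f (mvar k)) = coeff f n * mvar k ^ n"
proof -
  have "hcomp k n (poly f (mvar k)) = (\<Sum>i\<le>degree f. coeff f i * hcomp k n (mvar k ^ i))"
    by (simp add: poly_altdef hcomp_sum hcomp_mult_free[OF assms])
  also have "\<dots> = (\<Sum>i\<le>degree f. if n = i then coeff f i * mvar k ^ i else 0)"
    by (intro sum.cong refl) (auto simp: mvar_power hcomp_single lookup_single)
  also have "\<dots> = coeff f n * mvar k ^ n"
    by (auto simp: coeff_eq_0)
  finally show ?thesis .
qed

lemma mvar_nonzero [simp]: "(mvar k :: ('i, 's::comm_ring_1) mpoly) \<noteq> 0"
  by (simp add: mvar_def)

lemma inj_on_poly_mvar:
  "inj_on (\<lambda>f. poly f (mvar k)) {f :: ('i::linorder, 's::idom) mpoly poly. \<forall>n. free_of k (coeff f n)}"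
proof (rule inj_onI)
  fix f g :: "('i, 's) mpoly poly"
  assume f: "f \<in> {f. \<forall>n. free_of k (coeff f n)}" "g \<in> {f. \<forall>n. free_of k (coeff f n)}"
    and eq: "poly f (mvar k) = poly g (mvar k)"
  have "coeff f n * mvar k ^ n = coeff g n * mvar k ^ n" for n
    using f eq hcomp_poly_mvar[of k f n] hcomp_poly_mvar[of k g n] by simp
  then show "f = g" by (intro poly_eqI) simp
qed

lemma polys_in_insert:
  assumes "k \<notin> I"
  shows "polys_in (insert k I) = (\<lambda>f. poly f (mvar k)) ` polys_over (polys_in I :: ('i::linorder, 's::idom) mpoly set)"
proof (intro equalityI subsetI)
  let ?D = "polys_in I :: ('i, 's) mpoly set"
  note D = subring_polys_in[of I, where 's = 's]
  note P = subring_polys_over[OF D]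
  have sub: "subring_of ((\<lambda>f. poly f (mvar k)) ` polys_over ?D)"
    unfolding subring_of_def
  proof (intro conjI ballI)
    show "1 \<in> (\<lambda>f. poly f (mvar k)) ` polys_over ?D"
      by (rule image_eqI[of _ _ 1]) (simp_all add: subring_one[OF P])
    fix a b assume "a \<in> (\<lambda>f. poly f (mvar k)) ` polys_over ?D" "b \<in> (\<lambda>f. poly f (mvar k)) ` polys_over ?D"
    then obtain f g where "f \<in> polys_over ?D" "g \<in> polys_over ?D" "a = poly f (mvar k)" "b = poly g (mvar k)" by blast
    then show "a - b \<in> (\<lambda>f. poly f (mvar k)) ` polys_over ?D" "a * b \<in> (\<lambda>f. poly f (mvar k)) ` polys_over ?D"
      using subring_diff[OF P] subring_mult[OF P] by (metis (no_types) image_eqI poly_diff poly_mult)+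
  qed
  fix p :: "('i, 's) mpoly"
  assume p: "p \<in> polys_in (insert k I)"
  have "p = (\<Sum>n\<in>keys p. single n (lookup p n))"
    by (rule poly_mapping_eqI) (auto simp: lookup_sum lookup_single when_def in_keys_iff)
  also have "\<dots> \<in> (\<lambda>f. poly f (mvar k)) ` polys_over ?D"
  proof (rule subring_sum[OF sub])
    fix n assume n: "n \<in> keys p"
    define c where "c = single (Poly_Mapping.update k 0 n) (lookup p n)"
    have "c \<in> ?D" using n p
      by (auto simp: c_def polys_in_def free_of_single lookup_update free_of_def)
    moreover have "Poly_Mapping.update k 0 n + single k (lookup n k) = n"
      by (rule poly_mapping_eqI) (auto simp: lookup_add lookup_update lookup_single when_def)
    then have "single n (lookup p n) = poly (monom c (lookup n k)) (mvar k)"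
      by (simp add: poly_monom mvar_power c_def mult_single)
    ultimately show "single n (lookup p n) \<in> (\<lambda>f. poly f (mvar k)) ` polys_over ?D"
      using monom_in_polys_over[OF D] by blast
  qed
  finally show "p \<in> (\<lambda>f. poly f (mvar k)) ` polys_over ?D" .
next
  fix p :: "('i, 's) mpoly"
  assume "p \<in> (\<lambda>f. poly f (mvar k)) ` polys_over (polys_in I)"
  then obtain f where f: "f \<in> polys_over (polys_in I)" "p = poly f (mvar k)" by blast
  have "free_of j p" if "j \<notin> insert k I" for j
    using f that
    by (auto simp: poly_altdef polys_over_def polys_in_def intro!: free_of_sum free_of_mult free_of_power mvar_power_free)
  then show "p \<in> polys_in (insert k I)" by (auto simp: polys_in_def)
qed

lemma factorial_in_base: "factorial_in (UNIV :: 's::{factorial_semiring, idom} set)"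
proof -
  have "\<exists>u ps. u dvd 1 \<and> (\<forall>p\<in>set ps. prime_elem p) \<and> a = u * prod_list ps" if a: "a \<noteq> 0" for a :: 's
  proof -
    obtain A where A: "\<forall>x. x \<in># A \<longrightarrow> prime_elem x" "normalize (prod_mset A) = normalize a"
      using prime_factorization_exists[OF a] by blast
    obtain ps where ps: "A = mset ps" using ex_mset by metis
    have "prod_list ps dvd a" "a dvd prod_list ps"
      using A(2) by (simp_all add: ps prod_mset_prod_list associated_iff_dvd)
    then obtain u v where "a = prod_list ps * u" "prod_list ps = a * v" by (metis dvd_def)
    then have "a * 1 = a * (v * u)" by (metis mult.assoc mult_1_right)
    then have "1 = v * u" using a by (simp only: mult_cancel_left) simp
    then have "u dvd 1" by (metis dvd_triv_right)
    then show ?thesis using A(1) ps \<open>a = prod_list ps * u\<close>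
      by (intro exI[of _ u] exI[of _ ps]) (auto simp: mult.commute)
  qed
  then show ?thesis
    by (auto simp: factorial_in_def subring_of_def prime_in_def dvd_in_def prime_elem_def dvd_def)
qed

lemma polys_in_empty: "polys_in {} = range (mconst :: 's::comm_ring_1 \<Rightarrow> ('i, 's) mpoly)"
proof (intro equalityI subsetI)
  fix p :: "('i, 's) mpoly" assume p: "p \<in> polys_in {}"
  have "m = 0" if "m \<in> keys p" for m
    using that p by (intro poly_mapping_eqI) (auto simp: polys_in_def free_of_def)
  then have "p = mconst (lookup p 0)"
    by (intro poly_mapping_eqI) (auto simp: mconst_def lookup_single when_def in_keys_iff)
  then show "p \<in> range mconst" by blast
qed (auto simp: polys_in_def mconst_def free_of_single)

lemma mconst_inject [simp]: "mconst a = mconst b \<longleftrightarrow> a = b"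
  by (metis mconst_def lookup_single_eq)

lemma factorial_in_polys_in:
  assumes "finite I"
  shows "factorial_in (polys_in I :: ('i::linorder, 's::{factorial_semiring, idom}) mpoly set)"
  using assms
proof (induction I rule: finite_induct)
  case empty
  interpret c: unital_hom "mconst :: 's \<Rightarrow> ('i, 's) mpoly" by (rule unital_hom_mconst)
  show ?case unfolding polys_in_empty
    by (rule factorial_in_image[OF factorial_in_base])
      (auto simp: c.hom_one c.hom_diff c.hom_mult inj_on_def)
next
  case (insert k I)
  have "polys_over (polys_in I :: ('i, 's) mpoly set) \<subseteq> {f. \<forall>n. free_of k (coeff f n)}"
    using insert(2) by (auto simp: polys_over_def polys_in_def)
  then show ?case unfolding polys_in_insert[OF insert(2)]
    using factorial_in_polys_over[OF insert(3)] inj_on_subset[OF inj_on_poly_mvar]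
    by (intro factorial_in_image) auto
qed

theorem mpoly_prime_factorization:
  fixes p :: "('i::{finite,linorder}, 's::{factorial_semiring, idom}) mpoly"
  assumes "p \<noteq> 0"
  shows "\<exists>u ps. u dvd 1 \<and> (\<forall>q\<in>set ps. prime_elem q) \<and> p = u * prod_list ps"
proof -
  have "polys_in UNIV = (UNIV :: ('i, 's) mpoly set)" by (auto simp: polys_in_def)
  then have "factorial_in (UNIV :: ('i, 's) mpoly set)"
    using factorial_in_polys_in[of "UNIV :: 'i set", where 's = 's] by simp
  then show ?thesis using assms
    by (auto simp: factorial_in_def prime_in_def dvd_in_def prime_elem_def dvd_def)
qed

lemma mpoly_as_poly:
  fixes p :: "('i::linorder, 's::idom) mpoly"
  obtains f where "p = poly f (mvar k)" "\<And>n. free_of k (coeff f n)"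
proof -
  have "p \<in> polys_in (insert k (-{k}))" by (auto simp: polys_in_def)
  then obtain f where f: "f \<in> polys_over (polys_in (-{k}))" "p = poly f (mvar k)"
    unfolding polys_in_insert[of k "-{k}", simplified] by blast
  show ?thesis by (rule that[OF f(2)]) (use f(1) in \<open>auto simp: polys_over_def polys_in_def\<close>)
qed

lemma free_of_factor:
  fixes p q :: "('i::linorder, 's::idom) mpoly"
  assumes "free_of k (p * q)" "p * q \<noteq> 0"
  shows "free_of k p"
proof -
  obtain f where f: "p = poly f (mvar k)" "\<And>n. free_of k (coeff f n)" using mpoly_as_poly[of p k] by blast
  obtain g where g: "q = poly g (mvar k)" "\<And>n. free_of k (coeff g n)" using mpoly_as_poly[of q k] by blast
  have "f * g \<in> {f. \<forall>n. free_of k (coeff f n)}"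
    using f g by (auto simp: coeff_mult intro!: free_of_sum free_of_mult)
  moreover have "[:p * q:] \<in> {f. \<forall>n. free_of k (coeff f n)}"
    using assms by (auto simp: coeff_pCons split: nat.split)
  moreover have "poly (f * g) (mvar k) = poly [:p * q:] (mvar k)" using f g by simp
  ultimately have "f * g = [:p * q:]" by (intro inj_onD[OF inj_on_poly_mvar[of k]])
  then have "degree (f * g) = 0" by simp
  then have "degree f = 0" using assms f g degree_mult_eq[of f g] by force
  then obtain c where "f = [:c:]" by (metis degree_0_id)
  then show ?thesis using f(1) f(2)[of 0] by simp
qed

section \<open>Unique factorisation of Laurent polynomials\<close>

lemma dvd_mult_unitD: "a dvd b * u \<Longrightarrow> u dvd 1 \<Longrightarrow> a dvd (b :: 'a::comm_semiring_1)"
proof -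
  assume "a dvd b * u" "u dvd 1"
  then obtain v where "1 = u * v" by (auto elim: dvdE)
  then have "b = (b * u) * v" by (metis mult.assoc mult_1_right)
  then show "a dvd b" using \<open>a dvd b * u\<close> by (metis dvd_mult2)
qed

lemma monomial_unit: "(single (m::'i \<Rightarrow>\<^sub>0 int) (1::'s::comm_ring_1)) dvd 1"
proof
  show "1 = single m 1 * single (- m) (1::'s)" by (simp add: mult_single)
qed

text \<open>
  A variable that does not occur in \<open>P\<close> need not occur in the denominator.
\<close>

lemma clear_denominators:
  fixes P :: "('i::finite, 's::comm_ring_1) lpoly"
  obtains m p where "P * single (lift_exp m) 1 = to_laurent p"
    "\<And>k. free_of k P \<Longrightarrow> lookup m k = 0"
    "\<And>k. free_of k P \<Longrightarrow> free_of k p"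
proof -
  define b where "b i = (\<Sum>n\<in>keys P. nat (- lookup n i))" for i
  define m where "m = (\<Sum>i\<in>UNIV. single i (b i))"
  have m: "lookup m i = b i" for i
    by (simp add: m_def lookup_sum lookup_single when_def)
  have b: "int (b i) \<ge> - lookup n i" if "n \<in> keys P" for n i
  proof -
    have "nat (- lookup n i) \<le> b i"
      unfolding b_def by (rule member_le_sum) (use that in auto)
    then show ?thesis by linarith
  qed
  obtain p where p: "P * single (lift_exp m) 1 = to_laurent p"
  proof (rule to_laurent_surj)
    fix n i assume "n \<in> keys (P * single (lift_exp m) 1)"
    then obtain n' where "n' \<in> keys P" "n = n' + lift_exp m"
      using keys_mult[of P "single (lift_exp m) 1"] by auto
    then show "lookup n i \<ge> 0" using b[of n' i] by (simp add: lookup_add m)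
  qed
  have z: "lookup m k = 0" if "free_of k P" for k
    using that by (simp add: m b_def free_of_def)
  have "free_of k p" if "free_of k P" for k
  proof -
    have "free_of k (to_laurent p)"
      unfolding p[symmetric] using z that by (intro free_of_mult) (auto simp: free_of_single)
    then show ?thesis by simp
  qed
  with p z show ?thesis by (rule that)
qed

lemma prime_elem_to_laurent:
  fixes p :: "('i::{finite,linorder}, 's::idom) mpoly"
  assumes p: "prime_elem p" and nu: "\<not> to_laurent p dvd 1"
  shows "prime_elem (to_laurent p)"
proof (rule prime_elemI)
  show "to_laurent p \<noteq> 0" using p by (auto simp: prime_elem_def)
  fix a b assume "to_laurent p dvd a * b"
  then obtain q where q: "a * b = to_laurent p * q" by (auto elim: dvdE)
  obtain ma pa where a: "a * single (lift_exp ma) 1 = to_laurent pa" by (rule clear_denominators)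
  obtain mb pb where b: "b * single (lift_exp mb) 1 = to_laurent pb" by (rule clear_denominators)
  obtain mq pq where q': "q * single (lift_exp mq) 1 = to_laurent pq" by (rule clear_denominators)
  define X :: "('i \<Rightarrow>\<^sub>0 nat) \<Rightarrow> ('i, 's) lpoly" where "X m = single (lift_exp m) 1" for m
  have Xtl: "X m = to_laurent (single m 1)" for m by (simp add: X_def)
  have "to_laurent (pa * pb * single mq 1) = (a * X ma) * (b * X mb) * X mq"
    by (simp add: tl.hom_mult a b X_def)
  also have "\<dots> = (a * b) * X mq * X ma * X mb" by (simp only: ac_simps)
  also have "\<dots> = to_laurent p * (q * X mq) * X ma * X mb" unfolding q by (simp only: ac_simps)
  also have "\<dots> = to_laurent (p * (pq * single ma 1 * single mb 1))"
    unfolding tl.hom_mult Xtl q'[folded X_def, unfolded Xtl] by (simp only: ac_simps)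
  finally have "p dvd pa * pb * single mq 1" by simp
  moreover have "\<not> p dvd single mq 1"
  proof
    assume "p dvd single mq 1"
    then have "to_laurent p dvd X mq" unfolding Xtl by (auto simp: tl.hom_mult elim!: dvdE simp del: to_laurent_single)
    then show False using nu monomial_unit[of "lift_exp mq"] dvd_trans unfolding X_def by blast
  qed
  ultimately have "p dvd pa \<or> p dvd pb" using p by (meson prime_elem_dvd_mult_iff)
  then have "to_laurent p dvd a * X ma \<or> to_laurent p dvd b * X mb"
    unfolding X_def a b by (auto simp: tl.hom_mult elim!: dvdE)
  then show "to_laurent p dvd a \<or> to_laurent p dvd b"
    using dvd_mult_unitD monomial_unit unfolding X_def by blast
qed (use nu in auto)

lemma unit_mult: "a dvd 1 \<Longrightarrow> b dvd 1 \<Longrightarrow> a * b dvd (1 :: 'a::comm_semiring_1)"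
  using mult_dvd_mono[of a 1 b 1] by simp

text \<open>
  The prime factors can be taken from the polynomial ring, and then they involve no variable that
  \<open>P\<close> does not involve.
\<close>

theorem lpoly_prime_factorization:
  fixes P :: "('i::{finite,linorder}, 's::{factorial_semiring, idom}) lpoly"
  assumes "P \<noteq> 0"
  obtains u ps where "u dvd 1" "P = u * prod_list (map to_laurent ps)"
    "\<And>p. p \<in> set ps \<Longrightarrow> prime_elem (to_laurent p)"
    "\<And>p k. p \<in> set ps \<Longrightarrow> free_of k P \<Longrightarrow> free_of k p"
proof -
  obtain m p where p: "P * single (lift_exp m) 1 = to_laurent p"
    "\<And>k. free_of k P \<Longrightarrow> free_of k p"
    using clear_denominators[of P] by metis
  have p0: "p \<noteq> 0"
    using assms p(1) by (metis lookup_single_eq lookup_zero mult_eq_0_iff tl.hom_zero zero_neq_one)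
  obtain u ps where ps: "u dvd 1" "\<forall>q\<in>set ps. prime_elem q" "p = u * prod_list ps"
    using mpoly_prime_factorization[OF p0] by blast
  define us where "us = filter (\<lambda>q. to_laurent q dvd 1) ps"
  define qs where "qs = filter (\<lambda>q. \<not> to_laurent q dvd 1) ps"
  have split: "prod_list (map f ps) = prod_list (map f us) * prod_list (map f qs)"
    for f :: "_ \<Rightarrow> ('i, 's) lpoly"
    unfolding us_def qs_def by (induction ps) (auto simp: algebra_simps)
  have "to_laurent u dvd 1"
  proof -
    obtain v where "1 = u * v" using ps(1) by (auto elim: dvdE)
    then have "1 = to_laurent u * to_laurent v" by (metis tl.hom_mult tl.hom_one)
    then show ?thesis by (metis dvd_triv_left)
  qed
  moreover have "prod_list (map to_laurent us) dvd 1"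
  proof -
    have "prod_list (map to_laurent (filter (\<lambda>q. to_laurent q dvd 1) ps)) dvd (1 :: ('i, 's) lpoly)"
      by (induction ps) (auto simp: unit_mult)
    then show ?thesis by (simp add: us_def)
  qed
  moreover have "single (- lift_exp m) 1 dvd (1 :: ('i, 's) lpoly)" by (rule monomial_unit)
  ultimately have unit: "to_laurent u * prod_list (map to_laurent us) * single (- lift_exp m) 1 dvd 1"
    by (intro unit_mult)
  have "P = (P * single (lift_exp m) 1) * single (- lift_exp m) 1"
    by (simp add: mult.assoc mult_single)
  also have "\<dots> = to_laurent u * prod_list (map to_laurent us) * single (- lift_exp m) 1 *
      prod_list (map to_laurent qs)"
    unfolding p(1) ps(3) tl.hom_mult tl.hom_prod_list split by (simp only: ac_simps)
  finally have P: "P = \<dots>" .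
  show ?thesis
  proof (rule that[OF unit P])
    fix q assume q: "q \<in> set qs"
    then show "prime_elem (to_laurent q)" using ps(2) by (auto simp: qs_def intro: prime_elem_to_laurent)
    fix k assume "free_of k P"
    then have "free_of k p" by (rule p(2))
    obtain ps1 ps2 where "ps = ps1 @ q # ps2" using q split_list unfolding qs_def by fastforce
    then have "p = q * (u * prod_list ps1 * prod_list ps2)" using ps(3) by (simp add: algebra_simps)
    then show "free_of k q" using free_of_factor[of k q] \<open>free_of k p\<close> p0 by metis
  qed
qed

text \<open>
  A product of \<open>n\<close> primes has no more than \<open>n\<close> nonunit factors.  This bounds multiplicities, and the
  number of steps in the removal of common factors.
\<close>

lemma length_le_of_prod_dvd:
  fixes u :: "'a::idom"
  assumes "u dvd 1" "\<forall>p\<in>set ps. prime_elem p" "\<forall>c\<in>set cs. \<not> c dvd 1"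
    "prod_list cs dvd u * prod_list ps"
  shows "length cs \<le> length ps"
  using assms
proof (induction ps arbitrary: cs)
  case Nil
  have "c dvd 1" if c: "c \<in> set cs" for c
  proof -
    obtain cs1 cs2 where "cs = cs1 @ c # cs2" using split_list[OF c] by blast
    then have "prod_list cs = c * (prod_list cs1 * prod_list cs2)" by (simp add: mult_ac)
    then have "c dvd prod_list cs" by simp
    also have "prod_list cs dvd u" using Nil by simp
    also have "u dvd 1" using Nil by simp
    finally show ?thesis .
  qed
  then have "set cs = {}" using Nil.prems(3) by (meson ball_empty equals0I)
  then have "length cs = 0" by simp
  then show ?case by linarith
next
  case (Cons p ps)
  have p: "prime_elem p" "p \<noteq> 0" using Cons.prems by auto
  obtain w where w: "u * (p * prod_list ps) = prod_list cs * w" using Cons.prems(4) by (auto elim: dvdE)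
  have "p dvd prod_list cs * w" unfolding w[symmetric] by simp
  then consider "p dvd prod_list cs" | "p dvd w" using p by (meson prime_elem_dvd_mult_iff)
  then show ?case
  proof cases
    case 1
    then have "\<exists>c\<in>set cs. p dvd c"
    proof (induction cs)
      case Nil
      then show ?case using p by (simp add: prime_elem_def)
    next
      case (Cons a cs)
      then show ?case using p(1) by (auto simp: prime_elem_dvd_mult_iff)
    qed
    then obtain c c' where c: "c \<in> set cs" "c = p * c'" by (auto elim: dvdE)
    obtain cs1 cs2 where cs: "cs = cs1 @ c # cs2" using split_list[OF c(1)] by blast
    have "p * (u * prod_list ps) = prod_list cs * w"
      unfolding w[symmetric] by (simp only: ac_simps)
    also have "prod_list cs = prod_list (cs1 @ cs2) * (p * c')"
      unfolding cs c(2) prod_list.append prod_list.Cons by (simp only: ac_simps)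
    finally have "p * (u * prod_list ps) = p * (prod_list (cs1 @ cs2) * (c' * w))"
      by (simp only: ac_simps)
    then have "u * prod_list ps = prod_list (cs1 @ cs2) * (c' * w)" using p by simp
    then have "prod_list (cs1 @ cs2) dvd u * prod_list ps" by (metis dvd_triv_left)
    then have "length (cs1 @ cs2) \<le> length ps"
      using Cons.prems cs by (intro Cons.IH) auto
    then show ?thesis using cs by simp
  next
    case 2
    then obtain w' where "w = p * w'" by (auto elim: dvdE)
    then have "p * (u * prod_list ps) = p * (prod_list cs * w')"
      using w by (simp only: ac_simps)
    then have "prod_list cs dvd u * prod_list ps" using p by simp
    then have "length cs \<le> length ps" using Cons.prems by (intro Cons.IH) auto
    then show ?thesis by simp
  qed
qed

lemma finite_multiplicity_lpoly:
  fixes P :: "('i::{finite,linorder}, 's::{factorial_semiring, idom}) lpoly"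
  assumes "P \<noteq> 0" "\<not> e dvd 1"
  shows "\<exists>a. e ^ a dvd P \<and> \<not> e ^ Suc a dvd P"
proof -
  obtain u ps where ps: "u dvd 1" "P = u * prod_list (map to_laurent ps)"
    "\<And>p. p \<in> set ps \<Longrightarrow> prime_elem (to_laurent p)"
    by (rule lpoly_prime_factorization[OF assms(1)]) blast
  have "n \<le> length ps" if "e ^ n dvd P" for n
    using length_le_of_prod_dvd[of u "map to_laurent ps" "replicate n e"] ps assms(2) that
    by (auto simp: prod_list_replicate)
  then have "\<not> e ^ Suc (length ps) dvd P" by fastforce
  then obtain b where "\<not> e ^ b dvd P" "\<And>c. c < b \<Longrightarrow> e ^ c dvd P"
    using exists_least_iff[of "\<lambda>n. \<not> e ^ n dvd P"] by blast
  then show ?thesis by (cases b) auto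
qed

text \<open>
  \<open>cs\<close> is a list of nonunits satisfying \<open>Q\<close>, of greatest length among those whose product
  divides \<open>G\<close>.
\<close>

lemma remove_common_factors:
  fixes G :: "('i::{finite,linorder}, 's::{factorial_semiring, idom}) lpoly"
  assumes "G \<noteq> 0"
  shows "\<exists>cs H. G = prod_list cs * H \<and> (\<forall>c\<in>set cs. Q c) \<and> (\<forall>c. Q c \<and> c dvd H \<longrightarrow> c dvd 1)"
proof -
  obtain u ps where ps: "u dvd 1" "G = u * prod_list (map to_laurent ps)"
    "\<And>p. p \<in> set ps \<Longrightarrow> prime_elem (to_laurent p)"
    by (rule lpoly_prime_factorization[OF assms(1)]) blast
  define C where "C cs \<longleftrightarrow> prod_list cs dvd G \<and> (\<forall>c\<in>set cs. Q c \<and> \<not> c dvd 1)" for cs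
  have bd: "length cs \<le> length ps" if "C cs" for cs
    using length_le_of_prod_dvd[of u "map to_laurent ps" cs] ps that by (auto simp: C_def)
  have "C []" by (simp add: C_def)
  moreover have "\<forall>cs. C cs \<longrightarrow> length cs < Suc (length ps)" using bd by (simp add: less_Suc_eq_le)
  ultimately have "\<exists>cs. C cs \<and> (\<forall>ds. C ds \<longrightarrow> length ds \<le> length cs)"
    by (rule ex_has_greatest_nat)
  then obtain cs where cs: "C cs" "\<And>ds. C ds \<Longrightarrow> length ds \<le> length cs" by metis
  obtain H where H: "G = prod_list cs * H" using cs(1) by (auto simp: C_def elim: dvdE)
  have "c dvd 1" if c: "Q c" "c dvd H" for c
  proof (rule ccontr)
    assume "\<not> c dvd 1"
    moreover have "prod_list (c # cs) dvd G"
      using c(2) H by (auto simp: mult_dvd_mono mult.commute)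
    ultimately have "C (c # cs)" using c cs(1) by (auto simp: C_def)
    then show False using cs(2)[of "c # cs"] by simp
  qed
  then show ?thesis using H cs(1) unfolding C_def by blast
qed

lemma irreducible_mvar: "irreducible (mvar k :: ('i::{finite,linorder}, 's::idom) mpoly)"
proof (rule irreducibleI)
  have free1: "p dvd 1" if pq: "p * q = mvar k" "free_of k p" for p q :: "('i, 's) mpoly"
  proof -
    have *: "hcomp k 1 (mvar k :: ('i, 's) mpoly) = mvar k" by (simp add: mvar_def hcomp_single)
    obtain g where g: "q = poly g (mvar k)" "\<And>n. free_of k (coeff g n)" using mpoly_as_poly[of q k] by blast
    have "mvar k = p * hcomp k 1 q" using * hcomp_mult_free[OF pq(2), of 1 q] pq(1) by simp
    also have "hcomp k 1 q = coeff g 1 * mvar k" using hcomp_poly_mvar[of k g 1] g by simp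
    finally have "mvar k * 1 = mvar k * (p * coeff g 1)" by (simp add: mult_ac)
    then have "1 = p * coeff g 1" by (metis mult_cancel_left mvar_nonzero)
    then show "p dvd 1" by (metis dvd_triv_left)
  qed
  show "\<not> mvar k dvd (1 :: ('i, 's) mpoly)"
  proof
    assume "mvar k dvd (1 :: ('i, 's) mpoly)"
    then obtain q :: "('i, 's) mpoly" where "1 = mvar k * q" by (auto elim: dvdE)
    then have "free_of k (mvar k :: ('i, 's) mpoly)" using free_of_factor[of k "mvar k" q] by simp
    then show False by (simp add: mvar_def free_of_single)
  qed
  fix a b :: "('i, 's) mpoly"
  assume ab: "mvar k = a * b"
  obtain f where f: "a = poly f (mvar k)" "\<And>n. free_of k (coeff f n)" using mpoly_as_poly[of a k] by blast
  obtain g where g: "b = poly g (mvar k)" "\<And>n. free_of k (coeff g n)" using mpoly_as_poly[of b k] by blast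
  have "poly (f * g) (mvar k) = poly [:0, 1:] (mvar k)"
    unfolding poly_mult f(1)[symmetric] g(1)[symmetric] ab[symmetric] by simp
  moreover have "f * g \<in> {f. \<forall>n. free_of k (coeff f n)}"
    using f g by (auto simp: coeff_mult intro!: free_of_sum free_of_mult)
  moreover have "[:0, 1:] \<in> {f. \<forall>n. free_of k (coeff f n)}" by (auto simp: coeff_pCons split: nat.split)
  ultimately have fg: "f * g = [:0, 1:]" by (intro inj_onD[OF inj_on_poly_mvar[of k]])
  then have "degree (f * g) = 1" "f \<noteq> 0" "g \<noteq> 0" by auto
  then have "degree f = 0 \<or> degree g = 0" by (auto simp: degree_mult_eq)
  then have "free_of k a \<or> free_of k b"
  proof
    assume "degree f = 0"
    then obtain c where "f = [:c:]" by (metis degree_0_id)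
    then show ?thesis using f(1) f(2)[of 0] by simp
  next
    assume "degree g = 0"
    then obtain c where "g = [:c:]" by (metis degree_0_id)
    then show ?thesis using g(1) g(2)[of 0] by simp
  qed
  then show "a dvd 1 \<or> b dvd 1" using free1[of a b] free1[of b a] ab by (auto simp: mult.commute)
qed simp

lemma prime_elem_dvd_prod_finite:
  assumes "prime_elem p" "p dvd (\<Prod>i\<in>I. f i)"
  shows "\<exists>i\<in>I. p dvd f i"
  using assms(2)
proof (induction I rule: infinite_finite_induct)
  case (insert i I)
  then show ?case using prime_elem_dvd_mult_iff[OF assms(1), of "f i" "prod f I"] by auto
qed (use assms(1) in \<open>auto simp: prime_elem_def\<close>)

text \<open>
  The irreducible \<open>E\<close> is prime as a polynomial.  If it became a unit, it would divide a monomial and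
  hence be associated to a variable.
\<close>

lemma irreducible_prime_to_laurent:
  fixes E :: "('i::{finite,linorder}, 's::{factorial_semiring, idom}) mpoly"
  assumes irr: "irreducible E" and nv: "\<And>k. \<not> mvar k dvd E"
  shows "prime_elem (to_laurent E)"
proof -
  have E0: "E \<noteq> 0" using irr by auto
  obtain u ps where ps: "u dvd 1" "\<forall>q\<in>set ps. prime_elem q" "E = u * prod_list ps"
    using mpoly_prime_factorization[OF E0] by blast
  have prime: "prime_elem E"
  proof (cases ps)
    case Nil
    then show ?thesis using ps irr by (simp add: irreducible_def)
  next
    case (Cons q qs)
    have "\<not> q dvd 1" using ps Cons by (simp add: prime_elem_def)
    moreover have E: "E = q * (u * prod_list qs)" using ps Cons by (simp add: mult_ac)
    ultimately have v: "u * prod_list qs dvd 1" using irr by (auto simp: irreducible_def)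
    have "prime_elem q" using ps Cons by simp
    show ?thesis
    proof (rule prime_elemI)
      show "E \<noteq> 0" "\<not> E dvd 1" using irr by (auto simp: irreducible_def)
      fix a b assume "E dvd a * b"
      then have "q dvd a * b" unfolding E by (rule dvd_mult_left)
      then have "q dvd a \<or> q dvd b" using \<open>prime_elem q\<close> by (meson prime_elem_dvd_mult_iff)
      moreover have "E dvd c" if "q dvd c" for c
        using mult_dvd_mono[OF that v] unfolding E by simp
      ultimately show "E dvd a \<or> E dvd b" by blast
    qed
  qed
  have "\<not> to_laurent E dvd 1"
  proof
    assume "to_laurent E dvd 1"
    then obtain Q where Q: "1 = to_laurent E * Q" by (auto elim: dvdE)
    obtain m q where q: "Q * single (lift_exp m) 1 = to_laurent q" by (rule clear_denominators)
    have "to_laurent (single m 1) = to_laurent E * Q * single (lift_exp m) 1"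
      by (simp flip: Q)
    also have "\<dots> = to_laurent (E * q)" by (simp add: tl.hom_mult mult.assoc q)
    finally have "single m 1 = E * q" by (simp only: to_laurent_inject)
    also have "single m 1 = (\<Prod>i\<in>UNIV. mvar i ^ lookup m i :: ('i, 's) mpoly)"
      by (simp add: mvar_power prod_single_exp exp_expansion)
    finally have "E dvd (\<Prod>i\<in>UNIV. mvar i ^ lookup m i)" by simp
    then have "\<exists>i. E dvd mvar i ^ lookup m i"
      using prime_elem_dvd_prod_finite[OF prime] by blast
    then obtain i where "E dvd mvar i" using prime_elem_dvd_power[OF prime] by blast
    then obtain q' where q': "mvar i = E * q'" by (auto elim: dvdE)
    then have "q' dvd 1" using irr irreducible_mvar[of i, where 's = 's] unfolding irreducible_def by metis
    then have "mvar i dvd E" using dvd_mult_unitD[of "mvar i" E q'] q' by simp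
    then show False using nv by blast
  qed
  then show ?thesis by (rule prime_elem_to_laurent[OF prime])
qed

lemma hcomp_to_laurent: "hcomp k (int n) (to_laurent p) = to_laurent (hcomp k n p)"
  by (induction p rule: pm_induct)
    (auto simp: tl.hom_zero tl.hom_add hcomp_add hcomp_single)

text \<open>
  The highest and the lowest degree in \<open>x_k\<close> of a nonzero multiple of \<open>E\<close> differ by at least the
  degree of \<open>E\<close>, because \<open>E\<close> has a nonzero constant term in \<open>x_k\<close>.
\<close>

lemma not_dvd_free:
  fixes E :: "('i::{finite,linorder}, 's::idom) mpoly"
  assumes E: "\<not> free_of k E" "\<not> mvar k dvd E" and d: "d \<noteq> 0" "free_of k d"
  shows "\<not> to_laurent E dvd d"
proof
  assume "to_laurent E dvd d"
  then obtain Q where Q: "d = to_laurent E * Q" by (auto elim: dvdE)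
  obtain m q where q: "Q * single (lift_exp m) 1 = to_laurent q" by (rule clear_denominators)
  have Eq: "to_laurent (E * q) = d * single (lift_exp m) 1"
    by (simp add: Q tl.hom_mult mult.assoc q)
  obtain f where f: "E = poly f (mvar k)" "\<And>n. free_of k (coeff f n)" using mpoly_as_poly[of E k] by blast
  obtain g where g: "q = poly g (mvar k)" "\<And>n. free_of k (coeff g n)" using mpoly_as_poly[of q k] by blast
  have fg: "\<And>n. free_of k (coeff (f * g) n)" using f g by (auto simp: coeff_mult intro!: free_of_sum free_of_mult)
  have zero: "coeff (f * g) n = 0" if "n \<noteq> lookup m k" for n
  proof -
    have "to_laurent (hcomp k n (E * q)) = 0"
      unfolding hcomp_to_laurent[symmetric] Eq hcomp_mult_free[OF d(2)] using that by (simp add: hcomp_single)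
    then have "coeff (f * g) n * mvar k ^ n = 0"
      using hcomp_poly_mvar[OF fg, of n] by (simp add: f(1) g(1))
    then show ?thesis by simp
  qed
  have f0: "coeff f 0 \<noteq> 0"
  proof
    assume "coeff f 0 = 0"
    then obtain f' where "f = pCons 0 f'" by (cases f) auto
    then have "E = mvar k * poly f' (mvar k)" using f(1) by simp
    then show False using E(2) by simp
  qed
  have "q \<noteq> 0" using Q q d Eq by (metis lookup_single_eq lookup_zero mult_eq_0_iff to_laurent_eq_0_iff zero_neq_one)
  then have g0: "g \<noteq> 0" using g by auto
  define j where "j = (LEAST j. coeff g j \<noteq> 0)"
  have j: "coeff g j \<noteq> 0"   proof -
    have "\<exists>j. coeff g j \<noteq> 0" using g0 by (metis leading_coeff_0_iff)
    then show ?thesis unfolding j_def by (rule LeastI_ex)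
  qed
  have jl: "coeff g i = 0" if "i < j" for i
    using not_less_Least[of i "\<lambda>j. coeff g j \<noteq> 0"] that unfolding j_def by simp
  have "coeff (f * g) j = coeff f 0 * coeff g j + (\<Sum>i\<in>{..j}-{0}. coeff f i * coeff g (j - i))"
    unfolding coeff_mult by (subst sum.remove[of _ 0]) auto
  also have "(\<Sum>i\<in>{..j}-{0}. coeff f i * coeff g (j - i)) = 0"
    by (rule sum.neutral) (auto simp: jl)
  finally have "coeff (f * g) j \<noteq> 0" using f0 j by simp
  then have "j = lookup m k" using zero by blast
  moreover have "lead_coeff (f * g) \<noteq> 0" using f0 g0 by auto
  then have "degree (f * g) = lookup m k" using zero by blast
  moreover have "f \<noteq> 0" using f0 by auto
  then have "degree (f * g) = degree f + degree g" using g0 by (simp add: degree_mult_eq)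
  moreover have "j \<le> degree g" using j by (rule le_degree)
  ultimately have "degree f = 0" by simp
  then obtain c where "f = [:c:]" by (metis degree_0_id)
  then show False using f(1) f(2)[of 0] E(1) by simp
qed

section \<open>Evaluation of Laurent polynomials in a field\<close>

text \<open>
  The coefficient ring \<open>S\<close> mapped to a field.  This is used for the ambient field of the seeds and,
  in the study of the exchange exponents, for the field of fractions of \<open>S[x_i]\<close>.
\<close>

locale coefficient_hom = unital_hom \<phi> for \<phi> :: "'s::idom \<Rightarrow> 'f::field"
begin

text \<open>
  The coordinates of \<open>x\<close> are nonzero, and Laurent polynomials over \<open>S\<close> are determined by their
  values at \<open>x\<close>.  This is algebraic independence over the field of fractions of \<open>S\<close>, and it
  includes that the coefficients are embedded.
\<close>

definition laurent_indep :: "('i::{finite,linorder} \<Rightarrow> 'f) \<Rightarrow> bool" where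
  "laurent_indep x \<longleftrightarrow> (\<forall>i. x i \<noteq> 0) \<and> (\<forall>P. laurent_eval \<phi> x P = 0 \<longrightarrow> P = 0)"

lemma lev_hom: "(\<And>i. x i \<noteq> 0) \<Longrightarrow> unital_hom (laurent_eval \<phi> x)"
  by (rule unital_hom_laurent_eval) unfold_locales

lemma phi_hom: "unital_hom \<phi>"
  by unfold_locales

lemma lev_free: 
  assumes "free_of k P"
  shows "laurent_eval \<phi> (x(k := c)) P = laurent_eval \<phi> x P"
proof -
  have "(\<Prod>i\<in>UNIV. (x(k := c)) i powi lookup m i) = (\<Prod>i\<in>UNIV. x i powi lookup m i)"
    if "m \<in> keys P" for m
    using assms that by (intro prod.cong) (auto simp: free_of_def)
  then show ?thesis by (simp add: laurent_eval_def cong: sum.cong)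
qed

lemma lev_inject:
  assumes "laurent_indep x"
  shows "laurent_eval \<phi> x P = laurent_eval \<phi> x Q \<longleftrightarrow> P = Q"
proof -
  interpret l: unital_hom "laurent_eval \<phi> x" using assms by (intro lev_hom) (auto simp: laurent_indep_def)
  have "P - Q = 0" if "laurent_eval \<phi> x P = laurent_eval \<phi> x Q"
    using assms that l.hom_diff[of P Q] by (auto simp: laurent_indep_def)
  then show ?thesis by auto
qed

lemma subring_laurent_ring: "(\<And>i. x i \<noteq> 0) \<Longrightarrow> subring_of (laurent_ring \<phi> x)"
  unfolding laurent_ring_def by (intro unital_hom.subring_of_range lev_hom)

lemma laurent_ring_mem:
  "laurent_eval \<phi> x P \<in> laurent_ring \<phi> x" "\<phi> c \<in> laurent_ring \<phi> x"
  "x i \<in> laurent_ring \<phi> x" "x i powi n \<in> laurent_ring \<phi> x" "inverse (x i) \<in> laurent_ring \<phi> x"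
proof -
  show "laurent_eval \<phi> x P \<in> laurent_ring \<phi> x" for P by (simp add: laurent_ring_def)
  from this[of "mconst c"] show "\<phi> c \<in> laurent_ring \<phi> x" by (simp add: laurent_eval_mconst[OF phi_hom])
  show "x i powi n \<in> laurent_ring \<phi> x" for n
    using \<open>\<And>P. laurent_eval \<phi> x P \<in> laurent_ring \<phi> x\<close>[of "single (single i n) 1"]
    by (simp only: laurent_eval_single[OF phi_hom] prod_single_var_powi hom_one mult_1)
  from this[of 1] this[of "-1"] show "x i \<in> laurent_ring \<phi> x" "inverse (x i) \<in> laurent_ring \<phi> x"
    by (auto simp: power_int_minus)
qed

text \<open>
  To see that one Laurent ring is contained in another it is enough to look at the coordinates and
  their inverses.
\<close>

lemma laurent_ring_least:
  assumes R: "subring_of R" and c: "\<And>c. \<phi> c \<in> R" and x: "\<And>i. x i \<in> R" "\<And>i. inverse (x i) \<in> R"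
  shows "laurent_ring \<phi> x \<subseteq> R"
proof -
  have "x i powi n \<in> R" for i n
    using subring_power[OF R x(1)] subring_power[OF R x(2)]
    by (cases "n \<ge> 0") (auto simp: power_int_def)
  then show ?thesis
    using c by (auto simp: laurent_ring_def laurent_eval_def intro!: subring_sum[OF R] subring_mult[OF R] subring_prod[OF R])
qed

lemma laurent_indepD: "laurent_indep x \<Longrightarrow> x i \<noteq> 0"
  by (simp add: laurent_indep_def)

lemma dvd_in_laurent_ring:
  assumes x: "laurent_indep x"
  shows "dvd_in (laurent_ring \<phi> x) (laurent_eval \<phi> x a) (laurent_eval \<phi> x b) \<longleftrightarrow> a dvd b"
proof -
  interpret l: unital_hom "laurent_eval \<phi> x" using x by (intro lev_hom laurent_indepD)
  show ?thesis
    by (auto simp: dvd_in_def laurent_ring_def lev_inject[OF x] simp flip: l.hom_mult elim: dvdE)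
qed

lemma prime_in_laurent_ring:
  assumes x: "laurent_indep x" and e: "prime_elem e"
  shows "prime_in (laurent_ring \<phi> x) (laurent_eval \<phi> x e)"
proof -
  interpret l: unital_hom "laurent_eval \<phi> x" using x by (intro lev_hom laurent_indepD)
  have "laurent_eval \<phi> x e \<noteq> 0" using x e by (auto simp: laurent_indep_def)
  moreover have "\<not> dvd_in (laurent_ring \<phi> x) (laurent_eval \<phi> x e) 1"
    using dvd_in_laurent_ring[OF x, of e 1] e by (simp add: l.hom_one prime_elem_def)
  moreover have "dvd_in (laurent_ring \<phi> x) (laurent_eval \<phi> x e) a \<or> dvd_in (laurent_ring \<phi> x) (laurent_eval \<phi> x e) b"
    if ab: "a \<in> laurent_ring \<phi> x" "b \<in> laurent_ring \<phi> x"
      "dvd_in (laurent_ring \<phi> x) (laurent_eval \<phi> x e) (a * b)" for a b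
  proof -
    obtain A B where "a = laurent_eval \<phi> x A" "b = laurent_eval \<phi> x B"
      using ab by (auto simp: laurent_ring_def)
    then show ?thesis using ab(3) e
      by (simp add: dvd_in_laurent_ring[OF x] prime_elem_dvd_mult_iff flip: l.hom_mult)
  qed
  ultimately show ?thesis by (auto simp: prime_in_def laurent_ring_mem)
qed

text \<open>
  The new coordinate is \<open>d / x_j\<close> with \<open>d\<close> free of \<open>x_j\<close>.  A relation \<open>f\<close> of degree \<open>N\<close> in
  it becomes a relation between the old coordinates after multiplication with \<open>x_j^N\<close>, and there the
  terms of \<open>f\<close> have distinct degrees in \<open>x_j\<close>.
\<close>

lemma laurent_indep_exchange:
  fixes x :: "'i::{finite,linorder} \<Rightarrow> 'f"
  assumes x: "laurent_indep x" and d: "free_of j d" "d \<noteq> 0"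
  shows "laurent_indep (x(j := laurent_eval \<phi> x d / x j))"
proof -
  define \<delta> where "\<delta> = laurent_eval \<phi> x d"
  define y where "y = x(j := \<delta> / x j)"
  have x0: "x i \<noteq> 0" for i using x by (rule laurent_indepD)
  have \<delta>: "\<delta> \<noteq> 0" using x d by (auto simp: laurent_indep_def \<delta>_def)
  have y0: "y i \<noteq> 0" for i using x0 \<delta> by (auto simp: y_def)
  interpret lx: unital_hom "laurent_eval \<phi> x" by (rule lev_hom) (rule x0)
  interpret ly: unital_hom "laurent_eval \<phi> y" by (rule lev_hom) (rule y0)
  have "P = 0" if P: "laurent_eval \<phi> y P = 0" for P
  proof -
    obtain m p where p: "P * single (lift_exp m) 1 = to_laurent p" by (rule clear_denominators)
    obtain f where f: "p = poly f (mvar j)" "\<And>n. free_of j (coeff f n)" using mpoly_as_poly[of p j] by blast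
    define N where "N = degree f"
    define Q where "Q = (\<Sum>n\<le>N. to_laurent (coeff f n) * d ^ n * mvar j ^ (N - n))"
    have "0 = laurent_eval \<phi> y (to_laurent p)" by (simp flip: p add: ly.hom_mult P)
    also have "\<dots> = (\<Sum>n\<le>N. laurent_eval \<phi> y (to_laurent (coeff f n)) * y j ^ n)"
      by (simp add: f(1) poly_altdef N_def tl.hom_sum tl.hom_mult tl.hom_power ly.hom_sum ly.hom_mult ly.hom_power laurent_eval_mvar[OF phi_hom])
    also have "\<dots> = (\<Sum>n\<le>N. laurent_eval \<phi> x (to_laurent (coeff f n)) * (\<delta> / x j) ^ n)"
      using f(2) by (simp add: y_def lev_free)
    finally have "0 = (\<Sum>n\<le>N. laurent_eval \<phi> x (to_laurent (coeff f n)) * (\<delta> / x j) ^ n) * x j ^ N" by simp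
    also have "\<dots> = (\<Sum>n\<le>N. laurent_eval \<phi> x (to_laurent (coeff f n)) * \<delta> ^ n * x j ^ (N - n))"
      unfolding sum_distrib_right
      by (intro sum.cong refl) (auto simp: power_divide x0 power_diff field_simps)
    also have "\<dots> = laurent_eval \<phi> x Q"
      by (simp add: Q_def lx.hom_sum lx.hom_mult lx.hom_power laurent_eval_mvar[OF phi_hom] \<delta>_def)
    finally have Q: "Q = 0" using x by (auto simp: laurent_indep_def)
    have "coeff f n = 0" if n: "n \<le> N" for n
    proof -
      have mp: "(mvar j :: ('i, 's) lpoly) ^ k = single (single j (int k)) 1" for k
        using single_power[of j "1::int" k, where 's = 's] by (simp add: mvar_def)
      have "0 = hcomp j (int (N - n)) Q" by (simp add: Q)
      also have "\<dots> = (\<Sum>k\<le>N. if k = n then to_laurent (coeff f k) * d ^ k * mvar j ^ (N - k) else 0)"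
        unfolding Q_def hcomp_sum using n
        by (intro sum.cong refl) (auto simp: hcomp_mult_free free_of_mult free_of_power f(2) d mp hcomp_single lookup_single)
      also have "\<dots> = to_laurent (coeff f n) * d ^ n * mvar j ^ (N - n)" using n by simp
      finally show ?thesis using d(2) by (simp add: mvar_def single_one_nonzero)
    qed
    then have "f = 0" by (intro poly_eqI) (metis N_def coeff_0 coeff_eq_0 leI)
    then have "P * single (lift_exp m) 1 = 0" using p f(1) by (simp add: tl.hom_zero)
    then show "P = 0" by (metis lookup_single_eq lookup_zero mult_eq_0_iff zero_neq_one)
  qed
  then have "laurent_indep y" using y0 by (auto simp: laurent_indep_def)
  then show ?thesis by (simp add: y_def \<delta>_def)
qed

end

section \<open>Localisation at a prime element\<close>

text \<open>
  The localisation of \<open>N\<close> at the ideal generated by \<open>e\<close>, inside the ambient field, and its units;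
  both are meaningful when \<open>e\<close> is prime in \<open>N\<close>.
\<close>

definition loc :: "'f::field set \<Rightarrow> 'f \<Rightarrow> 'f set" where
  "loc N e = {a / b | a b. a \<in> N \<and> b \<in> N \<and> \<not> dvd_in N e b}"

definition loc_unit :: "'f::field set \<Rightarrow> 'f \<Rightarrow> 'f \<Rightarrow> bool" where
  "loc_unit N e u \<longleftrightarrow> u \<noteq> 0 \<and> u \<in> loc N e \<and> inverse u \<in> loc N e"

locale prime_subring =
  fixes N :: "'f::field set" and e :: 'f
  assumes N: "subring_of N" and e: "prime_in N e"
begin

lemma not_dvd_nonzero: "\<not> dvd_in N e b \<Longrightarrow> b \<noteq> 0"
  using dvd_in_zero[OF N] by auto

lemma not_dvd_mult: "a \<in> N \<Longrightarrow> b \<in> N \<Longrightarrow> \<not> dvd_in N e a \<Longrightarrow> \<not> dvd_in N e b \<Longrightarrow> \<not> dvd_in N e (a * b)"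
  using prime_inD(4)[OF e] by blast

lemma subring_loc: "subring_of (loc N e)"
  unfolding subring_of_def
proof (intro conjI ballI)
  show "1 \<in> loc N e" unfolding loc_def mem_Collect_eq
    by (intro exI[of _ 1]) (use subring_one[OF N] prime_inD(3)[OF e] in simp)
  fix u v assume "u \<in> loc N e" "v \<in> loc N e"
  then obtain a b c d where *: "a \<in> N" "b \<in> N" "c \<in> N" "d \<in> N" "\<not> dvd_in N e b" "\<not> dvd_in N e d"
    "u = a / b" "v = c / d" by (auto simp: loc_def)
  have bd: "b * d \<in> N" "\<not> dvd_in N e (b * d)" using * not_dvd_mult N by (auto simp: subring_mult)
  have "u - v = (a * d - c * b) / (b * d)" "u * v = (a * c) / (b * d)"
    using * not_dvd_nonzero by (auto simp: field_simps)
  moreover have "a * d - c * b \<in> N" "a * c \<in> N" using * N by (auto intro: subring_diff subring_mult)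
  ultimately show "u - v \<in> loc N e" "u * v \<in> loc N e" using bd unfolding loc_def by blast+
qed

lemma subset_loc: "N \<subseteq> loc N e"
proof
  fix a assume "a \<in> N"
  then show "a \<in> loc N e" unfolding loc_def mem_Collect_eq
    by (intro exI[of _ a] exI[of _ 1]) (use subring_one[OF N] prime_inD(3)[OF e] in simp)
qed

lemma loc_unitI: "b \<in> N \<Longrightarrow> \<not> dvd_in N e b \<Longrightarrow> loc_unit N e b"
  using subset_loc not_dvd_nonzero subring_one[OF N]
  by (auto simp: loc_unit_def loc_def inverse_eq_divide)

lemma loc_unit_mult: "loc_unit N e u \<Longrightarrow> loc_unit N e v \<Longrightarrow> loc_unit N e (u * v)"
  using subring_mult[OF subring_loc] by (auto simp: loc_unit_def)

lemma loc_unit_inverse: "loc_unit N e u \<Longrightarrow> loc_unit N e (inverse u)"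
  by (auto simp: loc_unit_def)

lemma loc_unit_divide: "loc_unit N e u \<Longrightarrow> loc_unit N e v \<Longrightarrow> loc_unit N e (u / v)"
  using loc_unit_mult loc_unit_inverse by (simp add: divide_inverse)

lemma loc_unit_one: "loc_unit N e 1"
  using subring_one[OF subring_loc] by (auto simp: loc_unit_def)

lemma loc_unit_power: "loc_unit N e u \<Longrightarrow> loc_unit N e (u ^ n)"
  by (induction n) (auto simp: loc_unit_one loc_unit_mult)

lemma loc_unit_power_int: "loc_unit N e u \<Longrightarrow> loc_unit N e (u powi n)"
  by (auto simp: power_int_def loc_unit_power loc_unit_inverse)

lemma loc_unit_prod: "(\<And>i. i \<in> I \<Longrightarrow> loc_unit N e (f i)) \<Longrightarrow> loc_unit N e (\<Prod>i\<in>I. f i)"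
  by (induction I rule: infinite_finite_induct) (auto simp: loc_unit_one loc_unit_mult)

lemma loc_unit_of_unit: "u \<in> N \<Longrightarrow> inverse u \<in> N \<Longrightarrow> u \<noteq> 0 \<Longrightarrow> loc_unit N e u"
  using subset_loc by (auto simp: loc_unit_def)

lemma dvd_of_loc:
  assumes "a \<in> N" "c \<in> loc N e" "a = e * c"
  shows "dvd_in N e a"
proof -
  obtain p q where c: "p \<in> N" "q \<in> N" "\<not> dvd_in N e q" "c = p / q" using assms by (auto simp: loc_def)
  have "a * q = e * p" using assms c not_dvd_nonzero by (auto simp: field_simps)
  then have "dvd_in N e (a * q)" using c by (auto simp: dvd_in_def)
  then show ?thesis using prime_inD(4)[OF e] assms c by blast
qed

lemma not_loc_unit_power: "n > 0 \<Longrightarrow> \<not> loc_unit N e (e ^ n)"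
proof
  assume n: "n > 0" and u: "loc_unit N e (e ^ n)"
  obtain m where m: "n = Suc m" using n by (cases n) auto
  have "e ^ m * inverse (e ^ n) \<in> loc N e"
    using u subset_loc subring_mult[OF subring_loc] subring_power[OF N prime_inD(1)[OF e], of m]
    by (auto simp: loc_unit_def)
  moreover have "1 = e * (e ^ m * inverse (e ^ n))"
    using prime_inD(2)[OF e] by (simp add: m divide_inverse[symmetric] field_simps)
  ultimately show False using dvd_of_loc[OF subring_one[OF N]] prime_inD(3)[OF e] by blast
qed

lemma loc_unit_prime_powi: "loc_unit N e (e powi n) \<Longrightarrow> n = 0"
proof (rule ccontr)
  assume u: "loc_unit N e (e powi n)" and n: "n \<noteq> 0"
  have "loc_unit N e (e ^ nat \<bar>n\<bar>)"
    using u loc_unit_inverse[OF u] n by (auto simp: power_int_def abs_if power_inverse split: if_splits)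
  then show False using not_loc_unit_power n by simp
qed

lemma mem_of_mult_power:
  assumes "f \<in> loc N e" "f * e ^ n \<in> N"
  shows "f \<in> N"
  using assms(2)
proof (induction n)
  case (Suc n)
  have "f * e ^ n \<in> loc N e"
    using assms(1) subset_loc subring_mult[OF subring_loc] subring_power[OF N prime_inD(1)[OF e], of n] by blast
  then have "dvd_in N e (f * e ^ Suc n)" using dvd_of_loc[OF Suc.prems] by (simp add: ac_simps)
  then obtain c where "c \<in> N" "f * e ^ Suc n = e * c" by (auto simp: dvd_in_def)
  then have "f * e ^ n = c" using prime_inD(2)[OF e] by simp
  then show ?case using Suc.IH \<open>c \<in> N\<close> by simp
qed simp

end

locale prime_subring_pair = P: prime_subring N e + Q: prime_subring N' e'
  for N :: "'f::field set" and e and N' :: "'f set" and e'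
begin

text \<open>
  Fractions with numerator and denominator in \<open>N\<close>, where the denominator is a unit of both
  localisations.
\<close>

definition common_fractions :: "'f set" where
  "common_fractions = {a. \<exists>w\<in>N. loc_unit N e w \<and> loc_unit N' e' w \<and> a * w \<in> N}"

lemma subring_common_fractions: "subring_of common_fractions"
  unfolding subring_of_def
proof (intro conjI ballI)
  show "1 \<in> common_fractions" unfolding common_fractions_def
    using subring_one[OF P.N] P.loc_unit_one Q.loc_unit_one by auto
  fix u v assume "u \<in> common_fractions" "v \<in> common_fractions"
  then obtain a b where *: "a \<in> N" "b \<in> N" "u * a \<in> N" "v * b \<in> N"
    "loc_unit N e a" "loc_unit N' e' a" "loc_unit N e b" "loc_unit N' e' b" by (auto simp: common_fractions_def)
  have ab: "a * b \<in> N" "loc_unit N e (a * b)" "loc_unit N' e' (a * b)"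
    using * P.loc_unit_mult Q.loc_unit_mult subring_mult[OF P.N] by auto
  have "(u - v) * (a * b) = (u * a) * b - (v * b) * a" by (simp add: algebra_simps)
  also have "\<dots> \<in> N"
    using subring_diff[OF P.N subring_mult[OF P.N *(3,2)] subring_mult[OF P.N *(4,1)]] .
  finally show "u - v \<in> common_fractions" using ab unfolding common_fractions_def by blast
  have "(u * v) * (a * b) = (u * a) * (v * b)" by (simp add: algebra_simps)
  also have "\<dots> \<in> N" using * subring_mult[OF P.N] by blast
  finally show "u * v \<in> common_fractions" using ab unfolding common_fractions_def by blast
qed

lemma subset_common_fractions: "N \<subseteq> common_fractions"
  unfolding common_fractions_def using subring_one[OF P.N] P.loc_unit_one Q.loc_unit_one by auto

lemma common_fractions_inverse:
  assumes "u \<in> common_fractions" "loc_unit N e u" "loc_unit N' e' u"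
  shows "inverse u \<in> common_fractions"
proof -
  obtain a where a: "a \<in> N" "u * a \<in> N" "loc_unit N e a" "loc_unit N' e' a"
    using assms by (auto simp: common_fractions_def)
  have "loc_unit N e (u * a)" "loc_unit N' e' (u * a)"
    using a assms P.loc_unit_mult Q.loc_unit_mult by auto
  moreover have "inverse u * (u * a) = a" using assms by (simp add: loc_unit_def mult.assoc[symmetric])
  then have "inverse u * (u * a) \<in> N" using a(1) by metis
  ultimately show ?thesis using a unfolding common_fractions_def by blast
qed

text \<open>
  An element of \<open>N'\<close> not divisible by \<open>e'\<close> is \<open>n / w\<close> with \<open>w\<close> a common unit.  If \<open>e\<close>
  divided \<open>n\<close>, then \<open>e'\<close> would divide the element in the localisation of \<open>N'\<close>, because
  \<open>e'\<close> divides \<open>e\<close> there.  So \<open>n\<close> is a unit of the localisation of \<open>N\<close>.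
\<close>

theorem loc_subset:
  assumes N': "N' \<subseteq> common_fractions" and NL: "N \<subseteq> loc N' e'" and e: "e / e' \<in> loc N' e'"
  shows "loc N' e' \<subseteq> loc N e"
proof -
  have mem: "q \<in> loc N e" if "q \<in> N'" for q
  proof -
    obtain w where w: "w \<in> N" "loc_unit N e w" "q * w \<in> N"
      using N' \<open>q \<in> N'\<close> by (auto simp: common_fractions_def)
    have "q = (q * w) * inverse w" using w by (simp add: loc_unit_def mult.assoc)
    moreover have "(q * w) * inverse w \<in> loc N e"
      using w P.subset_loc subring_mult[OF P.subring_loc] by (auto simp: loc_unit_def)
    ultimately show ?thesis by metis
  qed
  have unit: "inverse q \<in> loc N e" if q: "q \<in> N'" "\<not> dvd_in N' e' q" for q
  proof -
    obtain w where w: "w \<in> N" "loc_unit N e w" "loc_unit N' e' w" "q * w \<in> N"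
      using N' \<open>q \<in> N'\<close> by (auto simp: common_fractions_def)
    have "\<not> dvd_in N e (q * w)"
    proof
      assume "dvd_in N e (q * w)"
      then obtain n where n: "n \<in> N" "q * w = e * n" by (auto simp: dvd_in_def)
      have "q = (q * w) * inverse w" using w by (simp add: loc_unit_def)
      also have "\<dots> = e' * (e / e' * n * inverse w)" using n prime_inD(2)[OF Q.e] by simp
      finally have "q = e' * (e / e' * n * inverse w)" .
      moreover have "e / e' * n * inverse w \<in> loc N' e'"
        using e n(1) NL w by (intro subring_mult[OF Q.subring_loc]) (auto simp: loc_unit_def)
      ultimately show False using Q.dvd_of_loc q by blast
    qed
    then have "loc_unit N e (q * w)" using w by (intro P.loc_unitI)
    then have "loc_unit N e (w / (q * w))" using w P.loc_unit_divide by blast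
    moreover have "w / (q * w) = inverse q" using w by (simp add: loc_unit_def field_simps)
    ultimately show ?thesis by (simp add: loc_unit_def)
  qed
  show ?thesis
    using mem unit subring_mult[OF P.subring_loc] by (auto simp: loc_def[of N'] divide_inverse)
qed

end

section \<open>Exchange Laurent polynomials\<close>

text \<open>
  The properties of the exchange polynomials of a seed that mutation preserves.  Irreducibility is
  replaced by primality in the Laurent polynomial ring.
\<close>

definition exchange_system :: "('i::{finite,linorder} \<Rightarrow> ('i, 's::idom) mpoly) \<Rightarrow> bool" where
  "exchange_system E \<longleftrightarrow> (\<forall>i. free_of i (E i) \<and> prime_elem (to_laurent (E i)) \<and> (\<forall>k. \<not> mvar k dvd E i))"

text \<open>
  \<open>E_i\<close> at \<open>x_j \<leftarrow> E_j / X\<close>, the variable \<open>j\<close> standing for \<open>X\<close>.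
\<close>

definition exchange_subst :: "('i::{finite,linorder} \<Rightarrow> ('i, 's::idom) mpoly) \<Rightarrow> 'i \<Rightarrow> 'i \<Rightarrow> ('i, 's) lpoly" where
  "exchange_subst E i j = mpoly_eval mconst
     (mvar(j := to_laurent (E j) * single (single j (- 1)) 1)) (E i)"

lemma exchange_systemD:
  assumes "exchange_system E"
  shows "free_of i (E i)" "prime_elem (to_laurent (E i))" "\<not> mvar k dvd E i" "to_laurent (E i) \<noteq> 0"
    "\<not> to_laurent (E i) dvd 1"
  using assms by (auto simp: exchange_system_def prime_elem_def)

context coefficient_hom
begin

text \<open>
  The point with \<open>E_j / x_j\<close> in place of \<open>x_j\<close>.  The exchange Laurent polynomial at \<open>j\<close> differs from
  \<open>E_j\<close> by a monomial in the other variables, so the Laurent ring of this point is that of the seed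
  mutated at \<open>j\<close>.
\<close>

definition dual :: "('i::{finite,linorder} \<Rightarrow> 'f) \<Rightarrow> ('i \<Rightarrow> ('i, 's) mpoly) \<Rightarrow> 'i \<Rightarrow> 'i \<Rightarrow> 'f" where
  "dual x E j = x(j := laurent_eval \<phi> x (to_laurent (E j)) / x j)"

lemma laurent_indep_dual:
  assumes "laurent_indep x" "exchange_system E"
  shows "laurent_indep (dual x E j)"
  unfolding dual_def using assms exchange_systemD[OF assms(2), of j]
  by (intro laurent_indep_exchange) auto

lemma dual_free: "free_of j P \<Longrightarrow> laurent_eval \<phi> (dual x E j) P = laurent_eval \<phi> x P"
  unfolding dual_def by (rule lev_free)

text \<open>
  \<open>E_j\<close> has the same value at both points.
\<close>

lemma dual_dual:
  assumes "laurent_indep x" "exchange_system E"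
  shows "dual (dual x E j) E j = x"
proof -
  have "laurent_eval \<phi> x (to_laurent (E j)) \<noteq> 0"
    using assms exchange_systemD[OF assms(2), of j] by (auto simp: laurent_indep_def)
  moreover have "laurent_eval \<phi> (dual x E j) (to_laurent (E j)) = laurent_eval \<phi> x (to_laurent (E j))"
    using exchange_systemD[OF assms(2), of j] by (simp add: dual_free)
  ultimately show ?thesis
    using laurent_indepD[OF assms(1), of j] unfolding dual_def[of "dual x E j"]
    by (simp add: dual_def fun_eq_iff)
qed

lemma lev_substitution:
  assumes y: "\<And>i. y i \<noteq> 0" and d: "laurent_eval \<phi> y d \<noteq> 0"
  shows "laurent_eval \<phi> y (mpoly_eval mconst (mvar(j := d * single (single j (- 1)) 1)) p) =
    laurent_eval \<phi> (y(j := laurent_eval \<phi> y d / y j)) (to_laurent p)"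
proof -
  have h: "unital_hom (laurent_eval \<phi> y)" using y by (rule lev_hom)
  have y': "(y(j := laurent_eval \<phi> y d / y j)) l \<noteq> 0" for l using y d by simp
  have "laurent_eval \<phi> y (single (single j (- 1)) 1) = inverse (y j)"
    by (simp only: laurent_eval_single[OF phi_hom] prod_single_var_powi hom_one) (simp add: power_int_minus)
  then have *: "laurent_eval \<phi> y ((mvar(j := d * single (single j (- 1)) 1)) l) =
      (y(j := laurent_eval \<phi> y d / y j)) l" for l
    by (simp add: unital_hom.hom_mult[OF h] laurent_eval_mvar[OF phi_hom] divide_inverse)
  show ?thesis
    unfolding hom_mpoly_eval[OF h unital_hom_mconst] *
    by (simp add: laurent_eval_mconst[OF phi_hom] laurent_eval_to_laurent[OF phi_hom y'])
qed

lemma lev_exchange_subst: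
  assumes y: "laurent_indep y" and E: "exchange_system E"
  shows "laurent_eval \<phi> y (exchange_subst E i j) = laurent_eval \<phi> (dual y E j) (to_laurent (E i))"
  unfolding exchange_subst_def dual_def
  using y exchange_systemD[OF E, of j] by (intro lev_substitution) (auto simp: laurent_indep_def)

lemma lev_monomial: "laurent_eval \<phi> y (\<Prod>l\<in>I. single (single l (b l)) 1) = (\<Prod>l\<in>I. y l powi b l)"
  if "\<And>i. y i \<noteq> 0"
  unfolding unital_hom.hom_prod[OF lev_hom[OF that]]
  by (simp only: laurent_eval_single[OF phi_hom] prod_single_var_powi hom_one mult_1)

lemma lev_divide_by_monomial:
  assumes "\<And>i. y i \<noteq> 0"
  shows "laurent_eval \<phi> y (divide_by_monomial E i a) =
    laurent_eval \<phi> y (to_laurent (E i)) * (\<Prod>l\<in>-{i}. y l powi (- int (a l)))"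
  unfolding divide_by_monomial_def unital_hom.hom_mult[OF lev_hom[OF assms]] lev_monomial[OF assms] ..

lemma exchange_subst_eval:
  fixes y :: "'i::{finite,linorder} \<Rightarrow> 'f" and a :: "'i \<Rightarrow> nat"
  assumes y: "laurent_indep y" and E: "exchange_system E" and ij: "j \<noteq> i"
  obtains m where "lookup m i = 0"
    "laurent_eval \<phi> (dual y E j) (divide_by_monomial E i a) * laurent_eval \<phi> y (to_laurent (E j)) ^ a j
       = laurent_eval \<phi> y (exchange_subst E i j * single m 1)"
proof -
  interpret l: unital_hom "laurent_eval \<phi> y" using y by (intro lev_hom laurent_indepD)
  define e where "e = laurent_eval \<phi> y (to_laurent (E j))"
  have y0: "y l \<noteq> 0" for l using y by (rule laurent_indepD)
  have d0: "dual y E j l \<noteq> 0" for l using laurent_indep_dual[OF y E] by (rule laurent_indepD)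
  have e0: "e \<noteq> 0" using y exchange_systemD[OF E, of j] by (auto simp: e_def laurent_indep_def)
  let ?S = "exchange_subst E i j"
  define b where "b l = (if l = j then int (a j) else - int (a l))" for l
  define M where "M = single (\<Sum>l\<in>-{i}. single l (b l)) (1::'s)"
  have M: "M = (\<Prod>l\<in>-{i}. single (single l (b l)) 1)"
    by (simp add: M_def prod_single_exp)
  have jm: "j \<in> -{i}" using ij by simp
  have "(\<Prod>l\<in>-{i}. dual y E j l powi (- int (a l))) = (e / y j) powi (- int (a j)) * (\<Prod>l\<in>-{i}-{j}. y l powi (- int (a l)))"
    by (subst prod.remove[OF _ jm]) (auto simp: dual_def e_def)
  also have "(\<Prod>l\<in>-{i}-{j}. y l powi (- int (a l))) = (\<Prod>l\<in>-{i}-{j}. y l powi b l)"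
    by (rule prod.cong) (auto simp: b_def)
  also have "(e / y j) powi (- int (a j)) = y j powi b j / e ^ a j"
    using y0[of j] e0 by (simp add: b_def power_int_minus power_divide field_simps)
  also have "y j powi b j / e ^ a j * (\<Prod>l\<in>-{i}-{j}. y l powi b l) = laurent_eval \<phi> y M / e ^ a j"
    unfolding M lev_monomial[OF y0] by (subst prod.remove[OF _ jm, of "\<lambda>l. y l powi b l"]) auto
  finally have p: "laurent_eval \<phi> (dual y E j) (divide_by_monomial E i a) * e ^ a j = laurent_eval \<phi> y (?S * M)"
    using e0 unfolding lev_divide_by_monomial[OF d0] l.hom_mult lev_exchange_subst[OF y E] by simp
  show ?thesis
  proof (rule that)
    show "lookup (\<Sum>l\<in>-{i}. single l (b l)) i = 0"
      by (auto simp: lookup_sum lookup_single when_def)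
  qed (use p in \<open>simp only: e_def M_def\<close>)
qed

text \<open>
  The left side is the condition that defines the \<open>j\<close>-th exchange exponent, except that it is stated
  over an arbitrary field; on the right it is read off formally: \<open>a j\<close> is the multiplicity of
  \<open>E_j\<close> in \<open>E_i\<close> at \<open>x_j \<leftarrow> E_j / X\<close>.
\<close>

lemma exchange_subst_divisibility:
  fixes y :: "'i::{finite,linorder} \<Rightarrow> 'f" and a :: "'i \<Rightarrow> nat"
  assumes y: "laurent_indep y" and E: "exchange_system E" and ij: "j \<noteq> i"
  defines "p \<equiv> laurent_eval \<phi> (dual y E j) (divide_by_monomial E i a)"
    and "e \<equiv> laurent_eval \<phi> y (to_laurent (E j))"
  shows "p \<in> laurent_ring \<phi> y \<and> \<not> (\<exists>q\<in>laurent_ring \<phi> y. p = e * q) \<longleftrightarrow>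
    to_laurent (E j) ^ a j dvd exchange_subst E i j \<and> \<not> to_laurent (E j) ^ Suc (a j) dvd exchange_subst E i j"
proof -
  interpret l: unital_hom "laurent_eval \<phi> y" using y by (intro lev_hom laurent_indepD)
  have e0: "e \<noteq> 0" using y exchange_systemD[OF E, of j] by (auto simp: e_def laurent_indep_def)
  let ?e = "to_laurent (E j)" and ?S = "exchange_subst E i j"
  obtain m where p: "p * e ^ a j = laurent_eval \<phi> y (?S * single m 1)"
    using exchange_subst_eval[OF y E ij, of a] unfolding p_def e_def by metis
  define M where "M = single m (1::'s)"
  note p = p[folded M_def]
  have Mu: "M dvd 1" unfolding M_def by (rule monomial_unit)
  have eP: "e ^ n = laurent_eval \<phi> y (?e ^ n)" for n by (simp add: e_def l.hom_power)
  have mem: "p \<in> laurent_ring \<phi> y \<longleftrightarrow> ?e ^ a j dvd ?S"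
  proof
    assume "p \<in> laurent_ring \<phi> y"
    then obtain P where "p = laurent_eval \<phi> y P" by (auto simp: laurent_ring_def)
    then have "laurent_eval \<phi> y (P * ?e ^ a j) = laurent_eval \<phi> y (?S * M)" using p eP by (simp add: l.hom_mult)
    then have "P * ?e ^ a j = ?S * M" by (simp add: lev_inject[OF y])
    then have "?e ^ a j dvd ?S * M" by (metis dvd_triv_right)
    then show "?e ^ a j dvd ?S" using Mu by (rule dvd_mult_unitD)
  next
    assume "?e ^ a j dvd ?S"
    then obtain Q where Q: "?S = ?e ^ a j * Q" by (auto elim: dvdE)
    have "p * e ^ a j = laurent_eval \<phi> y (?e ^ a j * Q * M)" unfolding p Q ..
    also have "\<dots> = laurent_eval \<phi> y (Q * M) * e ^ a j"
      unfolding eP l.hom_mult by (simp only: ac_simps)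
    finally have "p = laurent_eval \<phi> y (Q * M)" using e0 by simp
    then show "p \<in> laurent_ring \<phi> y" by (simp add: laurent_ring_mem)
  qed
  have dvd: "(\<exists>q\<in>laurent_ring \<phi> y. p = e * q) \<longleftrightarrow> ?e ^ Suc (a j) dvd ?S"
  proof
    assume "\<exists>q\<in>laurent_ring \<phi> y. p = e * q"
    then obtain Q where "p = e * laurent_eval \<phi> y Q" by (auto simp: laurent_ring_def)
    then have "laurent_eval \<phi> y (?S * M) = e * laurent_eval \<phi> y Q * e ^ a j"
      unfolding p[symmetric] by simp
    also have "\<dots> = laurent_eval \<phi> y Q * e ^ Suc (a j)" by (simp add: ac_simps)
    also have "\<dots> = laurent_eval \<phi> y (Q * ?e ^ Suc (a j))" unfolding eP l.hom_mult ..
    finally have "laurent_eval \<phi> y (Q * ?e ^ Suc (a j)) = laurent_eval \<phi> y (?S * M)" ..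
    then have "Q * ?e ^ Suc (a j) = ?S * M" by (simp add: lev_inject[OF y])
    then have "?e ^ Suc (a j) dvd ?S * M" by (metis dvd_triv_right)
    then show "?e ^ Suc (a j) dvd ?S" using Mu by (rule dvd_mult_unitD)
  next
    assume "?e ^ Suc (a j) dvd ?S"
    then obtain Q where Q: "?S = ?e ^ Suc (a j) * Q" by (auto elim: dvdE)
    have "p * e ^ a j = laurent_eval \<phi> y (?e ^ Suc (a j) * (Q * M))"
      unfolding p Q by (simp only: ac_simps)
    also have "\<dots> = e ^ Suc (a j) * laurent_eval \<phi> y (Q * M)"
      unfolding eP l.hom_mult ..
    also have "\<dots> = (e * laurent_eval \<phi> y (Q * M)) * e ^ a j" by simp
    finally have "p = e * laurent_eval \<phi> y (Q * M)" using e0 by simp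
    then show "\<exists>q\<in>laurent_ring \<phi> y. p = e * q" using laurent_ring_mem(1) by blast
  qed
  show ?thesis unfolding mem dvd ..
qed

end

lemma mpoly_eval_identity: "mpoly_eval mconst mvar p = (p :: ('i::finite, 's::comm_ring_1) mpoly)"
proof -
  interpret e: unital_hom "mpoly_eval mconst mvar :: ('i, 's) mpoly \<Rightarrow> ('i, 's) mpoly"
    by (rule unital_hom_mpoly_eval[OF unital_hom_mconst])
  have "mpoly_eval mconst mvar (single m c) = (single m c :: ('i, 's) mpoly)" for m c
    by (simp add: mpoly_eval_single[OF unital_hom_mconst] mvar_power prod_single_exp exp_expansion)
      (simp add: mconst_def mult_single)
  then show ?thesis
    by (induction p rule: pm_induct) (auto simp: e.hom_zero e.hom_add)
qed

lemma unital_hom_Fract: "unital_hom (\<lambda>p :: 'a::idom. Fract p 1)"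
  by unfold_locales (auto simp: One_fract_def)

interpretation rconst: coefficient_hom "rconst :: 's::idom \<Rightarrow> ('i::{finite,linorder}, 's) mpoly fract"
proof -
  interpret c: unital_hom "mconst :: 's \<Rightarrow> ('i, 's) mpoly" by (rule unital_hom_mconst)
  show "coefficient_hom (rconst :: 's \<Rightarrow> ('i, 's) mpoly fract)"
    by unfold_locales (auto simp: rconst_def c.hom_one c.hom_add c.hom_mult One_fract_def)
qed

lemma laurent_indep_rvar:
  "rconst.laurent_indep (rvar :: 'i::{finite,linorder} \<Rightarrow> ('i, 's::idom) mpoly fract)"
  unfolding rconst.laurent_indep_def
proof (intro conjI allI impI)
  show v: "(rvar i :: ('i, 's) mpoly fract) \<noteq> 0" for i
    by (simp add: rvar_def Zero_fract_def eq_fract)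
  fix P :: "('i, 's) lpoly" assume P: "laurent_eval rconst (rvar :: 'i \<Rightarrow> ('i, 's) mpoly fract) P = 0"
  interpret l: unital_hom "laurent_eval rconst (rvar :: 'i \<Rightarrow> ('i, 's) mpoly fract)"
    by (rule rconst.lev_hom) (rule v)
  obtain m p where p: "P * single (lift_exp m) 1 = to_laurent p" by (rule clear_denominators)
  have "Fract p 1 = Fract (mpoly_eval mconst mvar p) 1" by (simp add: mpoly_eval_identity)
  also have "\<dots> = mpoly_eval rconst rvar p"
    unfolding hom_mpoly_eval[OF unital_hom_Fract unital_hom_mconst] rconst_def[symmetric] rvar_def[symmetric] ..
  also have "\<dots> = laurent_eval rconst rvar (to_laurent p)"
    by (simp add: laurent_eval_to_laurent[OF rconst.phi_hom v])
  also have "\<dots> = 0" by (simp flip: p add: l.hom_mult P)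
  finally have "p = 0" by (simp add: Zero_fract_def eq_fract)
  then have "P * single (lift_exp m) 1 = 0" using p by (simp add: tl.hom_zero)
  then show "P = 0" by simp
qed

lemma is_exchange_exponents_iff:
  assumes E: "exchange_system (E :: 'i::{finite,linorder} \<Rightarrow> ('i, 's::idom) mpoly)"
  shows "is_exchange_exponents E i a \<longleftrightarrow> a i = 0 \<and>
    (\<forall>j. j \<noteq> i \<longrightarrow> to_laurent (E j) ^ a j dvd exchange_subst E i j \<and>
       \<not> to_laurent (E j) ^ Suc (a j) dvd exchange_subst E i j)"
proof -
  have v: "(rvar i :: ('i, 's) mpoly fract) \<noteq> 0" for i
    using laurent_indep_rvar by (rule rconst.laurent_indepD)
  have *: "mpoly_eval rconst rvar (E j) = laurent_eval rconst rvar (to_laurent (E j))" for j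
    by (simp add: laurent_eval_to_laurent[OF rconst.phi_hom v])
  show ?thesis
    unfolding is_exchange_exponents_def Let_def * rconst.dual_def[symmetric]
    using rconst.exchange_subst_divisibility[OF laurent_indep_rvar E] by blast
qed

text \<open>
  The exchange exponents \<open>a_ij\<close> of \<open>E\<close>.
\<close>

definition exchange_exps :: "('i::{finite,linorder} \<Rightarrow> ('i, 's::idom) mpoly) \<Rightarrow> 'i \<Rightarrow> 'i \<Rightarrow> nat" where
  "exchange_exps E i = (THE a. is_exchange_exponents E i a)"

lemma exchange_laurent_altdef: "exchange_laurent E i = divide_by_monomial E i (exchange_exps E i)"
  by (simp add: exchange_laurent_def exchange_exps_def)

lemma exact_power_unique:
  assumes "e ^ a dvd S" "\<not> e ^ Suc a dvd S" "e ^ b dvd S" "\<not> e ^ Suc b dvd (S :: 'a::comm_semiring_1)"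
  shows "a = b"
proof -
  have "\<not> Suc a \<le> b" "\<not> Suc b \<le> a"
    using assms le_imp_power_dvd[of "Suc a" b e] le_imp_power_dvd[of "Suc b" a e] dvd_trans by blast+
  then show ?thesis by linarith
qed

lemma exchange_exps:
  fixes E :: "'i::{finite,linorder} \<Rightarrow> ('i, 's::{factorial_semiring,idom}) mpoly"
  assumes E: "exchange_system E"
  shows "exchange_exps E i i = 0"
    "j \<noteq> i \<Longrightarrow> to_laurent (E j) ^ exchange_exps E i j dvd exchange_subst E i j"
    "j \<noteq> i \<Longrightarrow> \<not> to_laurent (E j) ^ Suc (exchange_exps E i j) dvd exchange_subst E i j"
proof -
  have "\<exists>a. to_laurent (E j) ^ a dvd exchange_subst E i j \<and> \<not> to_laurent (E j) ^ Suc a dvd exchange_subst E i j" for j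
  proof (rule finite_multiplicity_lpoly)
    have "laurent_eval rconst rvar (exchange_subst E i j) \<noteq> 0"
      using rconst.laurent_indep_dual[OF laurent_indep_rvar E, of j] exchange_systemD[OF E, of i]
      by (auto simp: rconst.lev_exchange_subst[OF laurent_indep_rvar E] rconst.laurent_indep_def)
    moreover have "laurent_eval rconst (rvar :: 'i \<Rightarrow> ('i, 's) mpoly fract) 0 = 0"
      using laurent_indep_rvar by (intro unital_hom.hom_zero rconst.lev_hom rconst.laurent_indepD)
    ultimately show "exchange_subst E i j \<noteq> 0" by metis
    show "\<not> to_laurent (E j) dvd 1" using exchange_systemD[OF E] by blast
  qed
  then obtain a where a: "\<And>j. to_laurent (E j) ^ a j dvd exchange_subst E i j \<and> \<not> to_laurent (E j) ^ Suc (a j) dvd exchange_subst E i j"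
    by metis
  have "is_exchange_exponents E i (exchange_exps E i)"
    unfolding exchange_exps_def
  proof (rule theI[where P = "is_exchange_exponents E i" and a = "a(i := 0)"])
    show "is_exchange_exponents E i (a(i := 0))"
      using a by (auto simp: is_exchange_exponents_iff[OF E])
    fix b assume "is_exchange_exponents E i b"
    then show "b = a(i := 0)"
      using a exact_power_unique unfolding is_exchange_exponents_iff[OF E] fun_eq_iff
      by (metis fun_upd_apply)
  qed
  then show "exchange_exps E i i = 0"
    "j \<noteq> i \<Longrightarrow> to_laurent (E j) ^ exchange_exps E i j dvd exchange_subst E i j"
    "j \<noteq> i \<Longrightarrow> \<not> to_laurent (E j) ^ Suc (exchange_exps E i j) dvd exchange_subst E i j"
    unfolding is_exchange_exponents_iff[OF E] by auto
qed

lemma divide_by_monomial_single: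
  "divide_by_monomial E i a = to_laurent (E i) * single (\<Sum>l\<in>-{i}. single l (- int (a l))) 1"
  by (simp add: divide_by_monomial_def prod_single_exp)

lemma lookup_sum_single_compl:
  "lookup (\<Sum>l\<in>-{i::'i::finite}. single l (b l :: int)) k = (if k = i then 0 else b k)"
  by (auto simp: lookup_sum lookup_single when_def sum.delta)

lemma exchange_laurent_props:
  fixes E :: "'i::{finite,linorder} \<Rightarrow> ('i, 's::{factorial_semiring,idom}) mpoly"
  assumes E: "exchange_system E"
  shows "free_of i (exchange_laurent E i)" "exchange_laurent E i \<noteq> 0"
    "exchange_exps E i j = 0 \<Longrightarrow> m \<in> keys (exchange_laurent E i) \<Longrightarrow> lookup m j \<ge> 0"
proof -
  note D = exchange_systemD[OF E, of i]
  show "free_of i (exchange_laurent E i)"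
    unfolding exchange_laurent_altdef divide_by_monomial_single
    using D(1) by (intro free_of_mult) (auto simp: free_of_single lookup_sum_single_compl)
  show "exchange_laurent E i \<noteq> 0"
    unfolding exchange_laurent_altdef divide_by_monomial_single using D(4) by simp
  assume a: "exchange_exps E i j = 0" and m: "m \<in> keys (exchange_laurent E i)"
  let ?n = "\<Sum>l\<in>-{i}. single l (- int (exchange_exps E i l))"
  obtain m' where "m' \<in> keys (to_laurent (E i))" "m = m' + ?n"
    using m keys_mult[of "to_laurent (E i)" "single ?n 1"]
    unfolding exchange_laurent_altdef divide_by_monomial_single by auto
  then show "lookup m j \<ge> 0"
    using a by (auto simp: lookup_add lookup_sum_single_compl keys_to_laurent)
qed

lemma mvar_dvd_of_hcomp_zero:
  fixes p :: "('i::linorder, 's::idom) mpoly"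
  assumes "hcomp j 0 p = 0"
  shows "mvar j dvd p"
proof -
  obtain f where f: "p = poly f (mvar j)" "\<And>n. free_of j (coeff f n)" using mpoly_as_poly[of p j] by blast
  have "coeff f 0 = 0" using hcomp_poly_mvar[OF f(2), of 0] assms f(1) by simp
  then obtain g where "f = pCons 0 g" by (cases f) auto
  then show ?thesis using f(1) by simp
qed

lemma mpoly_eval_mconst_hom: "unital_hom (mpoly_eval mconst (y :: 'i::finite \<Rightarrow> ('i, 's::comm_ring_1) lpoly))"
  by (rule unital_hom_mpoly_eval[OF unital_hom_mconst])

text \<open>
  Constant terms in \<open>x_j\<close> are not affected by \<open>x_j \<leftarrow> d / x_j\<close>.
\<close>

lemma hcomp_exchange_subst:
  fixes p :: "('i::{finite,linorder}, 's::idom) mpoly"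
  assumes d: "free_of j d"
  shows "hcomp j 0 (mpoly_eval mconst (mvar(j := d * single (single j (- 1)) 1)) p) = to_laurent (hcomp j 0 p)"
proof -
  let ?y = "mvar(j := d * single (single j (- 1)) 1) :: 'i \<Rightarrow> ('i, 's) lpoly"
  interpret e: unital_hom "mpoly_eval mconst ?y" by (rule mpoly_eval_mconst_hom)
  show ?thesis
  proof (induction p rule: pm_induct)
    case zero
    then show ?case by (simp only: e.hom_zero tl.hom_zero hcomp_zero)
  next
    case (add m c f)
    let ?n = "lookup m j"
    define A where "A = mconst c * (\<Prod>i\<in>-{j}. mvar i ^ lookup m i) * d ^ ?n"
    have A: "free_of j A" unfolding A_def
      by (intro free_of_mult free_of_power d)
        (auto simp: mconst_def free_of_single mvar_def single_power prod_single_exp lookup_sum lookup_single when_def)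
    have ev: "mpoly_eval mconst ?y (single m c) = A * single (single j (- int ?n)) 1"
      unfolding mpoly_eval_single[OF unital_hom_mconst]
      by (subst prod.remove[where x = j])
        (auto simp: A_def power_mult_distrib single_power Compl_eq_Diff_UNIV[symmetric] mult_ac intro!: prod.cong)
    have "hcomp j 0 (mpoly_eval mconst ?y (single m c)) = (if ?n = 0 then A else 0)"
      unfolding ev hcomp_mult_free[OF A] by (auto simp: hcomp_single lookup_single)
    also have "\<dots> = to_laurent (hcomp j 0 (single m c))"
    proof (cases "?n = 0")
      case True
      have "A = mconst c * (\<Prod>i\<in>UNIV. mvar i ^ lookup m i)"
        by (subst prod.remove[where x = j]) (auto simp: A_def True Compl_eq_Diff_UNIV)
      also have "\<dots> = to_laurent (single m c)"
        unfolding to_laurent_def mpoly_eval_single[OF unital_hom_mconst] ..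
      finally show ?thesis using True by (simp add: hcomp_single)
    qed (simp add: hcomp_single tl.hom_zero)
    finally show ?case using add by (simp only: e.hom_add tl.hom_add hcomp_add)
  qed
qed

text \<open>
  If the exponent were positive, then \<open>E_j\<close> would divide the constant term of \<open>E_i\<close> in \<open>x_j\<close>,
  which is nonzero and free of \<open>x_i\<close>.
\<close>

lemma exchange_exps_zero:
  fixes E :: "'i::{finite,linorder} \<Rightarrow> ('i, 's::{factorial_semiring,idom}) mpoly"
  assumes E: "exchange_system E" and ij: "j \<noteq> i" and inv: "\<not> free_of i (E j)"
  shows "exchange_exps E i j = 0"
proof (rule ccontr)
  assume "exchange_exps E i j \<noteq> 0"
  then have "to_laurent (E j) dvd exchange_subst E i j"
    using exchange_exps(2)[OF E ij] by (metis dvd_power dvd_trans gr0I)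
  then obtain Q where Q: "exchange_subst E i j = to_laurent (E j) * Q" by (auto elim: dvdE)
  have "to_laurent (hcomp j 0 (E i)) = hcomp j 0 (exchange_subst E i j)"
    unfolding exchange_subst_def using exchange_systemD(1)[OF E, of j] by (simp add: hcomp_exchange_subst)
  also have "\<dots> = to_laurent (E j) * hcomp j 0 Q"
    unfolding Q using exchange_systemD(1)[OF E, of j] by (simp add: hcomp_mult_free)
  finally have "to_laurent (E j) dvd to_laurent (hcomp j 0 (E i))" by (metis dvd_triv_left)
  moreover have "hcomp j 0 (E i) \<noteq> 0" using mvar_dvd_of_hcomp_zero exchange_systemD(3)[OF E] by blast
  moreover have "free_of i (hcomp j 0 (E i))" using exchange_systemD(1)[OF E] by (intro free_of_hcomp_other)
  ultimately show False
    using not_dvd_free[OF inv exchange_systemD(3)[OF E], of "to_laurent (hcomp j 0 (E i))"] by simp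
qed

lemma free_of_mpoly_eval:
  fixes p :: "('i::{finite,linorder}, 's::idom) mpoly"
  assumes "free_of k p" "\<And>l. l \<noteq> k \<Longrightarrow> free_of k (y l)"
  shows "free_of k (mpoly_eval mconst y p :: ('i, 's) lpoly)"
proof -
  have "free_of k (\<Prod>l\<in>UNIV. y l ^ lookup m l)" if "m \<in> keys p" for m
  proof -
    have "(\<Prod>l\<in>UNIV. y l ^ lookup m l) = (\<Prod>l\<in>-{k}. y l ^ lookup m l)"
      using assms(1) that by (intro prod.mono_neutral_right) (auto simp: free_of_def)
    moreover have "free_of k (\<Prod>l\<in>I. y l ^ lookup m l)" if "k \<notin> I" for I
      using that assms(2)
      by (induction I rule: infinite_finite_induct) (auto intro!: free_of_mult free_of_power)
    ultimately show ?thesis by simp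
  qed
  then show ?thesis
    unfolding mpoly_eval_def by (intro free_of_sum free_of_mult) (auto simp: mconst_def free_of_single)
qed

section \<open>Invariance of the local rings\<close>

text \<open>
  The Laurent polynomials without negative powers of \<open>x_j\<close>.
\<close>

definition poly_in :: "'i \<Rightarrow> ('i, 's::zero) lpoly set" where
  "poly_in j = {P. \<forall>m\<in>keys P. 0 \<le> lookup m j}"

lemma poly_in_single: "single m c \<in> poly_in j \<longleftrightarrow> c = 0 \<or> 0 \<le> lookup m j"
  by (auto simp: poly_in_def)

lemma subring_poly_in: "subring_of (poly_in j :: ('i, 's::comm_ring_1) lpoly set)"
  unfolding subring_of_def
proof (intro conjI ballI)
  show "1 \<in> poly_in j" by (simp add: poly_in_def)
  fix P Q :: "('i, 's) lpoly" assume PQ: "P \<in> poly_in j" "Q \<in> poly_in j"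
  have "keys (P - Q) \<subseteq> keys P \<union> keys Q"
    by (auto simp: in_keys_iff lookup_minus)
  then show "P - Q \<in> poly_in j" using PQ by (auto simp: poly_in_def)
  show "P * Q \<in> poly_in j"
    using PQ keys_mult[of P Q] unfolding poly_in_def mem_Collect_eq
    by (intro ballI) (force simp: lookup_add)
qed

lemma free_of_poly_in: "free_of j P \<Longrightarrow> P \<in> poly_in j"
  by (simp add: free_of_def poly_in_def)

lemma to_laurent_poly_in: "to_laurent p \<in> poly_in j"
  by (auto simp: poly_in_def keys_to_laurent)

lemma mvar_dvd_minus_hcomp:
  fixes P :: "('i, 's::comm_ring_1) lpoly"
  assumes "P \<in> poly_in j"
  shows "dvd_in (poly_in j) (mvar j) (P - hcomp j 0 P)"
proof -
  note R = subring_poly_in[of j, where 's = 's]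
  have P: "P = (\<Sum>m\<in>keys P. single m (lookup P m))"
    by (rule poly_mapping_eqI) (auto simp: lookup_sum lookup_single when_def in_keys_iff)
  have "P - hcomp j 0 P = (\<Sum>m\<in>keys P. single m (lookup P m)
      - hcomp j 0 (single m (lookup P m)))"
    unfolding sum_subtractf hcomp_sum[symmetric] P[symmetric] ..
  also have "dvd_in (poly_in j) (mvar j) \<dots>"
  proof (rule dvd_in_sum[OF R])
    fix m assume "m \<in> keys P"
    then have m: "0 \<le> lookup m j" using assms by (auto simp: poly_in_def)
    show "dvd_in (poly_in j) (mvar j) (single m (lookup P m)
      - hcomp j 0 (single m (lookup P m)))"
    proof (cases "lookup m j = 0")
      case True
      then show ?thesis using dvd_in_zero[OF R] by (simp add: hcomp_single)
    next
      case False
      have "single m (lookup P m) =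
          mvar j * single (m - single j 1) (lookup P m)"
        by (simp add: mvar_def mult_single)
      moreover have "single (m - single j 1) (lookup P m) \<in> poly_in j"
        using m False by (auto simp: poly_in_single lookup_minus lookup_single)
      moreover have "hcomp j 0 (single m (lookup P m)) = 0"
        using False by (simp add: hcomp_single)
      ultimately show ?thesis unfolding dvd_in_def by (metis diff_zero)
    qed
  qed
  finally show ?thesis .
qed

text \<open>
  The coefficient ring is factorial from here on.
\<close>

locale factorial_hom = coefficient_hom \<phi>
  for \<phi> :: "'s::{factorial_semiring,idom} \<Rightarrow> 'f::field"
begin

abbreviation lev :: "('i::{finite,linorder} \<Rightarrow> 'f) \<Rightarrow> ('i, 's) lpoly \<Rightarrow> 'f" where
  "lev \<equiv> laurent_eval \<phi>"

abbreviation lring :: "('i::{finite,linorder} \<Rightarrow> 'f) \<Rightarrow> 'f set" where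
  "lring \<equiv> laurent_ring \<phi>"

lemma prime_subring_lring:
  assumes "laurent_indep x" "prime_elem e"
  shows "prime_subring (lring x) (lev x e)"
  using prime_in_laurent_ring[OF assms] subring_laurent_ring[OF laurent_indepD[OF assms(1)]]
  by unfold_locales

text \<open>
  In the localisation of a Laurent ring at a prime, the coordinates and all elements not divisible
  by the prime are units.
\<close>

lemma loc_unit_lring:
  assumes x: "laurent_indep x" and e: "prime_elem e"
  shows "loc_unit (lring x) (lev x e) (x i)" "\<not> e dvd P \<Longrightarrow> loc_unit (lring x) (lev x e) (lev x P)"
proof -
  interpret prime_subring "lring x" "lev x e" using x e by (rule prime_subring_lring)
  show "loc_unit (lring x) (lev x e) (x i)"
    using laurent_indepD[OF x] by (intro loc_unit_of_unit laurent_ring_mem)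
  show "loc_unit (lring x) (lev x e) (lev x P)" if "\<not> e dvd P"
    using that by (intro loc_unitI laurent_ring_mem) (simp add: dvd_in_laurent_ring[OF x])
qed

subsection \<open>Exchange polynomials that do not involve the mutated variable\<close>

text \<open>
  \<open>y\<close> and \<open>y'\<close> are the dual points at \<open>j\<close> of a seed and of its mutation at \<open>k\<close>.  The relation between them
  is symmetric, since \<open>W\<close> and \<open>e\<close> do not involve \<open>x_k\<close>.
\<close>

lemma loc_subset_free:
  assumes y: "laurent_indep y" and y': "laurent_indep y'" and e: "prime_elem e" "free_of k e"
    and W: "free_of k W" "\<not> e dvd W" and yk: "y' = y(k := lev y W / y k)"
  shows "loc (lring y') (lev y' e) \<subseteq> loc (lring y) (lev y e)"
proof -
  interpret prime_subring_pair "lring y" "lev y e" "lring y'" "lev y' e"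
    unfolding prime_subring_pair_def using y y' e(1) by (auto intro: prime_subring_lring)
  have ee: "lev y' e = lev y e" and ww: "lev y' W = lev y W"
    unfolding yk using e W by (simp_all add: lev_free)
  define w where "w = lev y W"
  have w: "loc_unit (lring y) (lev y e) w" "loc_unit (lring y') (lev y' e) w"
    using loc_unit_lring(2)[OF y e(1) W(2)] loc_unit_lring(2)[OF y' e(1) W(2)] by (simp_all add: w_def ww)
  have w0: "w \<noteq> 0" using w by (simp add: loc_unit_def)
  have y'k: "y' k = w * inverse (y k)" by (simp add: yk w_def divide_inverse)
  have wN: "w \<in> common_fractions" using subset_common_fractions laurent_ring_mem(1) unfolding w_def by blast
  have yC: "y i \<in> common_fractions" "inverse (y i) \<in> common_fractions" for i
    using subset_common_fractions laurent_ring_mem by blast+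
  have y'C: "y' i \<in> common_fractions \<and> inverse (y' i) \<in> common_fractions" for i
  proof (cases "i = k")
    case True
    have "inverse (y' k) = y k * inverse w" by (simp add: y'k)
    then show ?thesis
      using True y'k subring_mult[OF subring_common_fractions] wN yC common_fractions_inverse[OF wN w] by simp
  qed (use yC in \<open>simp add: yk\<close>)
  show ?thesis
  proof (rule loc_subset)
    show "lring y' \<subseteq> common_fractions"
      using y'C subset_common_fractions laurent_ring_mem(2)
      by (intro laurent_ring_least subring_common_fractions) auto
    show "lring y \<subseteq> loc (lring y') (lev y' e)"
    proof (intro laurent_ring_least Q.subring_loc)
      show "\<phi> c \<in> loc (lring y') (lev y' e)" for c using Q.subset_loc laurent_ring_mem(2) by blast
      have "y i \<in> loc (lring y') (lev y' e) \<and> inverse (y i) \<in> loc (lring y') (lev y' e)" for i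
      proof (cases "i = k")
        case True
        have "y k = w / y' k" using y'k w0 laurent_indepD[OF y, of k] laurent_indepD[OF y', of k] by (simp add: field_simps)
        then have "loc_unit (lring y') (lev y' e) (y k)"
          using w Q.loc_unit_divide loc_unit_lring(1)[OF y' e(1)] by metis
        then show ?thesis using True by (simp add: loc_unit_def)
      next
        case False
        then have "loc_unit (lring y') (lev y' e) (y i)"
          using loc_unit_lring(1)[OF y' e(1), of i] by (simp add: yk)
        then show ?thesis by (simp add: loc_unit_def)
      qed
      then show "y i \<in> loc (lring y') (lev y' e)" "inverse (y i) \<in> loc (lring y') (lev y' e)" for i by auto
    qed
    show "lev y e / lev y' e \<in> loc (lring y') (lev y' e)"
      using subring_one[OF Q.subring_loc] prime_inD(2)[OF P.e] by (simp add: ee)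
  qed
qed

lemma loc_eq_free:
  assumes y: "laurent_indep y" and y': "laurent_indep y'" and e: "prime_elem e" "free_of k e"
    and W: "free_of k W" "\<not> e dvd W" and yk: "y' = y(k := lev y W / y k)"
  shows "loc (lring y') (lev y' e) = loc (lring y) (lev y e)"
proof (rule equalityI[OF loc_subset_free[OF assms]])
  have "lev y' W = lev y W" unfolding yk using W by (simp add: lev_free)
  moreover have "lev y W \<noteq> 0" using loc_unit_lring(2)[OF y e(1) W(2)] by (simp add: loc_unit_def)
  ultimately have "y = y'(k := lev y' W / y' k)"
    using laurent_indepD[OF y, of k] unfolding yk by (auto simp: fun_eq_iff)
  then show "loc (lring y) (lev y e) \<subseteq> loc (lring y') (lev y' e)"
    by (intro loc_subset_free[OF y' y e W])
qed

subsection \<open>Exchange polynomials that involve the mutated variable\<close>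

text \<open>
  The two sides of a mutation at \<open>k\<close>, seen from the exchange polynomials \<open>E\<close> and \<open>E'\<close> at \<open>j\<close>,
  where \<open>A\<close> is the exchange Laurent polynomial at \<open>k\<close>.  The last condition says that \<open>E'\<close> is
  \<open>E\<close> with \<open>\<theta> / X\<close> in place of \<open>x_k\<close>, where \<open>\<theta>\<close> is \<open>A\<close> at \<open>x_j = 0\<close>, up to a power of
  \<open>X\<close> and factors free of \<open>x_j\<close> and \<open>x_k\<close>; it has such factors on both sides in order to be
  symmetric.
\<close>

definition mutation_pair ::
  "'i::{finite,linorder} \<Rightarrow> 'i \<Rightarrow> ('i, 's) lpoly \<Rightarrow> ('i \<Rightarrow> 'f) \<Rightarrow> ('i, 's) mpoly \<Rightarrow> ('i \<Rightarrow> 'f) \<Rightarrow> ('i, 's) mpoly \<Rightarrow> bool"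
  where
  "mutation_pair j k A x E x' E' \<longleftrightarrow> j \<noteq> k \<and> laurent_indep x \<and> laurent_indep x' \<and>
     A \<in> poly_in j \<and> free_of k A \<and> hcomp j 0 A \<noteq> 0 \<and> x' = x(k := lev x A / x k) \<and>
     (\<forall>F\<in>{E, E'}. prime_elem (to_laurent F) \<and> free_of j F \<and> \<not> free_of k F \<and> \<not> mvar k dvd F) \<and>
     (\<exists>C D n. free_of j C \<and> free_of k C \<and> free_of j D \<and> free_of k D \<and> C \<noteq> 0 \<and> D \<noteq> 0 \<and>
        (\<forall>X. X \<noteq> 0 \<longrightarrow> lev x C * lev (x(k := X)) (to_laurent E') =
           lev x D * X powi n * lev (x(k := lev x (hcomp j 0 A) / X)) (to_laurent E)))"

text \<open>
  Polynomials in \<open>x_j\<close> belong to the ring of the dual point, where \<open>x_j = e / y_j\<close>, and modulo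
  \<open>e\<close> only their constant terms remain.
\<close>

lemma lev_poly_in_mod:
  assumes y: "laurent_indep y" and x: "laurent_indep x" and e: "free_of j e" and yj: "y = x(j := lev x e / x j)"
    and P: "P \<in> poly_in j"
  shows "dvd_in (lring y) (lev y e) (lev x P - lev y (hcomp j 0 P))"
    "lev x P \<in> lring y"
proof -
  note R = subring_laurent_ring[OF laurent_indepD[OF y]]
  interpret l: unital_hom "lev x" using x by (intro lev_hom laurent_indepD)
  have ee: "lev y e = lev x e" unfolding yj using e by (rule lev_free)
  have yj': "y j = lev x e / x j" by (simp add: yj)
  then have "lev x e \<noteq> 0" using laurent_indepD[OF y, of j] by auto
  then have xj: "x j = lev y e * inverse (y j)" unfolding ee yj' by simp
  have xN: "x i \<in> lring y" for i
  proof (cases "i = j")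
    case True
    then show ?thesis
      using subring_mult[OF R laurent_ring_mem(1)[of y e] laurent_ring_mem(5)[of y j]] xj by simp
  next
    case False
    then show ?thesis using laurent_ring_mem(3)[of y i] by (simp add: yj)
  qed
  have mem: "lev x P \<in> lring y" if P: "P \<in> poly_in j" for P
  proof -
    have "x i powi lookup m i \<in> lring y" if m: "m \<in> keys P" for m i
    proof (cases "i = j")
      case True
      then have "0 \<le> lookup m i" using P m by (auto simp: poly_in_def)
      then show ?thesis using subring_power[OF R xN] by (simp add: power_int_def)
    next
      case False
      then show ?thesis using laurent_ring_mem(4)[of y i] by (simp add: yj)
    qed
    then show ?thesis unfolding laurent_eval_def
      by (intro subring_sum[OF R] subring_mult[OF R] subring_prod[OF R] laurent_ring_mem(2)) auto
  qed
  from this[OF P] show "lev x P \<in> lring y" .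
  obtain Q where Q: "Q \<in> poly_in j" "P - hcomp j 0 P = mvar j * Q"
    using mvar_dvd_minus_hcomp[OF P] by (auto simp: dvd_in_def)
  have "lev y (hcomp j 0 P) = lev x (hcomp j 0 P)" unfolding yj by (rule lev_free[OF free_of_hcomp_zero])
  then have "lev x P - lev y (hcomp j 0 P) = lev x (mvar j * Q)" by (simp flip: Q(2) add: l.hom_diff)
  also have "\<dots> = lev y e * (inverse (y j) * lev x Q)"
    by (simp add: l.hom_mult laurent_eval_mvar[OF phi_hom] xj)
  finally show "dvd_in (lring y) (lev y e) (lev x P - lev y (hcomp j 0 P))"
    using subring_mult[OF R laurent_ring_mem(5) mem[OF Q(1)]] unfolding dvd_in_def by blast
qed

text \<open>
  Let \<open>\<theta>\<close> be \<open>A\<close> at \<open>x_j = 0\<close>.  Since \<open>\<theta>\<close> and \<open>A\<close> are congruent modulo \<open>x_j\<close>, replacing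
  \<open>x_k\<close> by \<open>x_k \<theta> / A\<close> changes \<open>E\<close> by a multiple of \<open>x_j\<close> only, once the powers of \<open>A\<close> in the
  denominator are cleared.
\<close>

lemma homogenised_substitution:
  assumes x: "laurent_indep x" and A: "A \<in> poly_in j" "lev x A \<noteq> 0" "hcomp j 0 A \<noteq> 0"
  obtains d G where "G \<in> poly_in j"
    "lev x A ^ d * lev (x(k := x k * lev x (hcomp j 0 A) / lev x A)) (to_laurent E)
      = lev x A ^ d * lev x (to_laurent E) + x j * lev x G"
proof -
  note R = subring_poly_in[of j, where 's = 's]
  interpret l: unital_hom "lev x" using x by (intro lev_hom laurent_indepD)
  define T where "T = hcomp j 0 A"
  define s where "s = lev x T / lev x A"
  have T0: "lev x T \<noteq> 0" using x A(3) by (auto simp: T_def laurent_indep_def)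
  have x0: "x i \<noteq> 0" for i using x by (rule laurent_indepD)
  have xs0: "(x(k := x k * s)) i \<noteq> 0" for i using x0 T0 A by (simp add: s_def)
  have T: "T \<in> poly_in j" unfolding T_def by (intro free_of_poly_in free_of_hcomp_zero)
  define t where "t m = to_laurent (single m (lookup E m))" for m
  have tP: "t m \<in> poly_in j" for m unfolding t_def by (rule to_laurent_poly_in)
  define d where "d = (\<Sum>m\<in>keys E. lookup m k)"
  have d: "lookup m k \<le> d" if "m \<in> keys E" for m
    unfolding d_def using that by (intro member_le_sum) auto
  have "E = (\<Sum>m\<in>keys E. single m (lookup E m))"
    by (rule poly_mapping_eqI) (auto simp: lookup_sum lookup_single when_def in_keys_iff)
  then have E: "to_laurent E = (\<Sum>m\<in>keys E. t m)" unfolding t_def tl.hom_sum[symmetric] by simp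
  define U where "U = (\<Sum>m\<in>keys E. t m * (A ^ (d - lookup m k) * T ^ lookup m k))"
  \<comment> \<open>\<open>U\<close> evaluates to the left side; \<open>A - T\<close> divides \<open>A^m - T^m\<close>, and \<open>x_j\<close> divides \<open>A - T\<close>.\<close>
  have "dvd_in (poly_in j) (mvar j) (U - A ^ d * to_laurent E)"
  proof -
    have "U - A ^ d * to_laurent E = (\<Sum>m\<in>keys E.
        t m * A ^ (d - lookup m k) * (T ^ lookup m k - A ^ lookup m k))"
      unfolding U_def E sum_distrib_left sum_subtractf[symmetric]
    proof (rule sum.cong[OF refl])
      fix m assume m: "m \<in> keys E"
      have "A ^ d = A ^ (d - lookup m k) * A ^ lookup m k"
        using d[OF m] by (simp flip: power_add)
      then show "t m * (A ^ (d - lookup m k) * T ^ lookup m k) - A ^ d * t m =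
          t m * A ^ (d - lookup m k) * (T ^ lookup m k - A ^ lookup m k)"
        by (simp add: algebra_simps)
    qed
    also have "dvd_in (poly_in j) (mvar j) \<dots>"
    proof (rule dvd_in_sum[OF R])
      fix m
      have "dvd_in (poly_in j) (mvar j) (T - A)"
        using mvar_dvd_minus_hcomp[OF A(1)] dvd_in_mult_left[OF R, of "mvar j" "A - T" "- 1"]
          subring_uminus[OF R subring_one[OF R]] by (simp add: T_def)
      then have "dvd_in (poly_in j) (mvar j) (T ^ lookup m k - A ^ lookup m k)"
        unfolding power_diff_sumr2
        by (intro dvd_in_mult_left[OF R] subring_sum[OF R] subring_mult[OF R] subring_power[OF R] A T)
      then show "dvd_in (poly_in j) (mvar j)
        (t m * A ^ (d - lookup m k) * (T ^ lookup m k - A ^ lookup m k))"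
        using tP A(1) by (intro dvd_in_mult_right[OF R] subring_mult[OF R] subring_power[OF R])
    qed
    finally show ?thesis .
  qed
  then obtain G where G: "G \<in> poly_in j" "U - A ^ d * to_laurent E = mvar j * G" by (auto simp: dvd_in_def)
  have "lev x A ^ d * lev (x(k := x k * s)) (to_laurent E) = lev x U"
  proof -
    have "lev x A ^ d * lev (x(k := x k * s)) (t m) =
        lev x (t m * (A ^ (d - lookup m k) * T ^ lookup m k))"
      if m: "m \<in> keys E" for m
    proof -
      have "lev (x(k := x k * s)) (t m) = \<phi> (lookup E m) * (\<Prod>i\<in>UNIV. (x(k := x k * s)) i ^ lookup m i)"
        unfolding t_def laurent_eval_to_laurent[OF phi_hom xs0] mpoly_eval_single[OF phi_hom] ..
      also have "(\<Prod>i\<in>UNIV. (x(k := x k * s)) i ^ lookup m i) = (\<Prod>i\<in>UNIV. x i ^ lookup m i) * s ^ lookup m k"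
      proof -
        have "(\<Prod>i\<in>UNIV. (x(k := x k * s)) i ^ lookup m i) =
            (\<Prod>i\<in>UNIV. x i ^ lookup m i * (if i = k then s ^ lookup m k else 1))"
          by (intro prod.cong) (auto simp: power_mult_distrib)
        also have "\<dots> = (\<Prod>i\<in>UNIV. x i ^ lookup m i) * s ^ lookup m k"
          by (simp add: prod.distrib)
        finally show ?thesis .
      qed
      also have "\<phi> (lookup E m) * ((\<Prod>i\<in>UNIV. x i ^ lookup m i) * s ^ lookup m k) =
          lev x (t m) * s ^ lookup m k"
        unfolding t_def laurent_eval_to_laurent[OF phi_hom x0] mpoly_eval_single[OF phi_hom] by simp
      finally have 1: "lev (x(k := x k * s)) (t m) = lev x (t m) * s ^ lookup m k" .
      have "lev x A ^ d = lev x A ^ (d - lookup m k) * lev x A ^ lookup m k"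
        using d[OF m] by (simp flip: power_add)
      then show ?thesis unfolding 1 using A(2) by (simp add: l.hom_mult l.hom_power s_def power_divide)
    qed
    then show ?thesis
      unfolding U_def E l.hom_sum unital_hom.hom_sum[OF lev_hom[OF xs0]] sum_distrib_left
      by (intro sum.cong) auto
  qed
  also have "U = A ^ d * to_laurent E + mvar j * G" using G(2) by (simp add: algebra_simps)
  also have "lev x \<dots> = lev x A ^ d * lev x (to_laurent E) + x j * lev x G"
    by (simp add: l.hom_add l.hom_mult l.hom_power laurent_eval_mvar[OF phi_hom])
  finally show ?thesis
    by (intro that[OF G(1), of d]) (simp only: s_def T_def times_divide_eq_right)
qed

lemma mutation_pairD:
  assumes "mutation_pair j k A x E x' E'"
  shows "j \<noteq> k" "laurent_indep x" "laurent_indep x'" "A \<in> poly_in j" "free_of k A" "hcomp j 0 A \<noteq> 0"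
    "x' = x(k := lev x A / x k)" "prime_elem (to_laurent E)" "free_of j E" "\<not> free_of k E"
    "\<not> mvar k dvd E"
  using assms unfolding mutation_pair_def by blast+

lemma mutation_pair_nonzero:
  assumes "mutation_pair j k A x E x' E'"
  shows "lev x A \<noteq> 0" "lev x (hcomp j 0 A) \<noteq> 0"
  using mutation_pairD[OF assms] by (auto simp: laurent_indep_def)

lemma mutation_pair_sym:
  assumes m: "mutation_pair j k A x E x' E'"
  shows "mutation_pair j k A x' E' x E"
proof -
  note M = mutation_pairD[OF m]
  define T where "T = hcomp j 0 A"
  have T: "free_of k T" "free_of j T" unfolding T_def using M(5) by (auto intro: free_of_hcomp_other free_of_hcomp_zero)
  have ev: "lev x' P = lev x P" if "free_of k P" for P unfolding M(7) using that by (rule lev_free)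
  have x'X: "x'(k := X) = x(k := X)" for X by (simp add: M(7))
  have A0: "lev x A \<noteq> 0" and T0: "lev x T \<noteq> 0" using mutation_pair_nonzero[OF m] by (auto simp: T_def)
  interpret l: unital_hom "lev x" using M(2) by (intro lev_hom laurent_indepD)
  have "x'(k := lev x A / x' k) = x"
    using A0 laurent_indepD[OF M(2), of k] by (simp add: M(7) fun_eq_iff)
  then have xx: "x = x'(k := lev x' A / x' k)" by (simp only: ev[OF M(5)])
  obtain C D n where CD: "free_of j C" "free_of k C" "free_of j D" "free_of k D" "C \<noteq> 0" "D \<noteq> 0"
    and rel: "\<And>X. X \<noteq> 0 \<Longrightarrow> lev x C * lev (x(k := X)) (to_laurent E') =
      lev x D * X powi n * lev (x(k := lev x T / X)) (to_laurent E)"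
    using m unfolding mutation_pair_def T_def by metis
  \<comment> \<open>The power \<open>\<theta>^n\<close> goes to the one or the other side, according to the sign of \<open>n\<close>.\<close>
  define C' where "C' = D * T ^ nat n"
  define D' where "D' = C * T ^ nat (- n)"
  have T_ne: "T \<noteq> 0" using M(6) by (simp add: T_def)
  have CD': "free_of j C'" "free_of k C'" "free_of j D'" "free_of k D'" "C' \<noteq> 0" "D' \<noteq> 0"
    unfolding C'_def D'_def using CD T T_ne by (auto intro!: free_of_mult free_of_power)
  have "lev x' C' * lev (x'(k := X)) (to_laurent E) =
        lev x' D' * X powi n * lev (x'(k := lev x' T / X)) (to_laurent E')" if X: "X \<noteq> 0" for X
  proof -
    have q: "lev x T / (lev x T / X) = X" using T0 X by simp
    have "lev x C * lev (x(k := lev x T / X)) (to_laurent E') =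
        lev x D * (lev x T / X) powi n * lev (x(k := X)) (to_laurent E)"
      using rel[of "lev x T / X"] T0 X unfolding q by simp
    then have "lev x C * lev (x(k := lev x T / X)) (to_laurent E') * X powi n * lev x T ^ nat (- n) =
        lev x D * ((lev x T / X) powi n * X powi n * lev x T ^ nat (- n)) * lev (x(k := X)) (to_laurent E)"
      by (simp add: mult_ac)
    also have "(lev x T / X) powi n * X powi n * lev x T ^ nat (- n) = lev x T ^ nat n"
    proof -
      have "(lev x T / X) powi n * X powi n = lev x T powi n"
        using X by (simp flip: power_int_mult_distrib)
      moreover have "lev x T powi n * lev x T ^ nat (- n) = lev x T ^ nat n"
        using T0 by (cases "n \<ge> 0") (auto simp: power_int_def power_inverse)
      ultimately show ?thesis by simp
    qed
    finally have eq: "lev x C * lev (x(k := lev x T / X)) (to_laurent E') * X powi n * lev x T ^ nat (- n) =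
        lev x D * lev x T ^ nat n * lev (x(k := X)) (to_laurent E)" .
    have "lev x' C' = lev x D * lev x T ^ nat n" "lev x' D' = lev x C * lev x T ^ nat (- n)"
      unfolding ev[OF CD'(2)] ev[OF CD'(4)] by (simp_all add: C'_def D'_def l.hom_mult l.hom_power)
    then show ?thesis
      unfolding x'X ev[OF T(1)] using eq by (simp only: ac_simps)
  qed
  moreover have "\<forall>F\<in>{E', E}. prime_elem (to_laurent F) \<and> free_of j F \<and> \<not> free_of k F \<and> \<not> mvar k dvd F"
    using m by (auto simp: mutation_pair_def)
  ultimately show ?thesis
    unfolding mutation_pair_def T_def[symmetric] using M CD' xx T_ne by blast
qed

text \<open>
  The new coordinate \<open>z = E'(x') / x_j\<close> is a unit of the old local ring: up to units it is
  \<open>A^d y_j + G\<close>.  Modulo \<open>E\<close> the polynomial \<open>G\<close> does not involve \<open>y_j\<close>, so the coefficient of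
  \<open>y_j\<close> is \<open>\<theta>^d\<close>, and \<open>E\<close> does not divide it.
\<close>

lemma mutation_pair_coordinate:
  assumes m: "mutation_pair j k A x E x' E'"
  defines "y \<equiv> x(j := lev x (to_laurent E) / x j)" and "e \<equiv> lev x (to_laurent E)"
    and "z \<equiv> lev x' (to_laurent E') / x j"
  assumes y: "laurent_indep y"
  shows "\<And>P. free_of j P \<Longrightarrow> free_of k P \<Longrightarrow> P \<noteq> 0 \<Longrightarrow> lev x P \<in> lring y \<and> loc_unit (lring y) e (lev x P)"
    and "lev x A \<in> lring y" "loc_unit (lring y) e (lev x A)"
    and "loc_unit (lring y) e z"
    and "\<exists>C N. free_of j C \<and> free_of k C \<and> C \<noteq> 0 \<and> z * (lev x C * lev x A ^ N) \<in> lring y"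
proof -
  note M = mutation_pairD[OF m]
  define T where "T = hcomp j 0 A"
  have T: "free_of k T" "free_of j T" unfolding T_def using M(5) by (auto intro: free_of_hcomp_other free_of_hcomp_zero)
  have ey: "lev y (to_laurent E) = e" unfolding y_def e_def using M(9) by (simp add: lev_free)
  interpret prime_subring "lring y" e
    using prime_subring_lring[OF y M(8)] by (simp add: ey)
  interpret lx: unital_hom "lev x" using M(2) by (intro lev_hom laurent_indepD)
  interpret ly: unital_hom "lev y" using y by (intro lev_hom laurent_indepD)
  have x0: "x i \<noteq> 0" for i using M(2) by (rule laurent_indepD)
  have dvd_y: "dvd_in (lring y) e (lev y P) \<longleftrightarrow> to_laurent E dvd P" for P
    using dvd_in_laurent_ring[OF y] by (simp flip: ey)
  have evy: "lev y P = lev x P" if "free_of j P" for P unfolding y_def using that by (rule lev_free)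
  have unit: "lev x P \<in> lring y" "\<not> dvd_in (lring y) e (lev x P)"
    if P: "free_of j P" "free_of k P" "P \<noteq> 0" for P
    using not_dvd_free[OF M(10,11) P(3,2)] laurent_ring_mem(1)[of y P] by (simp_all add: evy[OF P(1), symmetric] dvd_y)
  then show goal1: "\<And>P. free_of j P \<Longrightarrow> free_of k P \<Longrightarrow> P \<noteq> 0 \<Longrightarrow> lev x P \<in> lring y \<and> loc_unit (lring y) e (lev x P)"
    using loc_unitI by blast
  have fE: "free_of j (to_laurent E)" using M(9) by simp
  have polyN: "lev x P \<in> lring y" if P: "P \<in> poly_in j" for P
    using lev_poly_in_mod(2)[OF y M(2) fE y_def[THEN meta_eq_to_obj_eq] P] .
  have mod: "dvd_in (lring y) e (lev x P - lev y (hcomp j 0 P))" if P: "P \<in> poly_in j" for P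
    using lev_poly_in_mod(1)[OF y M(2) fE y_def[THEN meta_eq_to_obj_eq] P] unfolding ey .
  show AN: "lev x A \<in> lring y" by (rule polyN[OF M(4)])
  have modA: "dvd_in (lring y) e (lev x A - lev x T)"
    using mod[OF M(4)] by (simp add: T_def evy free_of_hcomp_zero)
  have T_ne: "T \<noteq> 0" using M(6) by (simp add: T_def)
  have nA: "\<not> dvd_in (lring y) e (lev x A)"
  proof
    assume "dvd_in (lring y) e (lev x A)"
    then have "dvd_in (lring y) e (lev x A - (lev x A - lev x T))" using modA by (rule dvd_in_diff[OF N])
    then show False using unit(2)[OF T(2,1) T_ne] by simp
  qed
  show unitA: "loc_unit (lring y) e (lev x A)" using AN nA by (rule loc_unitI)
  have A0: "lev x A \<noteq> 0" and T0: "lev x T \<noteq> 0" using mutation_pair_nonzero[OF m] by (auto simp: T_def)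
  obtain d G where G: "G \<in> poly_in j"
    "lev x A ^ d * lev (x(k := x k * lev x T / lev x A)) (to_laurent E) = lev x A ^ d * e + x j * lev x G"
    using homogenised_substitution[OF M(2,4) A0 M(6), of k E] unfolding T_def e_def by metis
  define \<zeta> where "\<zeta> = lev x A ^ d * y j + lev x G"
  have yj: "y j = e / x j" by (simp add: y_def e_def)
  have \<zeta>N: "\<zeta> \<in> lring y" unfolding \<zeta>_def
    using polyN[OF G(1)] AN laurent_ring_mem(3)[of y j] N by (auto intro: subring_intros)
  have "\<not> dvd_in (lring y) e \<zeta>"
  proof
    assume *: "dvd_in (lring y) e \<zeta>"
    have "dvd_in (lring y) e (lev x A ^ d - lev x T ^ d)"
      unfolding power_diff_sumr2 using modA AN unit(1)[OF T(2,1) T_ne] N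
      by (intro dvd_in_mult_left subring_sum subring_mult subring_power)
    then have "dvd_in (lring y) e ((lev x A ^ d - lev x T ^ d) * y j)"
      using laurent_ring_mem(3)[of y j] by (intro dvd_in_mult_left[OF N])
    then have "dvd_in (lring y) e ((lev x A ^ d - lev x T ^ d) * y j + (lev x G - lev y (hcomp j 0 G)))"
      using mod[OF G(1)] by (rule dvd_in_add[OF N])
    with * have "dvd_in (lring y) e (\<zeta> - ((lev x A ^ d - lev x T ^ d) * y j + (lev x G - lev y (hcomp j 0 G))))"
      by (rule dvd_in_diff[OF N])
    also have "\<zeta> - ((lev x A ^ d - lev x T ^ d) * y j + (lev x G - lev y (hcomp j 0 G))) = lev y (T ^ d * mvar j + hcomp j 0 G)"
      using T by (simp add: \<zeta>_def ly.hom_add ly.hom_mult ly.hom_power laurent_eval_mvar[OF phi_hom] evy algebra_simps)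
    finally have "to_laurent E dvd T ^ d * mvar j + hcomp j 0 G" by (simp add: dvd_y)
    then obtain Q where Q: "T ^ d * mvar j + hcomp j 0 G = to_laurent E * Q" by (auto elim: dvdE)
    \<comment> \<open>Comparison of the coefficients of \<open>y_j\<close>.\<close>
    have "hcomp j 1 (hcomp j 0 G) = 0"
      by (rule poly_mapping_eqI) (auto simp: lookup_hcomp when_def)
    then have "hcomp j 1 (T ^ d * mvar j + hcomp j 0 G) = T ^ d * mvar j"
      using T by (simp add: hcomp_add hcomp_mult_free free_of_power mvar_def hcomp_single)
    then have "T ^ d * mvar j = to_laurent E * hcomp j 1 Q"
      using M(9) unfolding Q by (simp add: hcomp_mult_free)
    then have "to_laurent E dvd T ^ d * mvar j" by simp
    moreover have "(mvar j :: ('a, 's) lpoly) dvd 1" unfolding mvar_def by (rule monomial_unit)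
    ultimately have "to_laurent E dvd T ^ d" by (rule dvd_mult_unitD)
    then show False using not_dvd_free[OF M(10,11), of "T ^ d"] T T_ne by (auto intro: free_of_power)
  qed
  with \<zeta>N have unit\<zeta>: "loc_unit (lring y) e \<zeta>" by (rule loc_unitI)
  obtain C D n where CD: "free_of j C" "free_of k C" "free_of j D" "free_of k D" "C \<noteq> 0" "D \<noteq> 0"
    and rel: "\<And>X. X \<noteq> 0 \<Longrightarrow> lev x C * lev (x(k := X)) (to_laurent E') =
      lev x D * X powi n * lev (x(k := lev x T / X)) (to_laurent E)"
    using m unfolding mutation_pair_def T_def by metis
  have x'k: "x' k = lev x A / x k" by (simp add: M(7))
  have "lev x C * lev x' (to_laurent E') = lev x D * x' k powi n * lev (x(k := x k * lev x T / lev x A)) (to_laurent E)"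
  proof -
    have "x(k := x' k) = x'" by (simp add: M(7))
    moreover have "lev x T / x' k = x k * lev x T / lev x A" using x0[of k] A0 by (simp add: x'k)
    moreover have "x' k \<noteq> 0" using M(3) by (rule laurent_indepD)
    ultimately show ?thesis using rel[of "x' k"] by simp
  qed
  then have "lev x C * lev x A ^ d * (z * x j) =
      lev x D * x' k powi n * (lev x A ^ d * lev (x(k := x k * lev x T / lev x A)) (to_laurent E))"
    using x0[of j] by (simp add: z_def mult_ac)
  also have "lev x A ^ d * lev (x(k := x k * lev x T / lev x A)) (to_laurent E) = \<zeta> * x j"
    using G(2) x0[of j] by (simp add: \<zeta>_def yj algebra_simps)
  finally have zz: "lev x C * lev x A ^ d * z = lev x D * x' k powi n * \<zeta>"
    using x0[of j] by (simp add: mult.assoc[symmetric])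
  have C0: "lev x C \<noteq> 0" using M(2) CD by (auto simp: laurent_indep_def)
  have z: "z = lev x D * x' k powi n * \<zeta> / (lev x C * lev x A ^ d)" using zz C0 A0 by (simp add: field_simps)
  have yk: "y k = x k" using M(1) by (simp add: y_def)
  have ux: "loc_unit (lring y) e (x k)" using loc_unit_lring(1)[OF y M(8), of k] ey yk by simp
  show "loc_unit (lring y) e z"
    unfolding z x'k using goal1[OF CD(3,4,6)] goal1[OF CD(1,2,5)] unitA unit\<zeta> ux
    by (intro loc_unit_divide loc_unit_mult loc_unit_power loc_unit_power_int) auto
  have "z * (lev x C * lev x A ^ (d + nat (- n))) = (lev x C * lev x A ^ d * z) * lev x A ^ nat (- n)"
    by (simp add: power_add mult_ac)
  also have "\<dots> = lev x D * (x' k powi n * lev x A ^ nat (- n)) * \<zeta>" unfolding zz by (simp add: mult_ac)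
  also have "x' k powi n * lev x A ^ nat (- n) = x k powi (- n) * lev x A ^ nat n"
    using A0 x0[of k] by (cases "n \<ge> 0")
      (auto simp: x'k power_int_def power_inverse field_simps)
  also have "lev x D * (x k powi (- n) * lev x A ^ nat n) * \<zeta> \<in> lring y"
    using goal1[OF CD(3,4,6)] laurent_ring_mem(4)[of y k "- n"] AN \<zeta>N
    by (intro subring_mult[OF N] subring_power[OF N]) (auto simp: yk)
  finally show "\<exists>C N. free_of j C \<and> free_of k C \<and> C \<noteq> 0 \<and> z * (lev x C * lev x A ^ N) \<in> lring y"
    using CD by blast
qed

lemma mutation_pair_loc_subset:
  assumes m: "mutation_pair j k A x E x' E'"
  defines "y \<equiv> x(j := lev x (to_laurent E) / x j)" and "e \<equiv> lev x (to_laurent E)"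
  defines "y' \<equiv> x'(j := lev x' (to_laurent E') / x' j)" and "e' \<equiv> lev x' (to_laurent E')"
  assumes y: "laurent_indep y" and y': "laurent_indep y'"
  shows "loc (lring y') e' \<subseteq> loc (lring y) e"
proof -
  note M = mutation_pairD[OF m] and M' = mutation_pairD[OF mutation_pair_sym[OF m]]
  note B = mutation_pair_coordinate[OF m y[unfolded y_def], folded y_def e_def]
  note B' = mutation_pair_coordinate[OF mutation_pair_sym[OF m] y'[unfolded y'_def], folded y'_def e'_def]
  have ey: "lev y (to_laurent E) = e" unfolding y_def e_def using M(9) by (simp add: lev_free)
  have ey': "lev y' (to_laurent E') = e'" unfolding y'_def e'_def using M'(9) by (simp add: lev_free)
  interpret prime_subring_pair "lring y" e "lring y'" e'
    unfolding prime_subring_pair_def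
    using prime_subring_lring[OF y M(8)] prime_subring_lring[OF y' M'(8)] by (simp add: ey ey')
  have x'j: "x' j = x j" and x'i: "\<And>i. i \<noteq> k \<Longrightarrow> x' i = x i" using M(1) by (simp_all add: M(7))
  have ev: "lev x' P = lev x P" if "free_of k P" for P unfolding M(7) using that by (rule lev_free)
  have x0: "x i \<noteq> 0" for i using M(2) by (rule laurent_indepD)
  have yk: "y k = x k" "y' k = x' k" using M(1) by (simp_all add: y_def y'_def)
  have yj: "y j = e / x j" "y' j = e' / x j" by (simp_all add: y_def y'_def e_def e'_def x'j)
  have yi: "y' i = y i" if "i \<noteq> j" "i \<noteq> k" for i using that by (simp add: y_def y'_def x'i)
  have uy: "loc_unit (lring y) e (y i)" and uy': "loc_unit (lring y') e' (y' i)" for i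
    using loc_unit_lring(1)[OF y M(8)] loc_unit_lring(1)[OF y' M'(8)] ey ey' by auto
  have uA: "loc_unit (lring y) e (lev x A)" "loc_unit (lring y') e' (lev x A)"
    using B(3) B'(3) ev[OF M(5)] by auto
  have zu: "loc_unit (lring y) e (y' j)" using B(4) by (simp add: yj e'_def)
  have zu': "loc_unit (lring y') e' (y j)" using B'(4) by (simp add: yj e_def x'j)
  have yC: "y i \<in> common_fractions" "inverse (y i) \<in> common_fractions" for i
    using subset_common_fractions laurent_ring_mem by blast+
  have AC: "lev x A \<in> common_fractions" using B(2) subset_common_fractions by blast
  have x'k: "x' k = lev x A * inverse (x k)" by (simp add: M(7) divide_inverse)
  have y'jC: "y' j \<in> common_fractions"
  proof -
    obtain C n where C: "free_of j C" "free_of k C" "C \<noteq> 0"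
      "lev x' (to_laurent E') / x j * (lev x C * lev x A ^ n) \<in> lring y" using B(5) by blast
    have "lev x C * lev x A ^ n \<in> lring y" using B(1)[OF C(1-3)] B(2) P.N by (auto intro: subring_intros)
    moreover have "loc_unit (lring y) e (lev x C * lev x A ^ n)"
      using B(1)[OF C(1-3)] uA by (auto intro: P.loc_unit_mult P.loc_unit_power)
    moreover have "loc_unit (lring y') e' (lev x C * lev x A ^ n)"
      using B'(1)[OF C(1-3)] uA ev[OF C(2)] by (auto intro: Q.loc_unit_mult Q.loc_unit_power)
    ultimately show ?thesis using C(4) unfolding common_fractions_def by (auto simp: yj e'_def)
  qed
  have y'C: "y' i \<in> common_fractions \<and> inverse (y' i) \<in> common_fractions" for i
  proof -
    consider "i = j" | "i = k" | "i \<noteq> j" "i \<noteq> k" by blast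
    then show ?thesis
    proof cases
      case 1
      then show ?thesis using y'jC common_fractions_inverse[OF y'jC zu uy'] by simp
    next
      case 2
      have "inverse (x' k) = y k * inverse (lev x A)" by (simp add: x'k yk)
      moreover have "x' k = lev x A * inverse (y k)" by (simp add: x'k yk)
      ultimately show ?thesis
        using 2 yk(2) subring_mult[OF subring_common_fractions] AC yC common_fractions_inverse[OF AC uA] by simp
    next
      case 3
      then show ?thesis using yC by (simp add: yi)
    qed
  qed
  show ?thesis
  proof (rule loc_subset)
    show "lring y' \<subseteq> common_fractions"
      using y'C subset_common_fractions laurent_ring_mem(2)
      by (intro laurent_ring_least subring_common_fractions) auto
    have yu': "loc_unit (lring y') e' (y i)" for i
    proof -
      consider "i = j" | "i = k" | "i \<noteq> j" "i \<noteq> k" by blast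
      then show ?thesis
      proof cases
        case 1
        then show ?thesis using zu' by simp
      next
        case 2
        have "y k = lev x A / y' k" using x0[of k] mutation_pair_nonzero[OF m] by (simp add: yk M(7))
        then show ?thesis using 2 uA uy' Q.loc_unit_divide by metis
      next
        case 3
        then show ?thesis using uy'[of i] by (simp add: yi)
      qed
    qed
    show "lring y \<subseteq> loc (lring y') e'"
    proof (intro laurent_ring_least Q.subring_loc)
      show "\<phi> c \<in> loc (lring y') e'" for c using Q.subset_loc laurent_ring_mem(2) by blast
      show "y i \<in> loc (lring y') e'" "inverse (y i) \<in> loc (lring y') e'" for i
        using yu'[of i] by (auto simp: loc_unit_def)
    qed
    have "e / e' = y j / y' j" using x0[of j] by (simp add: yj)
    then show "e / e' \<in> loc (lring y') e'"
      using zu' uy' Q.loc_unit_divide by (metis loc_unit_def)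
  qed
qed

theorem mutation_pair_loc_eq:
  assumes m: "mutation_pair j k A x E x' E'"
    and y: "laurent_indep (x(j := lev x (to_laurent E) / x j))"
    and y': "laurent_indep (x'(j := lev x' (to_laurent E') / x' j))"
  shows "loc (lring (x'(j := lev x' (to_laurent E') / x' j))) (lev x' (to_laurent E'))
    = loc (lring (x(j := lev x (to_laurent E) / x j))) (lev x (to_laurent E))"
  using mutation_pair_loc_subset[OF m y y'] mutation_pair_loc_subset[OF mutation_pair_sym[OF m] y' y]
  by (rule equalityI)

end

section \<open>Mutation of exchange polynomials\<close>

lemma cancel_prime_dvd:
  fixes p :: "'a::idom"
  assumes p: "prime_elem p" "\<not> p dvd F" and d: "F dvd a * p"
  shows "F dvd a"
proof -
  obtain q where q: "a * p = F * q" using d by (auto elim: dvdE)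
  have "p dvd F * q" unfolding q[symmetric] by simp
  then have "p dvd q" using p by (auto simp: prime_elem_dvd_mult_iff)
  then obtain r where "q = p * r" by (auto elim: dvdE)
  then have "p * a = p * (F * r)" using q by (simp add: mult_ac)
  then have "a = F * r" using p by (auto simp: prime_elem_def)
  then show ?thesis by simp
qed

lemma cancel_primes_dvd:
  fixes F :: "'a::idom"
  assumes "\<And>p. p \<in> set ps \<Longrightarrow> prime_elem p \<and> \<not> p dvd F" "F dvd a * prod_list ps"
  shows "F dvd a"
  using assms
proof (induction ps)
  case (Cons p ps)
  have "F dvd (a * prod_list ps) * p" using Cons.prems(2) by (simp add: mult_ac)
  then have "F dvd a * prod_list ps" using Cons.prems(1)[of p] cancel_prime_dvd by auto
  then show ?case using Cons by auto
qed simp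

lemma lookup_monomial_mult:
  "lookup (single e (1::'s::comm_ring_1) * P) (e + m) = lookup P (m :: 'i \<Rightarrow>\<^sub>0 int)"
  by (induction P rule: pm_induct)
    (auto simp: distrib_left lookup_add mult_single lookup_single when_def)

text \<open>
  Multiplication with a monomial makes \<open>P\<close> a polynomial that no variable divides.
\<close>

lemma normalise_lpoly:
  fixes P :: "('i::finite, 's::comm_ring_1) lpoly"
  assumes "P \<noteq> 0"
  obtains e F where "to_laurent F = single e 1 * P" "\<And>k. \<not> mvar k dvd F"
    "\<And>k. free_of k P \<Longrightarrow> lookup e k = 0"
proof -
  define b where "b k = Min ((\<lambda>m. lookup m k) ` keys P)" for k
  define e where "e = (\<Sum>k\<in>UNIV. single k (- b k))"
  have e: "lookup e k = - b k" for k
    by (simp add: e_def lookup_sum lookup_single when_def)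
  have ne: "keys P \<noteq> {}" using assms by (metis ex_in_conv in_keys_iff lookup_zero poly_mapping_eqI)
  have b: "b k \<le> lookup m k" if "m \<in> keys P" for m k
    unfolding b_def using that by (intro Min_le) auto
  obtain F where F: "single e 1 * P = to_laurent F"
  proof (rule to_laurent_surj)
    fix n i assume "n \<in> keys (single e 1 * P)"
    then obtain m where "m \<in> keys P" "n = e + m"
      using keys_mult[of "single e 1" P] by auto
    then show "lookup n i \<ge> 0" using b[of m i] by (simp add: lookup_add e)
  qed
  have "\<not> mvar k dvd F" for k
  proof
    assume "mvar k dvd F"
    then obtain q where q: "F = mvar k * q" by (auto elim: dvdE)
    have "b k \<in> (\<lambda>m. lookup m k) ` keys P"
      unfolding b_def using ne by (intro Min_in) auto
    then obtain m where m: "m \<in> keys P" "lookup m k = b k" by auto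
    have "e + m \<in> keys (to_laurent F)"
      using m by (simp add: in_keys_iff lookup_monomial_mult flip: F)
    then obtain m' where m': "m' \<in> keys F" "e + m = lift_exp m'" by (auto simp: keys_to_laurent)
    have "int (lookup m' k) = 0"
      using m(2) by (simp flip: lookup_lift_exp m'(2) add: lookup_add e)
    moreover obtain c where "m' = single k 1 + c"
      using m'(1) keys_mult[of "mvar k" q] unfolding q by (auto simp: mvar_def)
    ultimately show False by (simp add: lookup_add)
  qed
  moreover have "lookup e k = 0" if "free_of k P" for k
  proof -
    have "(\<lambda>m. lookup m k) ` keys P = {0}"
      using that ne by (subst image_cong[OF refl, of _ _ "\<lambda>_. 0"]) (auto simp: free_of_def image_constant_conv)
    then show ?thesis by (simp add: e b_def)
  qed
  ultimately show ?thesis using F that by metis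
qed

text \<open>
  \<open>E_j\<close> at \<open>x_i \<leftarrow> \<theta> / x_i'\<close>, where \<open>\<theta>\<close> is the exchange Laurent polynomial at \<open>i\<close> for
  \<open>x_j = 0\<close>; the variable \<open>i\<close> stands for \<open>x_i'\<close>.
\<close>

definition mutation_subst :: "('i::{finite,linorder} \<Rightarrow> ('i, 's::idom) mpoly) \<Rightarrow> 'i \<Rightarrow> 'i \<Rightarrow> ('i, 's) lpoly" where
  "mutation_subst E i j = mpoly_eval mconst (mvar(i := hcomp j 0 (exchange_laurent E i) *
     single (single i (- 1)) 1)) (E j)"

lemma exchange_laurent_hcomp:
  fixes E :: "'i::{finite,linorder} \<Rightarrow> ('i, 's::{factorial_semiring,idom}) mpoly"
  assumes E: "exchange_system E" and ij: "j \<noteq> i" and inv: "\<not> free_of i (E j)"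
  shows "exchange_laurent E i \<in> poly_in j" "hcomp j 0 (exchange_laurent E i) \<noteq> 0"
    "free_of i (hcomp j 0 (exchange_laurent E i))" "free_of j (hcomp j 0 (exchange_laurent E i))"
proof -
  note a = exchange_exps_zero[OF E ij inv]
  show "exchange_laurent E i \<in> poly_in j"
    using exchange_laurent_props(3)[OF E a] by (auto simp: poly_in_def)
  show "free_of i (hcomp j 0 (exchange_laurent E i))"
    by (intro free_of_hcomp_other exchange_laurent_props E)
  show "free_of j (hcomp j 0 (exchange_laurent E i))" by (rule free_of_hcomp_zero)
  define M where "M = single (\<Sum>l\<in>-{i}. single l (- int (exchange_exps E i l))) (1::'s)"
  have "free_of j M" using a by (simp add: M_def free_of_single lookup_sum_single_compl)
  then have "hcomp j 0 (exchange_laurent E i) = M * to_laurent (hcomp j 0 (E i))"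
    using hcomp_to_laurent[of j 0 "E i"]
    unfolding exchange_laurent_altdef divide_by_monomial_single M_def[symmetric] mult.commute[of _ M]
    by (simp add: hcomp_mult_free)
  moreover have "hcomp j 0 (E i) \<noteq> 0" using mvar_dvd_of_hcomp_zero exchange_systemD(3)[OF E] by blast
  ultimately show "hcomp j 0 (exchange_laurent E i) \<noteq> 0" by (simp add: M_def)
qed

text \<open>
  Nonvanishing is seen at the generic point: there the substitution leads to coordinates that are
  again independent.
\<close>

lemma mutation_subst_props:
  fixes E :: "'i::{finite,linorder} \<Rightarrow> ('i, 's::{factorial_semiring,idom}) mpoly"
  assumes E: "exchange_system E" and ij: "j \<noteq> i" and inv: "\<not> free_of i (E j)"
  shows "mutation_subst E i j \<noteq> 0" "free_of j (mutation_subst E i j)"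
proof -
  note T = exchange_laurent_hcomp[OF E ij inv]
  let ?x = "rvar :: 'i \<Rightarrow> ('i, 's) mpoly fract"
  have x0: "?x l \<noteq> 0" for l using laurent_indep_rvar by (rule rconst.laurent_indepD)
  have "laurent_eval rconst ?x (hcomp j 0 (exchange_laurent E i)) \<noteq> 0"
    using laurent_indep_rvar T(2) by (auto simp: rconst.laurent_indep_def)
  moreover have "rconst.laurent_indep (?x(i := laurent_eval rconst ?x (hcomp j 0 (exchange_laurent E i)) / ?x i))"
    by (rule rconst.laurent_indep_exchange[OF laurent_indep_rvar T(3,2)])
  ultimately have "laurent_eval rconst ?x (mutation_subst E i j) \<noteq> 0"
    unfolding mutation_subst_def using x0 exchange_systemD(4)[OF E]
    by (auto simp: rconst.lev_substitution rconst.laurent_indep_def)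
  moreover have "laurent_eval rconst ?x 0 = 0"
    using x0 by (intro unital_hom.hom_zero rconst.lev_hom)
  ultimately show "mutation_subst E i j \<noteq> 0" by metis
  show "free_of j (mutation_subst E i j)"
    unfolding mutation_subst_def
  proof (rule free_of_mpoly_eval)
    show "free_of j (E j)" by (rule exchange_systemD[OF E])
    fix l assume "l \<noteq> j"
    then show "free_of j ((mvar(i := hcomp j 0 (exchange_laurent E i) * single (single i (- 1)) 1)) l)"
      using ij T(4) by (auto intro!: free_of_mult mvar_power_free simp: free_of_single lookup_single)
  qed
qed

lemma common_factorE:
  fixes E :: "'i::{finite,linorder} \<Rightarrow> ('i, 's::{factorial_semiring,idom}) mpoly"
  assumes "mutated_expoly E i j F"
  obtains cs H u e where "mutation_subst E i j = prod_list cs * H"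
    "\<And>c. c \<in> set cs \<Longrightarrow> free_of i c \<and> free_of j c"
    "\<And>p. free_of i p \<Longrightarrow> free_of j p \<Longrightarrow> to_laurent p dvd hcomp j 0 (exchange_laurent E i) \<Longrightarrow>
       to_laurent p dvd H \<Longrightarrow> to_laurent p dvd 1"
    "u dvd 1" "lookup e j = 0" "to_laurent F = single e u * H"
    "\<And>k. \<not> mvar k dvd F"
proof -
  from assms obtain H u e where
    1: "common_factors_removed {i, j} (hcomp j 0 (exchange_laurent E i)) (mutation_subst E i j) H"
    and 2: "u dvd 1" "lookup e j = 0" "to_laurent F = single e u * H"
      "\<And>k. \<not> mvar k dvd F"
    unfolding mutated_expoly_def Let_def set_zero_eq_hcomp mutation_subst_def by blast
  note 1 = 1[unfolded common_factors_removed_def Let_def]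
  obtain cs where cs': "mutation_subst E i j = prod_list cs * H \<and>
      (\<forall>c\<in>set cs. c \<in> to_laurent ` {p. \<forall>k\<in>{i, j}. \<not> involves k p} \<and> c dvd hcomp j 0 (exchange_laurent E i))"
    using conjunct1[OF 1] by (rule exE)
  have cs: "mutation_subst E i j = prod_list cs * H"
    "\<And>c. c \<in> set cs \<Longrightarrow> c \<in> to_laurent ` {p. \<forall>k\<in>{i, j}. \<not> involves k p}"
    using conjunct1[OF cs'] bspec[OF conjunct2[OF cs']] by simp_all
  have 3: "c dvd 1" if "c \<in> to_laurent ` {p. \<forall>k\<in>{i, j}. \<not> involves k p}"
    "c dvd hcomp j 0 (exchange_laurent E i)" "c dvd H" for c
    using bspec[OF conjunct2[OF 1] that(1)] that(2,3) by simp
  show ?thesis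
  proof (rule that[OF cs(1) _ _ 2])
    show "free_of i c \<and> free_of j c" if "c \<in> set cs" for c
      using cs(2)[OF that] by (auto simp: involves_iff)
    show "to_laurent p dvd 1" if "free_of i p" "free_of j p"
      "to_laurent p dvd hcomp j 0 (exchange_laurent E i)" "to_laurent p dvd H" for p
      using that 3[of "to_laurent p"] by (auto simp: involves_iff)
  qed
qed

lemma mutated_expoly_exists:
  fixes E :: "'i::{finite,linorder} \<Rightarrow> ('i, 's::{factorial_semiring,idom}) mpoly"
  assumes E: "exchange_system E" and ij: "j \<noteq> i" and inv: "\<not> free_of i (E j)"
  shows "\<exists>F. mutated_expoly E i j F"
proof -
  note G = mutation_subst_props[OF E ij inv]
  let ?R = "to_laurent ` {p :: ('i, 's) mpoly. \<forall>k\<in>{i, j}. \<not> involves k p}"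
  let ?A = "hcomp j 0 (exchange_laurent E i)"
  obtain cs H where H: "mutation_subst E i j = prod_list cs * H"
    "\<forall>c\<in>set cs. c \<in> ?R \<and> c dvd ?A" "\<forall>c. (c \<in> ?R \<and> c dvd ?A) \<and> c dvd H \<longrightarrow> c dvd 1"
    using remove_common_factors[OF G(1), of "\<lambda>c. c \<in> ?R \<and> c dvd ?A"] by blast
  have H0: "H \<noteq> 0" "prod_list cs \<noteq> 0" using H(1) G(1) by auto
  have "free_of j (prod_list cs)"
    using H(2) by (intro free_of_prod_list) (auto simp: involves_iff)
  then have fH: "free_of j H" using free_of_cancel[of j "prod_list cs" H] H0 H(1) G(2) by simp
  obtain e F where F: "to_laurent F = single e 1 * H" "\<And>k. \<not> mvar k dvd F"
    "\<And>k. free_of k H \<Longrightarrow> lookup e k = 0" by (rule normalise_lpoly[OF H0(1)]) blast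
  have "common_factors_removed {i, j} ?A (mutation_subst E i j) H"
    unfolding common_factors_removed_def Let_def using H by blast
  then have "mutated_expoly E i j F"
    unfolding mutated_expoly_def Let_def set_zero_eq_hcomp mutation_subst_def[symmetric]
    using F fH one_dvd by blast
  then show ?thesis by blast
qed

context factorial_hom
begin

text \<open>
  Powers of \<open>T\<close> carry the Laurent ring of \<open>x\<close> with \<open>T / x_k\<close> in place of \<open>x_k\<close> into that of
  \<open>x\<close>.
\<close>

lemma lev_clear_exchange:
  assumes x: "laurent_indep x" and T: "free_of k T" "T \<noteq> 0"
  obtains n b where "lev (x(k := lev x T / x k)) a * lev x T ^ n = lev x b"
proof -
  define xt where "xt = x(k := lev x T / x k)"
  note R = subring_laurent_ring[of x, OF laurent_indepD[OF x]]
  have T0: "lev x T \<noteq> 0" using x T by (auto simp: laurent_indep_def)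
  have x0: "x i \<noteq> 0" for i using x by (rule laurent_indepD)
  define S where "S = {f. \<exists>n. f * lev x T ^ n \<in> lring x}"
  have S: "subring_of S" and "lring x \<subseteq> S"
    unfolding S_def by (rule subring_saturation[OF R laurent_ring_mem(1)])+
  then have sub: "f \<in> S" if "f \<in> lring x" for f using that by blast
  have "xt i \<in> S \<and> inverse (xt i) \<in> S" for i
  proof (cases "i = k")
    case True
    have "inverse (xt k) * lev x T ^ 1 = x k" using T0 x0[of k] by (simp add: xt_def field_simps)
    then have "inverse (xt k) \<in> S" unfolding S_def using laurent_ring_mem(3)[of x k] by (metis (mono_tags) mem_Collect_eq)
    moreover have "xt k = lev x T * inverse (x k)" by (simp add: xt_def divide_inverse)
    then have "xt k \<in> S" using sub[OF subring_mult[OF R laurent_ring_mem(1) laurent_ring_mem(5)], of T k] by simp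
    ultimately show ?thesis using True by simp
  qed (use sub[OF laurent_ring_mem(3)[of x i]] sub[OF laurent_ring_mem(5)[of x i]] in \<open>simp add: xt_def\<close>)
  then have "lring xt \<subseteq> S" using sub laurent_ring_mem(2) by (intro laurent_ring_least S) auto
  then have "lev xt a \<in> S" using laurent_ring_mem(1) by blast
  then obtain n b where "lev xt a * lev x T ^ n = lev x b" by (auto simp: S_def laurent_ring_def)
  then show ?thesis using that unfolding xt_def by blast
qed

text \<open>
  The definition of the mutated polynomial \<open>F\<close>, without denominators and at points: \<open>C\<close> is the
  product of the removed factors, \<open>D\<close> a monomial with unit coefficient.  The last property says that
  all common factors with \<open>T\<close> have been removed.
\<close>

lemma mutated_expoly_relation:
  fixes x :: "'i::{finite,linorder} \<Rightarrow> 'f" and E :: "'i \<Rightarrow> ('i, 's) mpoly"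
  assumes x: "laurent_indep x" and E: "exchange_system E" and ij: "j \<noteq> i" and inv: "\<not> free_of i (E j)"
    and F: "mutated_expoly E i j F"
  defines "T \<equiv> hcomp j 0 (exchange_laurent E i)"
  obtains C D n where "free_of j C" "free_of i C" "free_of j D" "free_of i D" "C \<noteq> 0" "D dvd 1"
    "\<And>X. X \<noteq> 0 \<Longrightarrow> lev x C * lev (x(i := X)) (to_laurent F) =
       lev x D * X powi n * lev (x(i := lev x T / X)) (to_laurent (E j))"
    "free_of j F"
    "\<And>p. free_of i p \<Longrightarrow> free_of j p \<Longrightarrow> prime_elem (to_laurent p) \<Longrightarrow> to_laurent p dvd T \<Longrightarrow> \<not> to_laurent p dvd to_laurent F"
proof -
  note G = mutation_subst_props[OF E ij inv] and T = exchange_laurent_hcomp[OF E ij inv, folded T_def]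
  obtain cs H u e where H: "mutation_subst E i j = prod_list cs * H"
    and cs: "\<And>c. c \<in> set cs \<Longrightarrow> free_of i c \<and> free_of j c"
    and np: "\<And>p. free_of i p \<Longrightarrow> free_of j p \<Longrightarrow> to_laurent p dvd T \<Longrightarrow> to_laurent p dvd H \<Longrightarrow> to_laurent p dvd 1"
    and u: "u dvd 1" and e: "lookup e j = 0" and FH: "to_laurent F = single e u * H"
    using common_factorE[OF F] unfolding T_def by metis
  define C where "C = prod_list cs"
  define n where "n = lookup e i"
  define D where "D = single (e - single i n) u"
  have C: "free_of j C" "free_of i C" using cs unfolding C_def by (auto intro: free_of_prod_list)
  have C0: "C \<noteq> 0" "H \<noteq> 0" using H G(1) by (auto simp: C_def)
  have D: "free_of j D" "free_of i D"
    using ij e by (auto simp: D_def free_of_single lookup_minus lookup_single n_def)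
  obtain v where v: "1 = u * v" using u by (auto elim: dvdE)
  have su: "single m u dvd 1" for m :: "'i \<Rightarrow>\<^sub>0 int"
  proof
    show "1 = single m u * single (- m) v" by (simp add: mult_single flip: v)
  qed
  have De: "single e u = D * single (single i n) 1"
    by (simp add: D_def mult_single)
  have CF: "C * to_laurent F = D * single (single i n) 1 * mutation_subst E i j"
    unfolding FH H C_def De[symmetric] by (simp only: ac_simps)
  have fH: "free_of j H" using free_of_cancel[of j C H] C C0 H G(2) by (simp add: C_def)
  have "free_of j (to_laurent F)" unfolding FH using e fH by (intro free_of_mult) (auto simp: free_of_single)
  then have fF: "free_of j F" by simp
  have rel: "lev x C * lev (x(i := X)) (to_laurent F) =
       lev x D * X powi n * lev (x(i := lev x T / X)) (to_laurent (E j))" if X: "X \<noteq> 0" for X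
  proof -
    have p0: "(x(i := X)) l \<noteq> 0" for l using laurent_indepD[OF x] X by simp
    interpret p: unital_hom "lev (x(i := X))" by (rule lev_hom) (rule p0)
    have pf: "lev (x(i := X)) P = lev x P" if "free_of i P" for P using that by (rule lev_free)
    have T0: "lev (x(i := X)) T \<noteq> 0" unfolding pf[OF T(3)] using x T(2) by (auto simp: laurent_indep_def)
    have "lev (x(i := X)) (single (single i n) 1) = X powi n"
      by (simp only: laurent_eval_single[OF phi_hom] prod_single_var_powi hom_one) simp
    moreover have "lev (x(i := X)) (mutation_subst E i j) = lev (x(i := lev x T / X)) (to_laurent (E j))"
      unfolding mutation_subst_def T_def[symmetric] lev_substitution[OF p0 T0] pf[OF T(3)] by simp
    moreover have "lev (x(i := X)) (C * to_laurent F) =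
        lev (x(i := X)) (D * single (single i n) 1 * mutation_subst E i j)"
      unfolding CF ..
    ultimately show ?thesis unfolding p.hom_mult pf[OF C(2)] pf[OF D(2)] by simp
  qed
  have nd: "\<not> to_laurent p dvd to_laurent F"
    if p: "free_of i p" "free_of j p" "prime_elem (to_laurent p)" "to_laurent p dvd T" for p
  proof
    assume "to_laurent p dvd to_laurent F"
    then have "to_laurent p dvd H * single e u" unfolding FH by (simp add: mult.commute)
    then have "to_laurent p dvd H" using su dvd_mult_unitD by blast
    then show False using np p by (auto simp: prime_elem_def)
  qed
  show ?thesis by (rule that[OF C D C0(1) _ rel fF nd]) (auto simp: D_def su)
qed

text \<open>
  At the point \<open>xt\<close>, obtained from \<open>x\<close> by \<open>x_i \<leftarrow> T / x_i\<close>, the value of \<open>F\<close> is that of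
  \<open>E_j\<close> at \<open>x\<close>, up to factors free of \<open>x_i\<close> and powers of \<open>x_i\<close>.  The Laurent rings of \<open>x\<close>
  and \<open>xt\<close> agree after \<open>T\<close> is inverted, and \<open>E_j\<close> is prime in the former.  So if \<open>F\<close> divides
  \<open>a b\<close>, then it divides \<open>a\<close> or \<open>b\<close> up to a power of \<open>T\<close>.  That power can be dropped, because
  no prime factor of \<open>T\<close> divides \<open>F\<close>.
\<close>

lemma mutated_expoly_prime:
  fixes x :: "'i::{finite,linorder} \<Rightarrow> 'f" and E :: "'i \<Rightarrow> ('i, 's) mpoly"
  assumes x: "laurent_indep x" and E: "exchange_system E" and ij: "j \<noteq> i" and inv: "\<not> free_of i (E j)"
    and F: "mutated_expoly E i j F"
  shows "prime_elem (to_laurent F)" "\<not> free_of i F"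
proof -
  define T where "T = hcomp j 0 (exchange_laurent E i)"
  note T = exchange_laurent_hcomp[OF E ij inv, folded T_def] and Ej = exchange_systemD[OF E]
  obtain C D n where C: "free_of j C" "free_of i C" "C \<noteq> 0" and D: "free_of j D" "free_of i D" "D dvd 1"
    and rel: "\<And>X. X \<noteq> 0 \<Longrightarrow> lev x C * lev (x(i := X)) (to_laurent F) =
       lev x D * X powi n * lev (x(i := lev x T / X)) (to_laurent (E j))"
    and np: "\<And>p. free_of i p \<Longrightarrow> free_of j p \<Longrightarrow> prime_elem (to_laurent p) \<Longrightarrow> to_laurent p dvd T \<Longrightarrow> \<not> to_laurent p dvd to_laurent F"
    using mutated_expoly_relation[OF x E ij inv F] unfolding T_def by metis
  define xt where "xt = x(i := lev x T / x i)"
  have xt: "laurent_indep xt" unfolding xt_def by (rule laurent_indep_exchange[OF x T(3,2)])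
  have x0: "x l \<noteq> 0" for l using x by (rule laurent_indepD)
  have xt0: "xt l \<noteq> 0" for l using xt by (rule laurent_indepD)
  have ev: "lev xt P = lev x P" if "free_of i P" for P unfolding xt_def using that by (rule lev_free)
  have T0: "lev x T \<noteq> 0" using x T(2) by (auto simp: laurent_indep_def)
  have xi: "x i = lev x T / xt i" using T0 x0[of i] by (simp add: xt_def)
  have "xt(i := lev x T / xt i) = x" using T0 x0[of i] by (auto simp: xt_def fun_eq_iff)
  then have x_xt: "x = xt(i := lev xt T / xt i)" by (simp only: ev[OF T(3)])
  interpret l: unital_hom "lev x" by (rule lev_hom) (rule x0)
  interpret lt: unital_hom "lev xt" by (rule lev_hom) (rule xt0)
  have FE: "lev x C * lev xt (to_laurent F) = lev x D * xt i powi n * lev x (to_laurent (E j))"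
  proof -
    have "lev x T / (lev x T / x i) = x i" using T0 by simp
    then show ?thesis using rel[of "lev x T / x i"] T0 x0[of i] by (simp add: xt_def)
  qed
  define N where "N = nat (- n)"
  have xtN: "xt i powi n * lev x T ^ N = lev x T ^ nat n * x i powi (- n)"
    using T0 x0[of i] by (cases "n \<ge> 0") (auto simp: xt_def N_def power_int_def power_inverse power_divide field_simps)
  have prime: "prime_elem (to_laurent (E j))" and Enz: "\<not> to_laurent (E j) dvd Q" if "Q \<noteq> 0" "free_of i Q" for Q
    using Ej(2) not_dvd_free[OF inv Ej(3) that] by auto
  have prime: "prime_elem (to_laurent (E j))" by (rule Ej(2))
  have CTT: "\<not> to_laurent (E j) dvd C * T ^ m" for m
    using C T by (intro Enz) (auto intro: free_of_mult free_of_power)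
  \<comment> \<open>Divisibility by \<open>F\<close> at \<open>xt\<close> gives divisibility by \<open>E_j\<close> at \<open>x\<close>.\<close>
  have key: "\<exists>m. to_laurent (E j) dvd C * T ^ m * (a' * b')"
    if ab: "a * b = to_laurent F * c" and a': "lev xt a * lev x T ^ na = lev x a'"
      and b': "lev xt b * lev x T ^ nb = lev x b'" for a b c a' b' na nb
  proof -
    obtain nc c' where c': "lev xt c * lev x T ^ nc = lev x c'"
      using lev_clear_exchange[OF x T(3,2)] unfolding xt_def by metis
    have "lev x (C * T ^ (nc + N) * (a' * b')) =
        lev x C * lev x T ^ nc * lev x T ^ N * ((lev xt a * lev x T ^ na) * (lev xt b * lev x T ^ nb))"
      unfolding a' b' by (simp add: l.hom_mult l.hom_power power_add mult_ac)
    also have "\<dots> = lev x C * (lev xt (a * b)) * lev x T ^ nc * lev x T ^ N * lev x T ^ na * lev x T ^ nb"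
      by (simp add: lt.hom_mult mult_ac)
    also have "\<dots> = (lev x C * lev xt (to_laurent F)) * (lev xt c * lev x T ^ nc) * lev x T ^ N * lev x T ^ na * lev x T ^ nb"
      unfolding ab lt.hom_mult by (simp only: ac_simps)
    also have "\<dots> = lev x D * (xt i powi n * lev x T ^ N) * lev x (to_laurent (E j)) * lev x c' * lev x T ^ na * lev x T ^ nb"
      unfolding FE c' by (simp only: ac_simps)
    also have "\<dots> = lev x (to_laurent (E j) * (D * T ^ nat n * single (single i (- n)) 1 * c' * T ^ na * T ^ nb))"
    proof -
      have "lev x (single (single i (- n)) 1) = x i powi (- n)"
        by (simp only: laurent_eval_single[OF phi_hom] prod_single_var_powi hom_one mult_1)
      then show ?thesis unfolding xtN l.hom_mult l.hom_power by (simp only: ac_simps)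
    qed
    finally have "C * T ^ (nc + N) * (a' * b') = to_laurent (E j) * (D * T ^ nat n * single (single i (- n)) 1 * c' * T ^ na * T ^ nb)"
      by (simp only: lev_inject[OF x])
    then show ?thesis by (metis dvd_triv_left)
  qed
  \<comment> \<open>Powers of \<open>T\<close> cancel, prime factor by prime factor.\<close>
  have T_primes: "to_laurent F dvd a" if F_dvd: "to_laurent F dvd a * T ^ m" for a m
  proof -
    obtain w ps where ps: "w dvd 1" "T = w * prod_list (map to_laurent ps)"
      "\<And>p. p \<in> set ps \<Longrightarrow> prime_elem (to_laurent p)" "\<And>p k. p \<in> set ps \<Longrightarrow> free_of k T \<Longrightarrow> free_of k p"
      by (rule lpoly_prime_factorization[OF T(2)]) blast
    have pT: "to_laurent p dvd T" if p: "p \<in> set ps" for p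
    proof -
      obtain ps1 ps2 where "ps = ps1 @ p # ps2" using split_list[OF p] by blast
      then have "T = to_laurent p * (w * prod_list (map to_laurent ps1) * prod_list (map to_laurent ps2))"
        using ps(2) by (simp add: mult_ac)
      then show ?thesis by (metis dvd_triv_left)
    qed
    show ?thesis using F_dvd
    proof (induction m)
      case (Suc m)
      have "to_laurent F dvd (a * T ^ m * prod_list (map to_laurent ps)) * w"
        using Suc.prems unfolding power_Suc by (subst (asm) ps(2)) (simp add: mult_ac)
      then have "to_laurent F dvd a * T ^ m * prod_list (map to_laurent ps)" using ps(1) by (rule dvd_mult_unitD)
      then have "to_laurent F dvd a * T ^ m"
        by (rule cancel_primes_dvd[rotated]) (use ps np pT T(3,4) in auto)
      then show ?case by (rule Suc.IH)
    qed simp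
  qed
  \<comment> \<open>Conversely, divisibility by \<open>E_j\<close> at \<open>x\<close> gives divisibility by \<open>F\<close> at \<open>xt\<close>.\<close>
  have descend: "to_laurent F dvd a" if E_dvd: "to_laurent (E j) dvd a'" and a': "lev xt a * lev x T ^ na = lev x a'" for a a' na
  proof -
    obtain q where q: "a' = to_laurent (E j) * q" using E_dvd by (auto elim: dvdE)
    obtain nq q' where q': "lev x q * lev xt T ^ nq = lev xt q'"
      using lev_clear_exchange[OF xt T(3,2)] unfolding x_xt[symmetric] by metis
    define Y where "Y = single (single i n) (1::'s)"
    have Y: "lev xt Y = xt i powi n" unfolding Y_def
      by (simp only: laurent_eval_single[OF phi_hom] prod_single_var_powi hom_one mult_1)
    have "lev xt (a * T ^ (na + nq) * (D * Y)) = (lev xt a * lev x T ^ na) * lev x T ^ nq * (lev x D * xt i powi n)"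
      by (simp add: lt.hom_mult lt.hom_power ev[OF T(3)] ev[OF D(2)] Y power_add mult_ac)
    also have "\<dots> = (lev x D * xt i powi n * lev x (to_laurent (E j))) * (lev x q * lev xt T ^ nq)"
      unfolding a' q l.hom_mult ev[OF T(3)] by (simp only: ac_simps)
    also have "\<dots> = lev xt (to_laurent F * (C * q'))"
      unfolding FE[symmetric] q' by (simp add: lt.hom_mult ev[OF C(2)] mult_ac)
    finally have "a * T ^ (na + nq) * (D * Y) = to_laurent F * (C * q')" by (simp only: lev_inject[OF xt])
    then have "to_laurent F dvd a * T ^ (na + nq) * (D * Y)" by (metis dvd_triv_left)
    moreover have "D * Y dvd 1" using D(3) unfolding Y_def by (intro unit_mult monomial_unit)
    ultimately have "to_laurent F dvd a * T ^ (na + nq)" by (rule dvd_mult_unitD)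
    then show ?thesis by (rule T_primes)
  qed
  have F0: "to_laurent F \<noteq> 0"
  proof
    assume F_zero: "to_laurent F = 0"
    have "lev x D * xt i powi n * lev x (to_laurent (E j)) = 0"
      using FE unfolding F_zero lt.hom_zero by simp
    moreover have "D \<noteq> 0" using D(3) by auto
    ultimately show False using x xt0[of i] Ej(4)[of j] by (auto simp: laurent_indep_def)
  qed
  show "prime_elem (to_laurent F)"
  proof (rule prime_elemI)
    show "to_laurent F \<noteq> 0" by (rule F0)
    show "\<not> to_laurent F dvd 1"
    proof
      assume "to_laurent F dvd 1"
      then obtain c where "1 * 1 = to_laurent F * c" by (auto elim: dvdE)
      then obtain m where "to_laurent (E j) dvd C * T ^ m * (1 * 1)"
        using key[of 1 1 c 0 1 0 1] by (auto simp: l.hom_one lt.hom_one)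
      then show False using CTT by simp
    qed
    fix a b assume "to_laurent F dvd a * b"
    then obtain c where c: "a * b = to_laurent F * c" by (auto elim: dvdE)
    obtain na a' where a': "lev xt a * lev x T ^ na = lev x a'"
      using lev_clear_exchange[OF x T(3,2)] unfolding xt_def by metis
    obtain nb b' where b': "lev xt b * lev x T ^ nb = lev x b'"
      using lev_clear_exchange[OF x T(3,2)] unfolding xt_def by metis
    obtain m where "to_laurent (E j) dvd C * T ^ m * (a' * b')" using key[OF c a' b'] by blast
    then have "to_laurent (E j) dvd a' \<or> to_laurent (E j) dvd b'"
      using CTT prime by (auto simp: prime_elem_dvd_mult_iff)
    then show "to_laurent F dvd a \<or> to_laurent F dvd b" using descend a' b' by blast
  qed
  show "\<not> free_of i F"
  proof
    assume "free_of i F"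
    then have fF: "free_of i (to_laurent F)" by simp
    have "lev xt (to_laurent F) * lev x T ^ 0 = lev x (to_laurent F)" using ev[OF fF] by simp
    moreover have "lev xt 1 * lev x T ^ 0 = lev x 1" by (simp add: lt.hom_one l.hom_one)
    ultimately obtain m where "to_laurent (E j) dvd C * T ^ m * (to_laurent F * 1)"
      using key[of "to_laurent F" 1 1 0 "to_laurent F" 0 1] by auto
    moreover have "free_of i (C * T ^ m * (to_laurent F * 1))"
      using C T fF by (auto intro!: free_of_mult free_of_power)
    moreover have "C * T ^ m * (to_laurent F * 1) \<noteq> 0" using C T F0 by auto
    ultimately show False using Enz by blast
  qed
qed

end

section \<open>Mutation of seeds\<close>

context factorial_hom
begin

text \<open>
  The invariant that mutations preserve: an independent cluster together with prime exchange
  polynomials.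
\<close>

definition good_seed :: "('i::{finite,linorder}, 's, 'f) lp_seed \<Rightarrow> bool" where
  "good_seed t \<longleftrightarrow> laurent_indep (cvar t) \<and> exchange_system (expoly t)"

text \<open>
  The local ring \<open>O_j(t)\<close>: the Laurent ring of the seed mutated at \<open>j\<close>, localised at the exchange
  polynomial \<open>E_j\<close>.
\<close>

definition seed_loc :: "('i::{finite,linorder}, 's, 'f) lp_seed \<Rightarrow> 'i \<Rightarrow> 'f set" where
  "seed_loc t j = loc (lring (dual (cvar t) (expoly t) j)) (lev (cvar t) (to_laurent (expoly t j)))"

lemma lev_dual_expoly:
  "exchange_system E \<Longrightarrow> lev (dual x E j) (to_laurent (E j)) = lev x (to_laurent (E j))"
  using exchange_systemD(1)[of E j] by (simp add: dual_free)

lemma prime_subring_dual: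
  assumes "laurent_indep x" "exchange_system E"
  shows "prime_subring (lring (dual x E j)) (lev x (to_laurent (E j)))"
  using prime_subring_lring[OF laurent_indep_dual[OF assms] exchange_systemD(2)[OF assms(2)], of j j]
  by (simp add: lev_dual_expoly[OF assms(2)])

text \<open>
  By the choice of the exchange exponents, the exchange Laurent polynomial at \<open>i\<close> lies in the Laurent
  ring of the dual point at \<open>j\<close> and is not divisible by \<open>E_j\<close> there.
\<close>

lemma exchange_value:
  fixes x :: "'i::{finite,linorder} \<Rightarrow> 'f" and E :: "'i \<Rightarrow> ('i, 's) mpoly"
  assumes x: "laurent_indep x" and E: "exchange_system E" and ij: "j \<noteq> i"
  obtains W where "lev x (exchange_laurent E i) = lev (dual x E j) W" "\<not> to_laurent (E j) dvd W"
    "free_of i (E j) \<Longrightarrow> free_of i W"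
proof -
  let ?y = "dual x E j"
  have y: "laurent_indep ?y" by (rule laurent_indep_dual[OF x E])
  interpret l: unital_hom "lev ?y" using y by (intro lev_hom laurent_indepD)
  obtain m where m: "lookup m i = 0"
    "lev x (exchange_laurent E i) * lev ?y (to_laurent (E j)) ^ exchange_exps E i j
       = lev ?y (exchange_subst E i j * single m 1)"
    using exchange_subst_eval[OF y E ij, of "exchange_exps E i"]
    unfolding dual_dual[OF x E] exchange_laurent_altdef by metis
  obtain W where W: "exchange_subst E i j = to_laurent (E j) ^ exchange_exps E i j * W"
    using exchange_exps(2)[OF E ij] by (auto elim: dvdE)
  have E0: "to_laurent (E j) \<noteq> 0" by (rule exchange_systemD[OF E])
  have e0: "lev ?y (to_laurent (E j)) \<noteq> 0" using y E0 by (auto simp: laurent_indep_def)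
  have "lev x (exchange_laurent E i) * lev ?y (to_laurent (E j)) ^ exchange_exps E i j =
      lev ?y (W * single m 1) * lev ?y (to_laurent (E j)) ^ exchange_exps E i j"
    unfolding m(2) W l.hom_mult l.hom_power by (simp only: ac_simps)
  then have 1: "lev x (exchange_laurent E i) = lev ?y (W * single m 1)" using e0 by simp
  have 2: "\<not> to_laurent (E j) dvd W * single m 1"
  proof
    assume "to_laurent (E j) dvd W * single m 1"
    then have "to_laurent (E j) dvd W" using monomial_unit by (rule dvd_mult_unitD)
    then have "to_laurent (E j) ^ exchange_exps E i j * to_laurent (E j) dvd exchange_subst E i j"
      unfolding W by (intro mult_dvd_mono) auto
    then show False using exchange_exps(3)[OF E ij] by (simp add: mult.commute)
  qed
  have 3: "free_of i (W * single m 1)" if "free_of i (E j)"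
  proof -
    have "free_of i (exchange_subst E i j)"
      unfolding exchange_subst_def
    proof (rule free_of_mpoly_eval)
      show "free_of i (E i)" by (rule exchange_systemD[OF E])
      fix l assume "l \<noteq> i"
      then show "free_of i ((mvar(j := to_laurent (E j) * single (single j (- 1)) 1)) l)"
        using ij that by (auto intro!: free_of_mult mvar_power_free simp: free_of_single lookup_single)
    qed
    then have "free_of i (to_laurent (E j) ^ exchange_exps E i j * W)" by (simp only: W)
    then have "free_of i W"
      using that E0 free_of_cancel[of i "to_laurent (E j) ^ exchange_exps E i j" W]
      by (simp add: free_of_power)
    then show ?thesis using m(1) by (intro free_of_mult) (auto simp: free_of_single)
  qed
  show ?thesis using that 1 2 3 by blast
qed

text \<open>
  The exchange exponent is the value of \<open>E_i\<close> in the valuation ring at \<open>j\<close>, where \<open>x_j\<close> has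
  value \<open>1\<close>.
\<close>

lemma exchange_exponent_unit:
  fixes x :: "'i::{finite,linorder} \<Rightarrow> 'f" and E :: "'i \<Rightarrow> ('i, 's) mpoly"
  assumes x: "laurent_indep x" and E: "exchange_system E" and ij: "j \<noteq> i"
  shows "loc_unit (lring (dual x E j)) (lev x (to_laurent (E j)))
    (lev x (to_laurent (E i)) * x j powi (- int (exchange_exps E i j)))"
proof -
  let ?y = "dual x E j" and ?a = "exchange_exps E i" and ?e = "lev x (to_laurent (E j))"
  note y = laurent_indep_dual[OF x E, of j]
  interpret prime_subring "lring ?y" ?e by (rule prime_subring_dual[OF x E])
  have x0: "x l \<noteq> 0" for l using x by (rule laurent_indepD)
  obtain W where W: "lev x (exchange_laurent E i) = lev ?y W" "\<not> to_laurent (E j) dvd W"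
    using exchange_value[OF x E ij] by blast
  have u: "loc_unit (lring ?y) ?e (lev x (exchange_laurent E i))"
    using loc_unit_lring(2)[OF y exchange_systemD(2)[OF E] W(2)] W(1) by (simp add: lev_dual_expoly[OF E])
  have ux: "loc_unit (lring ?y) ?e (x l powi n)" if "l \<noteq> j" for l n
  proof -
    have "?y l = x l" using that by (simp add: dual_def)
    then have "loc_unit (lring ?y) ?e (x l)"
      using loc_unit_lring(1)[OF y exchange_systemD(2)[OF E], of j l] by (simp add: lev_dual_expoly[OF E])
    then show ?thesis by (rule loc_unit_power_int)
  qed
  define M where "M = (\<Prod>l\<in>-{i}-{j}. x l powi (- int (?a l)))"
  have uM: "loc_unit (lring ?y) ?e M" unfolding M_def by (intro loc_unit_prod ux) auto
  have "lev x (exchange_laurent E i) = lev x (to_laurent (E i)) * (x j powi (- int (?a j)) * M)"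
    unfolding exchange_laurent_altdef lev_divide_by_monomial[OF x0] M_def
    using ij by (subst prod.remove[of _ j]) auto
  then have "lev x (to_laurent (E i)) * x j powi (- int (?a j)) = lev x (exchange_laurent E i) / M"
    using uM by (simp add: loc_unit_def)
  then show ?thesis using u uM loc_unit_divide by simp
qed

lemma lring_scale:
  assumes y: "laurent_indep y" and u: "u \<in> lring y" "inverse u \<in> lring y"
  shows "lring (y(j := u * y j)) \<subseteq> lring y"
proof (rule laurent_ring_least)
  note R = subring_laurent_ring[of y, OF laurent_indepD[OF y]]
  show R': "subring_of (lring y)" by (rule R)
  show "\<phi> c \<in> lring y" for c by (rule laurent_ring_mem)
  show "(y(j := u * y j)) i \<in> lring y" "inverse ((y(j := u * y j)) i) \<in> lring y" for i
    using subring_mult[OF R u(1) laurent_ring_mem(3)[of y j]]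
      subring_mult[OF R u(2) laurent_ring_mem(5)[of y j]] laurent_ring_mem(3,5)[of y i] by auto
qed

lemma lring_exchange:
  fixes x :: "'i::{finite,linorder} \<Rightarrow> 'f" and E :: "'i \<Rightarrow> ('i, 's) mpoly"
  assumes x: "laurent_indep x" and E: "exchange_system E"
  shows "lring (x(j := lev x (exchange_laurent E j) / x j)) = lring (dual x E j)"
proof -
  let ?y = "dual x E j" and ?z = "x(j := lev x (exchange_laurent E j) / x j)"
  have y: "laurent_indep ?y" by (rule laurent_indep_dual[OF x E])
  have z: "laurent_indep ?z" by (intro laurent_indep_exchange x exchange_laurent_props E)
  have x0: "x l \<noteq> 0" for l using x by (rule laurent_indepD)
  define u where "u = (\<Prod>l\<in>-{j}. x l powi (- int (exchange_exps E j l)))"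
  have u0: "u \<noteq> 0" using x0 by (simp add: u_def)
  have uw: "u \<in> lring w \<and> inverse u \<in> lring w" if w: "\<And>l. l \<noteq> j \<Longrightarrow> w l = x l" "laurent_indep w" for w
  proof -
    note R = subring_laurent_ring[of w, OF laurent_indepD[OF w(2)]]
    have x_powi: "x l powi n \<in> lring w" if "l \<noteq> j" for l n using laurent_ring_mem(4)[of w l n] w(1)[OF that] by simp
    have "inverse u = (\<Prod>l\<in>-{j}. x l powi int (exchange_exps E j l))"
      unfolding u_def by (simp add: prod_inversef[symmetric] power_int_minus)
    also have "\<dots> \<in> lring w" by (rule subring_prod[OF R]) (rule x_powi, simp)
    finally have "inverse u \<in> lring w" .
    moreover have "u \<in> lring w" unfolding u_def by (rule subring_prod[OF R]) (rule x_powi, simp)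
    ultimately show ?thesis by simp
  qed
  have zy: "?z = ?y(j := u * ?y j)"
    unfolding exchange_laurent_altdef lev_divide_by_monomial[OF x0] u_def[symmetric]
    by (simp add: dual_def fun_eq_iff)
  have "?y(j := u * ?y j, j := inverse u * (u * ?y j)) = ?y"
    using u0 by (simp add: mult.assoc[symmetric])
  then have yz: "?y = ?z(j := inverse u * ?z j)" unfolding zy by simp
  have A: "lring (?y(j := u * ?y j)) \<subseteq> lring ?y"
    using uw[of ?y] y by (intro lring_scale) (auto simp: dual_def)
  have B: "lring (?z(j := inverse u * ?z j)) \<subseteq> lring ?z"
    using uw[of ?z] z by (intro lring_scale) auto
  show ?thesis
  proof
    show "lring ?z \<subseteq> lring ?y" by (subst zy) (rule A)
    show "lring ?y \<subseteq> lring ?z" by (subst yz) (rule B)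
  qed
qed

text \<open>
  For \<open>f\<close> in the Laurent ring of \<open>x\<close> some \<open>f E_j^n\<close> lies in that of the dual point, since
  \<open>1 / x_j = y_j / E_j\<close>; powers of \<open>E_j\<close> can be cancelled inside the localisation.
\<close>

lemma mem_dual_iff_mem_loc:
  assumes x: "laurent_indep x" and E: "exchange_system E" and f: "f \<in> lring x"
  shows "f \<in> lring (dual x E j) \<longleftrightarrow> f \<in> loc (lring (dual x E j)) (lev x (to_laurent (E j)))"
proof
  let ?y = "dual x E j" and ?e = "lev x (to_laurent (E j))"
  interpret prime_subring "lring ?y" ?e by (rule prime_subring_dual[OF x E])
  note y = laurent_indep_dual[OF x E, of j]
  show "f \<in> lring ?y \<Longrightarrow> f \<in> loc (lring ?y) ?e" using subset_loc by blast
  have x0: "x l \<noteq> 0" for l using x by (rule laurent_indepD)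
  have eN: "?e \<in> lring ?y" by (rule prime_inD(1)[OF e])
  have e0: "?e \<noteq> 0" by (rule prime_inD(2)[OF e])
  define S where "S = {f. \<exists>n. f * ?e ^ n \<in> lring ?y}"
  have S: "subring_of S" and "lring ?y \<subseteq> S"
    unfolding S_def by (rule subring_saturation[OF N eN])+
  then have sub: "g \<in> S" if "g \<in> lring ?y" for g using that by blast
  have "x l \<in> S \<and> inverse (x l) \<in> S" for l
  proof (cases "l = j")
    case True
    have "?y j = ?e * inverse (x j)" by (simp add: dual_def divide_inverse)
    then have eq: "inverse (x j) * ?e ^ 1 = ?y j" "x j = ?e * inverse (?y j)" using e0 x0[of j] by simp_all
    have "inverse (x j) * ?e ^ 1 \<in> lring ?y" unfolding eq(1) by (rule laurent_ring_mem)
    moreover have "x j \<in> lring ?y"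
      using subring_mult[OF N eN laurent_ring_mem(5)[of ?y j]] by (simp only: eq(2)[symmetric])
    ultimately have "inverse (x j) \<in> S" "x j \<in> S" using sub unfolding S_def by blast+
    then show ?thesis using True by simp
  next
    case False
    then have "?y l = x l" by (simp add: dual_def)
    then show ?thesis using sub[OF laurent_ring_mem(3)[of ?y l]] sub[OF laurent_ring_mem(5)[of ?y l]] by simp
  qed
  then have "lring x \<subseteq> S" using sub[OF laurent_ring_mem(2)] by (intro laurent_ring_least S) auto
  then obtain n where "f * ?e ^ n \<in> lring ?y" using f by (auto simp: S_def)
  then show "f \<in> lring ?y" if "f \<in> loc (lring ?y) ?e" using mem_of_mult_power[OF that] by blast
qed

lemma lp_mutationD:
  assumes "lp_mutation \<phi> k t t'"
  shows "cvar t' = (cvar t)(k := lev (cvar t) (exchange_laurent (expoly t) k) / cvar t k)"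
    "expoly t' k = expoly t k"
    "j \<noteq> k \<Longrightarrow> \<not> free_of k (expoly t j) \<Longrightarrow> mutated_expoly (expoly t) k j (expoly t' j)"
    "j \<noteq> k \<Longrightarrow> free_of k (expoly t j) \<Longrightarrow> expoly t' j = expoly t j"
  using assms unfolding lp_mutation_def involves_iff by (simp, simp, metis, metis)

lemma good_seed_mutation:
  assumes t: "good_seed t" and m: "lp_mutation \<phi> k t t'"
  shows "good_seed t'"
proof -
  note M = lp_mutationD[OF m]
  have x: "laurent_indep (cvar t)" and E: "exchange_system (expoly t)" using t by (auto simp: good_seed_def)
  have "laurent_indep (cvar t')"
    unfolding M(1) by (intro laurent_indep_exchange x exchange_laurent_props E)
  moreover have "free_of j (expoly t' j) \<and> prime_elem (to_laurent (expoly t' j)) \<and> (\<forall>l. \<not> mvar l dvd expoly t' j)" for j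
  proof -
    consider "j = k" | "j \<noteq> k" "free_of k (expoly t j)" | "j \<noteq> k" "\<not> free_of k (expoly t j)" by blast
    then show ?thesis
    proof cases
      case 1
      then show ?thesis using M(2) exchange_systemD[OF E] by simp
    next
      case 2
      then show ?thesis using M(4) exchange_systemD[OF E] by simp
    next
      case 3
      note F = M(3)[OF 3]
      have "free_of j (expoly t' j)" using mutated_expoly_relation[OF x E 3 F] by metis
      moreover have "\<forall>l. \<not> mvar l dvd expoly t' j" using F by (auto simp: mutated_expoly_def)
      ultimately show ?thesis using mutated_expoly_prime(1)[OF x E 3 F] by blast
    qed
  qed
  ultimately show ?thesis by (auto simp: good_seed_def exchange_system_def)
qed

lemma mutation_exists:
  assumes "good_seed t"
  shows "\<exists>t'. lp_mutation \<phi> k t t'"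
proof -
  have E: "exchange_system (expoly t)" using assms by (auto simp: good_seed_def)
  define F where "F j = (if j = k \<or> free_of k (expoly t j) then expoly t j
    else (SOME F. mutated_expoly (expoly t) k j F))" for j
  have "mutated_expoly (expoly t) k j (F j)" if "j \<noteq> k" "\<not> free_of k (expoly t j)" for j
    using someI_ex[OF mutated_expoly_exists[OF E that]] that by (simp add: F_def)
  then have "lp_mutation \<phi> k t \<lparr>cvar = (cvar t)(k := lev (cvar t) (exchange_laurent (expoly t) k) / cvar t k), expoly = F\<rparr>"
    by (simp add: lp_mutation_def involves_iff F_def)
  then show ?thesis by blast
qed

lemma seed_ring_mutation:
  assumes t: "good_seed t" and m: "lp_mutation \<phi> j t t'"
  shows "seed_ring \<phi> t' = lring (dual (cvar t) (expoly t) j)"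
    "f \<in> seed_ring \<phi> t \<Longrightarrow> f \<in> seed_ring \<phi> t' \<longleftrightarrow> f \<in> seed_loc t j"
proof -
  have x: "laurent_indep (cvar t)" and E: "exchange_system (expoly t)" using t by (auto simp: good_seed_def)
  show 1: "seed_ring \<phi> t' = lring (dual (cvar t) (expoly t) j)"
    unfolding seed_ring_def lp_mutationD(1)[OF m] by (rule lring_exchange[OF x E])
  show "f \<in> seed_ring \<phi> t' \<longleftrightarrow> f \<in> seed_loc t j" if f: "f \<in> seed_ring \<phi> t"
    unfolding 1 seed_loc_def by (rule mem_dual_iff_mem_loc[OF x E]) (use f in \<open>simp add: seed_ring_def\<close>)
qed

text \<open>
  The two cases are whether \<open>E_j\<close> is left alone by the mutation or changed by it.
\<close>

theorem seed_loc_mutation: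
  assumes t: "good_seed t" and m: "lp_mutation \<phi> k t t'" and jk: "j \<noteq> k"
  shows "seed_loc t' j = seed_loc t j"
proof -
  note M = lp_mutationD[OF m]
  have t': "good_seed t'" using t m by (rule good_seed_mutation)
  define x where "x = cvar t"
  define E where "E = expoly t"
  define x' where "x' = cvar t'"
  define E' where "E' = expoly t'"
  note defs = x_def[symmetric] E_def[symmetric] x'_def[symmetric] E'_def[symmetric]
  note M = M[unfolded defs]
  have x: "laurent_indep x" and E: "exchange_system E" and x': "laurent_indep x'" and E': "exchange_system E'"
    using t t' by (auto simp: good_seed_def x_def E_def x'_def E'_def)
  note y = laurent_indep_dual[OF x E, of j] and y' = laurent_indep_dual[OF x' E', of j]
  show ?thesis
  proof (cases "free_of k (E j)")
    case True
    have Ej: "E' j = E j" using M(4) jk True by simp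
    obtain W where W: "lev x (exchange_laurent E k) = lev (dual x E j) W" "\<not> to_laurent (E j) dvd W" "free_of k W"
      using exchange_value[OF x E jk] True by blast
    have ex: "lev x' (to_laurent (E j)) = lev x (to_laurent (E j))"
      unfolding M(1) using True by (simp add: lev_free)
    have "dual x' E' j = (dual x E j)(k := lev (dual x E j) W / dual x E j k)"
      unfolding dual_def[of x' E'] Ej ex W(1)[symmetric] using jk
      by (auto simp: fun_eq_iff dual_def M(1))
    then have "loc (lring (dual x' E' j)) (lev (dual x' E' j) (to_laurent (E j))) =
        loc (lring (dual x E j)) (lev (dual x E j) (to_laurent (E j)))"
      using True W by (intro loc_eq_free[OF y y' exchange_systemD(2)[OF E]]) auto
    then show ?thesis
      unfolding seed_loc_def defs using lev_dual_expoly[OF E, of x j] lev_dual_expoly[OF E', of x' j]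
      by (simp add: Ej)
  next
    case False
    note F = M(3)[OF jk False]
    note T = exchange_laurent_hcomp[OF E jk False]
    obtain C D n where C: "free_of j C" "free_of k C" "C \<noteq> 0" and D: "free_of j D" "free_of k D" "D dvd 1"
      and rel: "\<And>X. X \<noteq> 0 \<Longrightarrow> lev x C * lev (x(k := X)) (to_laurent (E' j)) =
        lev x D * X powi n * lev (x(k := lev x (hcomp j 0 (exchange_laurent E k)) / X)) (to_laurent (E j))"
      using mutated_expoly_relation[OF x E jk False F] by metis
    have "D \<noteq> 0" using D by auto
    moreover have "prime_elem (to_laurent G) \<and> free_of j G \<and> \<not> free_of k G \<and> \<not> mvar k dvd G" if "G \<in> {E j, E' j}" for G
      using that exchange_systemD[OF E] exchange_systemD[OF E'] False mutated_expoly_prime(2)[OF x E jk False F] by blast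
    ultimately have "mutation_pair j k (exchange_laurent E k) x (E j) x' (E' j)"
      unfolding mutation_pair_def
      using jk x x' T(1,2) exchange_laurent_props(1)[OF E] M(1) C D rel by blast
    then show ?thesis
      unfolding seed_loc_def defs dual_def
      by (rule mutation_pair_loc_eq) (use y y' in \<open>simp_all add: dual_def\<close>)
  qed
qed

text \<open>
  The exponents are determined by the local rings at \<open>j \<noteq> k\<close>, and these do not change.
\<close>

lemma exchange_laurent_mutation:
  assumes t: "good_seed t" and m: "lp_mutation \<phi> k t t'"
  shows "exchange_laurent (expoly t') k = exchange_laurent (expoly t) k"
proof -
  note M = lp_mutationD[OF m]
  have t': "good_seed t'" using t m by (rule good_seed_mutation)
  have x: "laurent_indep (cvar t)" and E: "exchange_system (expoly t)"
    and x': "laurent_indep (cvar t')" and E': "exchange_system (expoly t')"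
    using t t' by (auto simp: good_seed_def)
  have "exchange_exps (expoly t') k j = exchange_exps (expoly t) k j" for j
  proof (cases "j = k")
    case True
    then show ?thesis using exchange_exps(1) E E' by metis
  next
    case jk: False
    let ?a = "exchange_exps (expoly t) k j" and ?a' = "exchange_exps (expoly t') k j"
    let ?v = "lev (cvar t) (to_laurent (expoly t k))" and ?c = "cvar t j"
    let ?y = "dual (cvar t) (expoly t) j" and ?e = "lev (cvar t) (to_laurent (expoly t j))"
    interpret prime_subring "lring ?y" ?e by (rule prime_subring_dual[OF x E])
    have c: "cvar t' j = ?c" using M(1) jk by simp
    have v: "lev (cvar t') (to_laurent (expoly t' k)) = ?v"
      unfolding M(1,2) using exchange_systemD(1)[OF E, of k] by (simp add: lev_free)
    have c0: "?c \<noteq> 0" using x by (rule laurent_indepD)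
    have u: "loc_unit (lring ?y) ?e (?v * ?c powi (- int ?a))" by (rule exchange_exponent_unit[OF x E jk])
    have "loc_unit (lring (dual (cvar t') (expoly t') j)) (lev (cvar t') (to_laurent (expoly t' j))) (?v * ?c powi (- int ?a'))"
      using exchange_exponent_unit[OF x' E' jk] unfolding c v .
    then have u': "loc_unit (lring ?y) ?e (?v * ?c powi (- int ?a'))"
      using seed_loc_mutation[OF t m jk] unfolding loc_unit_def seed_loc_def by simp
    have v0: "?v \<noteq> 0" using u by (auto simp: loc_unit_def)
    have "loc_unit (lring ?y) ?e ((?v * ?c powi (- int ?a')) / (?v * ?c powi (- int ?a)))"
      using u' u by (rule loc_unit_divide)
    moreover have "(?v * ?c powi (- int ?a')) / (?v * ?c powi (- int ?a)) = ?c powi (int ?a - int ?a')"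
      using v0 c0 by (simp add: power_int_diff power_int_minus field_simps)
    ultimately have uc: "loc_unit (lring ?y) ?e (?c powi (int ?a - int ?a'))" by simp
    have uy: "loc_unit (lring ?y) ?e (?y j powi (int ?a - int ?a'))"
      using loc_unit_lring(1)[OF laurent_indep_dual[OF x E] exchange_systemD(2)[OF E], of j j j]
      by (intro loc_unit_power_int) (simp add: lev_dual_expoly[OF E])
    have "?e = ?c * ?y j" using c0 by (simp add: dual_def)
    then have "?e powi (int ?a - int ?a') = ?c powi (int ?a - int ?a') * ?y j powi (int ?a - int ?a')"
      by (simp add: power_int_mult_distrib)
    then have "loc_unit (lring ?y) ?e (?e powi (int ?a - int ?a'))" using loc_unit_mult[OF uc uy] by simp
    then have "int ?a - int ?a' = 0" by (rule loc_unit_prime_powi)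
    then show ?thesis by simp
  qed
  then have "exchange_exps (expoly t') k = exchange_exps (expoly t) k" by blast
  then show ?thesis by (simp add: exchange_laurent_altdef divide_by_monomial_def M(2))
qed

lemma mutation_involutive:
  assumes t: "good_seed t" and m: "lp_mutation \<phi> k t t'" and m': "lp_mutation \<phi> k t' t''"
  shows "cvar t'' = cvar t"
proof -
  note M = lp_mutationD(1)[OF m]
  have x: "laurent_indep (cvar t)" and E: "exchange_system (expoly t)" using t by (auto simp: good_seed_def)
  have "exchange_laurent (expoly t) k \<noteq> 0" "free_of k (exchange_laurent (expoly t) k)"
    using exchange_laurent_props[OF E] by auto
  then have "lev (cvar t) (exchange_laurent (expoly t) k) \<noteq> 0"
    "lev (cvar t') (exchange_laurent (expoly t) k) = lev (cvar t) (exchange_laurent (expoly t) k)"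
    unfolding M using x by (auto simp: laurent_indep_def lev_free)
  then show ?thesis
    using laurent_indepD[OF x, of k]
    unfolding lp_mutationD(1)[OF m'] exchange_laurent_mutation[OF t m] by (auto simp: M fun_eq_iff)
qed

section \<open>Invariance of the upper bound\<close>

lemma mem_upper_bound_iff:
  assumes t: "good_seed t"
  shows "f \<in> upper_bound \<phi> t \<longleftrightarrow> f \<in> seed_ring \<phi> t \<and> (\<forall>j. f \<in> seed_loc t j)"
proof -
  have "(\<forall>t'. lp_mutation \<phi> j t t' \<longrightarrow> f \<in> seed_ring \<phi> t') \<longleftrightarrow> f \<in> seed_loc t j" if "f \<in> seed_ring \<phi> t" for j
    using seed_ring_mutation(2)[OF t _ that] mutation_exists[OF t] by metis
  then show ?thesis by (auto simp: upper_bound_def)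
qed

theorem upper_bound_mutation:
  assumes t: "good_seed t" and m: "lp_mutation \<phi> k t t'"
  shows "upper_bound \<phi> t = upper_bound \<phi> t'"
proof -
  have t': "good_seed t'" using t m by (rule good_seed_mutation)
  obtain t'' where m': "lp_mutation \<phi> k t' t''" using mutation_exists[OF t'] by blast
  have "seed_ring \<phi> t'' = seed_ring \<phi> t" by (simp add: seed_ring_def mutation_involutive[OF t m m'])
  then have k': "f \<in> seed_ring \<phi> t' \<Longrightarrow> f \<in> seed_ring \<phi> t \<longleftrightarrow> f \<in> seed_loc t' k" for f
    using seed_ring_mutation(2)[OF t' m'] by simp
  have "f \<in> upper_bound \<phi> t \<longleftrightarrow> f \<in> upper_bound \<phi> t'" for f
    unfolding mem_upper_bound_iff[OF t] mem_upper_bound_iff[OF t']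
    using seed_ring_mutation(2)[OF t m, of f] k'[of f] seed_loc_mutation[OF t m] by metis
  then show ?thesis by blast
qed

lemma good_seed_pattern:
  assumes "good_seed t" "s \<in> lp_pattern \<phi> t"
  shows "good_seed s \<and> upper_bound \<phi> s = upper_bound \<phi> t"
proof -
  have "(\<lambda>u u'. \<exists>i. lp_mutation \<phi> i u u')\<^sup>*\<^sup>* t s" using assms(2) by (simp add: lp_pattern_def)
  then show ?thesis
  proof (induction rule: rtranclp_induct)
    case base
    then show ?case using assms(1) by simp
  next
    case (step u u')
    then show ?case using good_seed_mutation upper_bound_mutation by blast
  qed
qed

theorem upper_bound_eq_upper_algebra:
  assumes t: "good_seed t"
  shows "upper_bound \<phi> t = upper_lp_algebra \<phi> t"
proof
  show "upper_bound \<phi> t \<subseteq> upper_lp_algebra \<phi> t"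
    using good_seed_pattern[OF t] by (auto simp: upper_lp_algebra_def upper_bound_def)
  have "t \<in> lp_pattern \<phi> t" by (simp add: lp_pattern_def)
  moreover have "t' \<in> lp_pattern \<phi> t" if "lp_mutation \<phi> i t t'" for i t'
    using that by (auto simp: lp_pattern_def)
  ultimately show "upper_lp_algebra \<phi> t \<subseteq> upper_bound \<phi> t"
    by (auto simp: upper_lp_algebra_def upper_bound_def)
qed

text \<open>Denominators are cleared, and a polynomial over \<open>S\<close> is read as one over the field of fractions.\<close>

lemma laurent_indep_of_algebraically_independent:
  fixes x :: "'i::{finite,linorder} \<Rightarrow> 'f"
  assumes inj: "inj \<phi>" and ai: "algebraically_independent_over (fraction_subfield \<phi>) x"
  shows "laurent_indep x"
proof -
  have phi0: "\<phi> c = 0 \<longleftrightarrow> c = 0" for c using inj_eq[OF inj, of c 0] by (simp add: hom_zero)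
  have frac: "\<phi> c \<in> fraction_subfield \<phi>" for c
    unfolding fraction_subfield_def mem_Collect_eq
    by (rule exI[of _ c], rule exI[of _ 1]) (simp add: hom_one)
  have inj_eval: "p = 0" if p: "mpoly_eval \<phi> x p = 0" for p
  proof -
    define q where "q = Poly_Mapping.map \<phi> p"
    have q: "lookup q m = \<phi> (lookup p m)" for m
      by (simp add: q_def map.rep_eq when_def hom_zero)
    have "keys q = keys p" by (auto simp: in_keys_iff q phi0)
    then have "mpoly_eval (\<lambda>c. c) x q = 0" using p by (simp add: mpoly_eval_def q)
    moreover have "range (lookup q) \<subseteq> fraction_subfield \<phi>" using frac by (auto simp: q)
    ultimately have "q = 0" using ai by (auto simp: algebraically_independent_over_def)
    then show "p = 0" using q phi0 by (intro poly_mapping_eqI) (metis lookup_zero)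
  qed
  have x0: "x i \<noteq> 0" for i
  proof
    assume "x i = 0"
    then have "mpoly_eval \<phi> x (mvar i) = 0" by (simp add: mpoly_eval_mvar[OF phi_hom])
    then have "(mvar i :: ('i, 's) mpoly) = 0" by (rule inj_eval)
    then show False by simp
  qed
  interpret l: unital_hom "lev x" by (rule lev_hom) (rule x0)
  have "P = 0" if P: "lev x P = 0" for P
  proof -
    obtain m p where p: "P * single (lift_exp m) 1 = to_laurent p" by (rule clear_denominators)
    have "mpoly_eval \<phi> x p = lev x (to_laurent p)" by (simp add: laurent_eval_to_laurent[OF phi_hom x0])
    also have "\<dots> = 0" by (simp flip: p add: l.hom_mult P)
    finally have "P * single (lift_exp m) 1 = 0" using p inj_eval by (simp add: tl.hom_zero)
    then show "P = 0" by simp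
  qed
  then show ?thesis using x0 by (auto simp: laurent_indep_def)
qed

end

theorem theorem1p3:
  fixes emb :: "'s::{factorial_semiring,idom} \<Rightarrow> 'f::field"
    and t0 :: "('i::{finite,linorder}, 's, 'f) lp_seed"
  assumes "ring_embedding emb"
    and "is_lp_seed emb t0"
  shows "(\<forall>t\<in>lp_pattern emb t0. \<forall>k t'. lp_mutation emb k t t' \<longrightarrow>
            upper_bound emb t = upper_bound emb t') \<and>
         (\<forall>t\<in>lp_pattern emb t0. upper_bound emb t = upper_lp_algebra emb t)"
proof -
  interpret factorial_hom emb
    using assms(1) by unfold_locales (auto simp: ring_embedding_def)
  have "laurent_indep (cvar t0)"
    using assms by (intro laurent_indep_of_algebraically_independent) (auto simp: ring_embedding_def is_lp_seed_def)
  moreover have "exchange_system (expoly t0)"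
    using assms(2) irreducible_prime_to_laurent
    by (auto simp: is_lp_seed_def exchange_system_def involves_iff)
  ultimately have "good_seed t0" by (simp add: good_seed_def)
  then show ?thesis
    using good_seed_pattern upper_bound_mutation upper_bound_eq_upper_algebra by blast
qed

end
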